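(* Let $m\geq 3$ be a positive integer and let $1\leq p_{0}<m^{*}<p_1$. Then for all $\theta\in(0,1)$ $$\big[\,\widehat\otimes_{i=1,\varepsilon}^{m}\ell_{p_{0}},\ \widehat\otimes_{i=1,\varepsilon}^{m}\ell_{p_{1}}\big]_{\theta}\ \ncong\ \widehat\otimes_{i=1,\varepsilon}^{m}\ell_{p_{\theta}},$$ that is, the two spaces are not isomorphic, where $\frac{1}{p_{\theta}}=\frac{1-\theta}{p_{0}}+\frac{\theta}{p_{1}}$.
   Context: All spaces are complex Banach spaces. $m^*=\frac{m}{m-1}$ is the conjugate exponent of $m$. $\widehat\otimes_{i=1,\varepsilon}^{m}\ell_p=\ell_p\widehat\otimes_\varepsilon\cdots\widehat\otimes_\varepsilon\ell_p$ ($m$ factors) is the completed $m$-fold injective tensor product of $\ell_p$. $[\cdot,\cdot]_\theta$ denotes the complex interpolation space of parameter $\theta$. The symbol $\ncong$ means "is not isomorphic to". *)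

theory Defs
  imports "HOL-Analysis.Analysis"
begin

(* A normed space whose vectors are functions 'i => complex with the pointwise operations.
   Completed tensor products and interpolation spaces depend on numerical parameters, so they
   cannot be types; they are represented by a carrier and a norm that matters only on it. *)

record 'i fspace =
  vecs :: "('i \<Rightarrow> complex) set"
  nrm :: "('i \<Rightarrow> complex) \<Rightarrow> real"

definition isomorphic :: "'i fspace \<Rightarrow> 'j fspace \<Rightarrow> bool" where
  "isomorphic X Y \<longleftrightarrow>
    (\<exists>T. bij_betw T (vecs X) (vecs Y) \<and>
      (\<forall>x\<in>vecs X. \<forall>y\<in>vecs X. T (\<lambda>i. x i + y i) = (\<lambda>j. T x j + T y j)) \<and>
      (\<forall>c. \<forall>x\<in>vecs X. T (\<lambda>i. c * x i) = (\<lambda>j. c * T x j)) \<and>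
      (\<exists>C. \<forall>x\<in>vecs X. nrm Y (T x) \<le> C * nrm X x) \<and>
      (\<exists>C. \<forall>x\<in>vecs X. nrm X x \<le> C * nrm Y (T x)))"

definition ell :: "real \<Rightarrow> nat fspace" where
  "ell p =
    \<lparr>vecs = {x. summable (\<lambda>n. norm (x n) powr p)},
     nrm = (\<lambda>x. (\<Sum>n. norm (x n) powr p) powr (1 / p))\<rparr>"


subsection \<open>Completed injective tensor powers\<close>

(* Closed unit ball of the dual.  Values of a functional outside the carrier are irrelevant. *)
definition dual_ball :: "'i fspace \<Rightarrow> (('i \<Rightarrow> complex) \<Rightarrow> complex) set" where
  "dual_ball X =
    {\<phi>. (\<forall>x\<in>vecs X. \<forall>y\<in>vecs X. \<phi> (\<lambda>i. x i + y i) = \<phi> x + \<phi> y) \<and>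
        (\<forall>c. \<forall>x\<in>vecs X. \<phi> (\<lambda>i. c * x i) = c * \<phi> x) \<and>
        (\<forall>x\<in>vecs X. norm (\<phi> x) \<le> nrm X x)}"

definition dual_tuples ::
  "nat \<Rightarrow> 'i fspace \<Rightarrow> (('i \<Rightarrow> complex) \<Rightarrow> complex) list set" where
  "dual_tuples m X = {\<phi>s. length \<phi>s = m \<and> set \<phi>s \<subseteq> dual_ball X}"

(* x1 \<otimes> ... \<otimes> xm, as the function (f1, ..., fm) |-> f1(x1) ... fm(xm) on m-tuples from the dual
   unit ball; this realisation of the algebraic tensor product is the one whose sup norm is
   the injective norm. *)
definition elem_tensor ::
  "nat \<Rightarrow> 'i fspace \<Rightarrow> ('i \<Rightarrow> complex) list \<Rightarrow> (('i \<Rightarrow> complex) \<Rightarrow> complex) list \<Rightarrow> complex" where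
  "elem_tensor m X xs =
    (\<lambda>\<phi>s. if \<phi>s \<in> dual_tuples m X then (\<Prod>k<m. (\<phi>s ! k) (xs ! k)) else 0)"

definition alg_tensor_power ::
  "nat \<Rightarrow> 'i fspace \<Rightarrow> ((('i \<Rightarrow> complex) \<Rightarrow> complex) list \<Rightarrow> complex) set" where
  "alg_tensor_power m X =
    {\<lambda>\<phi>s. \<Sum>j<n. c j * elem_tensor m X (xs j) \<phi>s | (n::nat) (c :: nat \<Rightarrow> complex) xs.
      \<forall>j<n. length (xs j) = m \<and> set (xs j) \<subseteq> vecs X}"

(* The completion is the closure of the algebraic tensor product in the Banach space of
   bounded functions on the m-tuples. *)
definition inj_tensor_power ::
  "nat \<Rightarrow> 'i fspace \<Rightarrow> (('i \<Rightarrow> complex) \<Rightarrow> complex) list fspace" where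
  "inj_tensor_power m X =
    \<lparr>vecs = {u. (\<forall>\<phi>s. \<phi>s \<notin> dual_tuples m X \<longrightarrow> u \<phi>s = 0) \<and>
                (\<forall>e>0. \<exists>v\<in>alg_tensor_power m X. \<forall>\<phi>s\<in>dual_tuples m X. norm (u \<phi>s - v \<phi>s) \<le> e)},
     nrm = (\<lambda>u. SUP \<phi>s\<in>dual_tuples m X. norm (u \<phi>s))\<rparr>"

(* The array of coefficients of a tensor: entry (i1, ..., im) is its value at the coordinate
   functionals with these indices. *)
definition coeffs ::
  "((('i \<Rightarrow> complex) \<Rightarrow> complex) list \<Rightarrow> complex) \<Rightarrow> 'i list \<Rightarrow> complex" where
  "coeffs u = (\<lambda>is. u (map (\<lambda>i x. x i) is))"

(* The completed m-fold injective tensor power of l_p, transported isometrically along coeffs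
   (injective by inj_on_coeffs below) to a space of arrays indexed by lists of length m.  For
   different p these spaces thereby lie in one common space of arrays, with the identification
   induced by the inclusions between the l_p spaces, and so form compatible couples. *)
definition ell_inj_tensor :: "nat \<Rightarrow> real \<Rightarrow> nat list fspace" where
  "ell_inj_tensor m p =
    \<lparr>vecs = coeffs ` vecs (inj_tensor_power m (ell p)),
     nrm = (\<lambda>a. nrm (inj_tensor_power m (ell p))
                  (inv_into (vecs (inj_tensor_power m (ell p))) coeffs a))\<rparr>"


subsection \<open>Complex interpolation\<close>

definition sum_space :: "'i fspace \<Rightarrow> 'i fspace \<Rightarrow> 'i fspace" where
  "sum_space X0 X1 =
    \<lparr>vecs = {\<lambda>i. x i + y i | x y. x \<in> vecs X0 \<and> y \<in> vecs X1},
     nrm = (\<lambda>z. Inf {nrm X0 x + nrm X1 y | x y.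
                  x \<in> vecs X0 \<and> y \<in> vecs X1 \<and> z = (\<lambda>i. x i + y i)})\<rparr>"

definition strip :: "complex set" where
  "strip = {z. 0 \<le> Re z \<and> Re z \<le> 1}"

definition bounded_into :: "'i fspace \<Rightarrow> complex set \<Rightarrow> (complex \<Rightarrow> 'i \<Rightarrow> complex) \<Rightarrow> bool" where
  "bounded_into X S f \<longleftrightarrow> (\<exists>B. \<forall>z\<in>S. nrm X (f z) \<le> B)"

definition continuous_into ::
  "'i fspace \<Rightarrow> 'a::topological_space set \<Rightarrow> ('a \<Rightarrow> 'i \<Rightarrow> complex) \<Rightarrow> bool" where
  "continuous_into X S f \<longleftrightarrow>
    (\<forall>z\<in>S. ((\<lambda>w. nrm X (\<lambda>i. f w i - f z i)) \<longlongrightarrow> 0) (at z within S))"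

definition holomorphic_into :: "'i fspace \<Rightarrow> complex set \<Rightarrow> (complex \<Rightarrow> 'i \<Rightarrow> complex) \<Rightarrow> bool" where
  "holomorphic_into X S f \<longleftrightarrow>
    (\<forall>z\<in>S. \<exists>d\<in>vecs X.
      ((\<lambda>w. nrm X (\<lambda>i. (f w i - f z i) / (w - z) - d i)) \<longlongrightarrow> 0) (at z within S))"

(* f t for real t, continuous into X and vanishing at plus and minus infinity *)
definition C0_into :: "'i fspace \<Rightarrow> (real \<Rightarrow> 'i \<Rightarrow> complex) \<Rightarrow> bool" where
  "C0_into X f \<longleftrightarrow>
    (\<forall>t. f t \<in> vecs X) \<and> continuous_into X UNIV f \<and> ((\<lambda>t. nrm X (f t)) \<longlongrightarrow> 0) at_infinity"

(* Calderon's space F(X0, X1).  Values of f off the strip are irrelevant. *)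
definition calderon_fun :: "'i fspace \<Rightarrow> 'i fspace \<Rightarrow> (complex \<Rightarrow> 'i \<Rightarrow> complex) set" where
  "calderon_fun X0 X1 =
    {f. (\<forall>z\<in>strip. f z \<in> vecs (sum_space X0 X1)) \<and>
        bounded_into (sum_space X0 X1) strip f \<and>
        continuous_into (sum_space X0 X1) strip f \<and>
        holomorphic_into (sum_space X0 X1) (interior strip) f \<and>
        C0_into X0 (\<lambda>t. f (Complex 0 t)) \<and>
        C0_into X1 (\<lambda>t. f (Complex 1 t))}"

definition calderon_norm ::
  "'i fspace \<Rightarrow> 'i fspace \<Rightarrow> (complex \<Rightarrow> 'i \<Rightarrow> complex) \<Rightarrow> real" where
  "calderon_norm X0 X1 f =
    max (SUP t. nrm X0 (f (Complex 0 t))) (SUP t. nrm X1 (f (Complex 1 t)))"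

definition complex_interpolation :: "'i fspace \<Rightarrow> 'i fspace \<Rightarrow> real \<Rightarrow> 'i fspace" where
  "complex_interpolation X0 X1 \<theta> =
    \<lparr>vecs = {f (of_real \<theta>) | f. f \<in> calderon_fun X0 X1},
     nrm = (\<lambda>x. Inf {calderon_norm X0 X1 f | f.
                  f \<in> calderon_fun X0 X1 \<and> f (of_real \<theta>) = x})\<rparr>"


definition conj_exponent :: "real \<Rightarrow> real" where
  "conj_exponent r = r / (r - 1)"


subsection \<open>Injectivity of the coefficient map\<close>

lemma ell_le_norm:
  assumes "p > 0" "x \<in> vecs (ell p)"
  shows "norm (x i) \<le> nrm (ell p) x"
proof -
  have s: "summable (\<lambda>n. norm (x n) powr p)"
    using assms(2) by (simp add: ell_def)
  have "norm (x i) powr p \<le> (\<Sum>n. norm (x n) powr p)"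
    using sum_le_suminf[OF s, of "{i}"] by simp
  hence "(norm (x i) powr p) powr (1 / p) \<le> (\<Sum>n. norm (x n) powr p) powr (1 / p)"
    using assms(1) by (intro powr_mono2) auto
  thus ?thesis
    using assms(1) by (simp add: powr_powr ell_def)
qed

lemma coord_in_dual_ball:
  assumes "p > 0"
  shows "(\<lambda>x. x i) \<in> dual_ball (ell p)"
  using ell_le_norm[OF assms] by (auto simp: dual_ball_def)

lemma dual_ball_D:
  assumes "\<phi> \<in> dual_ball X" "x \<in> vecs X"
  shows "y \<in> vecs X \<Longrightarrow> \<phi> (\<lambda>i. x i + y i) = \<phi> x + \<phi> y"
    and "\<phi> (\<lambda>i. c * x i) = c * \<phi> x"
    and "norm (\<phi> x) \<le> nrm X x"
  using assms unfolding dual_ball_def by auto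

lemma finite_support_in_ell: "(\<lambda>i. if i < (n::nat) then x i else 0) \<in> vecs (ell p)"
  unfolding ell_def
  by (auto intro!: summable_finite[of "{..<n}"] split: if_splits)

lemma ell_tail_in:
  assumes "x \<in> vecs (ell p)"
  shows "(\<lambda>i. if i < (n::nat) then 0 else x i) \<in> vecs (ell p)"
  using assms unfolding ell_def
  by (auto intro!: summable_comparison_test[of _ "\<lambda>n. norm (x n) powr p"])

lemma ell_tail_norm:
  assumes "p > 0" "x \<in> vecs (ell p)"
  shows "(\<lambda>n. nrm (ell p) (\<lambda>i. if i < n then 0 else x i)) \<longlonglongrightarrow> 0"
proof -
  let ?g = "\<lambda>n. norm (x n) powr p"
  have s: "summable ?g"
    using assms(2) by (simp add: ell_def)
  have eq: "(\<Sum>i. norm (if i < n then 0 else x i) powr p) = suminf ?g - (\<Sum>i<n. ?g i)" for n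
  proof -
    have fin: "(\<lambda>i. if i < n then ?g i else 0) sums (\<Sum>i<n. ?g i)"
      using sums_If_finite_set[of "{..<n}" ?g] by simp
    have "(\<lambda>i. ?g i - (if i < n then ?g i else 0)) sums (suminf ?g - (\<Sum>i<n. ?g i))"
      by (intro sums_diff summable_sums[OF s] fin)
    moreover have "(\<lambda>i. ?g i - (if i < n then ?g i else 0))
        = (\<lambda>i. norm (if i < n then 0 else x i) powr p)"
      by auto
    ultimately show ?thesis
      by (simp add: sums_iff)
  qed
  have "(\<lambda>n. suminf ?g - (\<Sum>i<n. ?g i)) \<longlonglongrightarrow> suminf ?g - suminf ?g"
    by (intro tendsto_intros summable_LIMSEQ[OF s])
  hence l: "(\<lambda>n. suminf ?g - (\<Sum>i<n. ?g i)) \<longlonglongrightarrow> 0"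
    by simp
  have nn: "suminf ?g - (\<Sum>i<n. ?g i) \<ge> 0" for n
    using sum_le_suminf[OF s, of "{..<n}"] by simp
  have "(\<lambda>n. (suminf ?g - (\<Sum>i<n. ?g i)) powr (1 / p)) \<longlonglongrightarrow> 0"
    using tendsto_powr'[OF l tendsto_const, of "1 / p"] assms(1) nn by simp
  thus ?thesis
    by (simp add: ell_def eq)
qed

definition trunc :: "nat \<Rightarrow> ((nat \<Rightarrow> complex) \<Rightarrow> complex) \<Rightarrow> (nat \<Rightarrow> complex) \<Rightarrow> complex" where
  "trunc n \<phi> = (\<lambda>x. \<phi> (\<lambda>i. if i < n then x i else 0))"

lemma ell_trunc_norm:
  assumes "p > 0" "x \<in> vecs (ell p)"
  shows "nrm (ell p) (\<lambda>i. if i < (n::nat) then x i else 0) \<le> nrm (ell p) x"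
proof -
  have s: "summable (\<lambda>n. norm (x n) powr p)"
    using assms(2) by (simp add: ell_def)
  have s': "summable (\<lambda>i. norm (if i < n then x i else 0) powr p)"
    using finite_support_in_ell[of n x p] by (simp add: ell_def)
  have "(\<Sum>i. norm (if i < n then x i else 0) powr p) \<le> (\<Sum>i. norm (x i) powr p)"
    by (intro suminf_le s s') auto
  thus ?thesis
    using assms(1) suminf_nonneg[OF s'] by (auto simp: ell_def intro!: powr_mono2)
qed

lemma trunc_in_dual_ball:
  assumes "p > 0" "\<phi> \<in> dual_ball (ell p)"
  shows "trunc n \<phi> \<in> dual_ball (ell p)"
proof -
  have a: "(\<lambda>i. if i < n then x i + y i else 0)
      = (\<lambda>i. (if i < n then x i else 0) + (if i < n then y i else 0))" for x y :: "nat \<Rightarrow> complex"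
    by auto
  have m: "(\<lambda>i. if i < n then c * x i else 0) = (\<lambda>i. c * (if i < n then x i else 0))"
    for x :: "nat \<Rightarrow> complex" and c
    by auto
  note fs = finite_support_in_ell
  have "norm (\<phi> (\<lambda>i. if i < n then x i else 0)) \<le> nrm (ell p) x" if "x \<in> vecs (ell p)" for x
    using dual_ball_D(3)[OF assms(2) fs[of n x]] ell_trunc_norm[OF assms(1) that, of n] by linarith
  moreover have "\<phi> (\<lambda>i. if i < n then x i + y i else 0)
      = \<phi> (\<lambda>i. if i < n then x i else 0) + \<phi> (\<lambda>i. if i < n then y i else 0)" for x y
    unfolding a by (rule dual_ball_D(1)[OF assms(2) fs fs])
  moreover have "\<phi> (\<lambda>i. if i < n then c * x i else 0)
      = c * \<phi> (\<lambda>i. if i < n then x i else 0)" for c x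
    unfolding m by (rule dual_ball_D(2)[OF assms(2) fs])
  ultimately show ?thesis
    unfolding dual_ball_def trunc_def by blast
qed

lemma trunc_eq:
  assumes "\<phi> \<in> dual_ball (ell p)"
  shows "trunc n \<phi> x = (\<Sum>i<n. \<phi> (\<lambda>j. if j = i then 1 else 0) * x i)"
proof (induction n)
  case 0
  have "(\<lambda>_. 0) \<in> vecs (ell p)"
    using finite_support_in_ell[of 0] by simp
  from dual_ball_D(2)[OF assms this, of 0] have "\<phi> (\<lambda>_. 0) = 0"
    by simp
  thus ?case
    by (simp add: trunc_def)
next
  case (Suc n)
  let ?e = "\<lambda>j. if j = n then 1 else (0::complex)"
  have "?e = (\<lambda>i. if i < Suc n then ?e i else 0)"
    by auto
  hence e: "?e \<in> vecs (ell p)"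
    using finite_support_in_ell[of "Suc n" ?e p] by simp
  have "(\<lambda>i. x n * ?e i) = (\<lambda>i. if i < Suc n then x n * ?e i else 0)"
    by auto
  hence e': "(\<lambda>i. x n * ?e i) \<in> vecs (ell p)"
    using finite_support_in_ell[of "Suc n" "\<lambda>i. x n * ?e i" p] by simp
  have "(\<lambda>i. if i < Suc n then x i else 0) = (\<lambda>i. (if i < n then x i else 0) + x n * ?e i)"
    by (auto simp: less_Suc_eq)
  hence "trunc (Suc n) \<phi> x = \<phi> (\<lambda>i. (if i < n then x i else 0) + x n * ?e i)"
    unfolding trunc_def by (rule arg_cong)
  also have "\<dots> = trunc n \<phi> x + \<phi> (\<lambda>i. x n * ?e i)"
    unfolding trunc_def by (rule dual_ball_D(1)[OF assms finite_support_in_ell e'])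
  also have "\<phi> (\<lambda>i. x n * ?e i) = x n * \<phi> ?e"
    by (rule dual_ball_D(2)[OF assms e])
  finally show ?case
    using Suc by (simp add: mult.commute)
qed

lemma trunc_tendsto:
  assumes "p > 0" "\<phi> \<in> dual_ball (ell p)" "x \<in> vecs (ell p)"
  shows "(\<lambda>n. trunc n \<phi> x) \<longlonglongrightarrow> \<phi> x"
proof -
  have "norm (trunc n \<phi> x - \<phi> x) \<le> nrm (ell p) (\<lambda>i. if i < n then 0 else x i)" for n
  proof -
    let ?t = "\<lambda>i. if i < n then 0 else x i"
    have "x = (\<lambda>i. (if i < n then x i else 0) + ?t i)"
      by auto
    hence "\<phi> x = \<phi> (\<lambda>i. (if i < n then x i else 0) + ?t i)"
      by (rule arg_cong)
    also have "\<dots> = trunc n \<phi> x + \<phi> ?t"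
      unfolding trunc_def
      by (rule dual_ball_D(1)[OF assms(2) finite_support_in_ell ell_tail_in[OF assms(3)]])
    finally have "norm (trunc n \<phi> x - \<phi> x) = norm (\<phi> ?t)"
      by (simp add: norm_minus_commute)
    also have "\<dots> \<le> nrm (ell p) ?t"
      by (rule dual_ball_D(3)[OF assms(2) ell_tail_in[OF assms(3)]])
    finally show ?thesis .
  qed
  hence "(\<lambda>n. trunc n \<phi> x - \<phi> x) \<longlonglongrightarrow> 0"
    by (intro Lim_null_comparison[OF _ ell_tail_norm[OF assms(1,3)]] always_eventually) auto
  thus ?thesis
    by (simp add: LIM_zero_iff)
qed

(* In each slot, a tensor is determined by its values at the coordinate functionals. *)
definition slotwise :: "real \<Rightarrow> nat \<Rightarrow> (((nat \<Rightarrow> complex) \<Rightarrow> complex) list \<Rightarrow> complex) \<Rightarrow> bool" where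
  "slotwise p m u \<longleftrightarrow>
    (\<forall>\<phi>s\<in>dual_tuples m (ell p). \<forall>k<m.
      (\<forall>n. u (\<phi>s[k := trunc n (\<phi>s ! k)]) =
        (\<Sum>i<n. (\<phi>s ! k) (\<lambda>j. if j = i then 1 else 0) * u (\<phi>s[k := \<lambda>x. x i]))) \<and>
      (\<lambda>n. u (\<phi>s[k := trunc n (\<phi>s ! k)])) \<longlonglongrightarrow> u \<phi>s)"

lemma dual_tuples_update:
  assumes "\<phi>s \<in> dual_tuples m X" "\<psi> \<in> dual_ball X"
  shows "\<phi>s[k := \<psi>] \<in> dual_tuples m X"
  using assms set_update_subset_insert[of \<phi>s k \<psi>] by (auto simp: dual_tuples_def)

lemma slotwise_elem_tensor:
  assumes p: "p > 0" and xs: "length xs = m" "set xs \<subseteq> vecs (ell p)"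
  shows "slotwise p m (elem_tensor m (ell p) xs)"
  unfolding slotwise_def
proof (intro ballI allI impI)
  fix \<phi>s k
  assume \<phi>s: "\<phi>s \<in> dual_tuples m (ell p)" and k: "k < m"
  have \<phi>: "\<phi>s ! k \<in> dual_ball (ell p)" and len: "length \<phi>s = m"
    using \<phi>s k by (auto simp: dual_tuples_def)
  have x: "xs ! k \<in> vecs (ell p)"
    using xs k by auto
  define R where "R = (\<Prod>j\<in>{..<m} - {k}. (\<phi>s ! j) (xs ! j))"
  have upd: "elem_tensor m (ell p) xs (\<phi>s[k := \<psi>]) = \<psi> (xs ! k) * R"
    if "\<psi> \<in> dual_ball (ell p)" for \<psi>
    using dual_tuples_update[OF \<phi>s that, of k] k len
    by (simp add: elem_tensor_def R_def prod.remove[of "{..<m}" k])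
  have self: "elem_tensor m (ell p) xs \<phi>s = (\<phi>s ! k) (xs ! k) * R"
    using upd[OF \<phi>] by simp
  note simps = upd[OF trunc_in_dual_ball[OF p \<phi>]] upd[OF coord_in_dual_ball[OF p]] self
  have "elem_tensor m (ell p) xs (\<phi>s[k := trunc n (\<phi>s ! k)]) =
      (\<Sum>i<n. (\<phi>s ! k) (\<lambda>j. if j = i then 1 else 0) *
        elem_tensor m (ell p) xs (\<phi>s[k := \<lambda>x. x i]))" for n
    unfolding simps trunc_eq[OF \<phi>] sum_distrib_right mult.assoc ..
  moreover have "(\<lambda>n. elem_tensor m (ell p) xs (\<phi>s[k := trunc n (\<phi>s ! k)]))
      \<longlonglongrightarrow> elem_tensor m (ell p) xs \<phi>s"
    unfolding simps by (intro tendsto_mult tendsto_const trunc_tendsto[OF p \<phi> x])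
  ultimately show "(\<forall>n. elem_tensor m (ell p) xs (\<phi>s[k := trunc n (\<phi>s ! k)]) =
      (\<Sum>i<n. (\<phi>s ! k) (\<lambda>j. if j = i then 1 else 0) *
        elem_tensor m (ell p) xs (\<phi>s[k := \<lambda>x. x i]))) \<and>
    (\<lambda>n. elem_tensor m (ell p) xs (\<phi>s[k := trunc n (\<phi>s ! k)]))
      \<longlonglongrightarrow> elem_tensor m (ell p) xs \<phi>s"
    by blast
qed

lemma slotwise_alg_tensor_power:
  assumes p: "p > 0" and v: "v \<in> alg_tensor_power m (ell p)"
  shows "slotwise p m v"
proof -
  obtain N :: nat and c xs where v_eq: "v = (\<lambda>\<phi>s. \<Sum>j<N. c j * elem_tensor m (ell p) (xs j) \<phi>s)"
    and xs: "\<And>j. j < N \<Longrightarrow> length (xs j) = m \<and> set (xs j) \<subseteq> vecs (ell p)"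
    using v unfolding alg_tensor_power_def by blast
  have s: "slotwise p m (elem_tensor m (ell p) (xs j))" if "j < N" for j
    using slotwise_elem_tensor[OF p] xs[OF that] by blast
  show ?thesis
    unfolding slotwise_def
  proof (intro ballI allI impI conjI)
    fix \<phi>s k n
    assume a: "\<phi>s \<in> dual_tuples m (ell p)" "k < m"
    have "v (\<phi>s[k := trunc n (\<phi>s ! k)]) = (\<Sum>j<N. \<Sum>i<n. c j *
        ((\<phi>s ! k) (\<lambda>j. if j = i then 1 else 0) *
          elem_tensor m (ell p) (xs j) (\<phi>s[k := \<lambda>x. x i])))"
      unfolding v_eq
    proof (intro sum.cong refl)
      fix j assume "j \<in> {..<N}"
      hence "elem_tensor m (ell p) (xs j) (\<phi>s[k := trunc n (\<phi>s ! k)]) =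
        (\<Sum>i<n. (\<phi>s ! k) (\<lambda>j. if j = i then 1 else 0) *
          elem_tensor m (ell p) (xs j) (\<phi>s[k := \<lambda>x. x i]))"
        using s[of j] a unfolding slotwise_def by blast
      thus "c j * elem_tensor m (ell p) (xs j) (\<phi>s[k := trunc n (\<phi>s ! k)]) =
        (\<Sum>i<n. c j * ((\<phi>s ! k) (\<lambda>j. if j = i then 1 else 0) *
          elem_tensor m (ell p) (xs j) (\<phi>s[k := \<lambda>x. x i])))"
        by (simp add: sum_distrib_left)
    qed
    also have "\<dots> = (\<Sum>i<n. (\<phi>s ! k) (\<lambda>j. if j = i then 1 else 0) * v (\<phi>s[k := \<lambda>x. x i]))"
      unfolding v_eq by (subst sum.swap) (simp add: sum_distrib_left mult.left_commute)
    finally show "v (\<phi>s[k := trunc n (\<phi>s ! k)]) =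
      (\<Sum>i<n. (\<phi>s ! k) (\<lambda>j. if j = i then 1 else 0) * v (\<phi>s[k := \<lambda>x. x i]))" .
  next
    fix \<phi>s k
    assume a: "\<phi>s \<in> dual_tuples m (ell p)" "k < m"
    show "(\<lambda>n. v (\<phi>s[k := trunc n (\<phi>s ! k)])) \<longlonglongrightarrow> v \<phi>s"
      unfolding v_eq
    proof (intro tendsto_sum tendsto_mult tendsto_const)
      fix j assume "j \<in> {..<N}"
      thus "(\<lambda>n. elem_tensor m (ell p) (xs j) (\<phi>s[k := trunc n (\<phi>s ! k)]))
          \<longlonglongrightarrow> elem_tensor m (ell p) (xs j) \<phi>s"
        using s[of j] a unfolding slotwise_def by blast
    qed
  qed
qed

lemma slotwise_inj_tensor_power:
  assumes p: "p > 0" and u: "u \<in> vecs (inj_tensor_power m (ell p))"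
  shows "slotwise p m u"
proof -
  have "\<exists>v. v \<in> alg_tensor_power m (ell p) \<and>
      (\<forall>\<phi>s\<in>dual_tuples m (ell p). norm (u \<phi>s - v \<phi>s) \<le> inverse (real (Suc N)))" for N
  proof -
    have "\<forall>e>0. \<exists>v\<in>alg_tensor_power m (ell p).
        \<forall>\<phi>s\<in>dual_tuples m (ell p). norm (u \<phi>s - v \<phi>s) \<le> e"
      using u by (simp add: inj_tensor_power_def)
    moreover have "inverse (real (Suc N)) > 0"
      by simp
    ultimately show ?thesis
      by blast
  qed
  hence "\<exists>v. \<forall>N. v N \<in> alg_tensor_power m (ell p) \<and>
      (\<forall>\<phi>s\<in>dual_tuples m (ell p). norm (u \<phi>s - v N \<phi>s) \<le> inverse (real (Suc N)))"
    by (intro choice) blast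
  then obtain v where v: "\<And>N. v N \<in> alg_tensor_power m (ell p)"
    and uv: "\<And>N \<phi>s. \<phi>s \<in> dual_tuples m (ell p) \<Longrightarrow> norm (u \<phi>s - v N \<phi>s) \<le> inverse (real (Suc N))"
    by blast
  have lim: "(\<lambda>N. v N \<phi>s) \<longlonglongrightarrow> u \<phi>s" if "\<phi>s \<in> dual_tuples m (ell p)" for \<phi>s
  proof -
    have "(\<lambda>N. v N \<phi>s - u \<phi>s) \<longlonglongrightarrow> 0"
    proof (rule Lim_null_comparison[OF always_eventually LIMSEQ_inverse_real_of_nat], rule allI)
      show "norm (v N \<phi>s - u \<phi>s) \<le> inverse (real (Suc N))" for N
        using uv[OF that, of N] by (subst norm_minus_commute)
    qed
    thus ?thesis
      by (simp add: LIM_zero_iff)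
  qed
  have s: "slotwise p m (v N)" for N
    by (rule slotwise_alg_tensor_power[OF p v])
  show ?thesis
    unfolding slotwise_def
  proof (intro ballI allI impI conjI)
    fix \<phi>s k n
    assume a: "\<phi>s \<in> dual_tuples m (ell p)" "k < m"
    have \<phi>: "\<phi>s ! k \<in> dual_ball (ell p)"
      using a by (auto simp: dual_tuples_def)
    have t: "\<phi>s[k := trunc n (\<phi>s ! k)] \<in> dual_tuples m (ell p)"
      by (intro dual_tuples_update[OF a(1)] trunc_in_dual_ball[OF p \<phi>])
    have c: "\<phi>s[k := \<lambda>x. x i] \<in> dual_tuples m (ell p)" for i
      by (intro dual_tuples_update[OF a(1)] coord_in_dual_ball[OF p])
    have eq: "v N (\<phi>s[k := trunc n (\<phi>s ! k)]) =
        (\<Sum>i<n. (\<phi>s ! k) (\<lambda>j. if j = i then 1 else 0) * v N (\<phi>s[k := \<lambda>x. x i]))" for N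
      using s[of N] a unfolding slotwise_def by blast
    have "(\<lambda>N. \<Sum>i<n. (\<phi>s ! k) (\<lambda>j. if j = i then 1 else 0) * v N (\<phi>s[k := \<lambda>x. x i]))
        \<longlonglongrightarrow> (\<Sum>i<n. (\<phi>s ! k) (\<lambda>j. if j = i then 1 else 0) * u (\<phi>s[k := \<lambda>x. x i]))"
      by (intro tendsto_sum tendsto_mult tendsto_const lim c)
    with lim[OF t] show "u (\<phi>s[k := trunc n (\<phi>s ! k)]) =
        (\<Sum>i<n. (\<phi>s ! k) (\<lambda>j. if j = i then 1 else 0) * u (\<phi>s[k := \<lambda>x. x i]))"
      unfolding eq by (rule LIMSEQ_unique)
  next
    fix \<phi>s k
    assume a: "\<phi>s \<in> dual_tuples m (ell p)" "k < m"
    have \<phi>: "\<phi>s ! k \<in> dual_ball (ell p)"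
      using a by (auto simp: dual_tuples_def)
    have t: "\<phi>s[k := trunc n (\<phi>s ! k)] \<in> dual_tuples m (ell p)" for n
      by (intro dual_tuples_update[OF a(1)] trunc_in_dual_ball[OF p \<phi>])
    have "uniform_limit (dual_tuples m (ell p)) v u sequentially"
    proof (rule uniform_limitI)
      fix e :: real assume "e > 0"
      hence "\<forall>\<^sub>F N in sequentially. inverse (real (Suc N)) < e"
        using LIMSEQ_inverse_real_of_nat by (rule order_tendstoD(2)[rotated])
      thus "\<forall>\<^sub>F N in sequentially. \<forall>\<phi>s\<in>dual_tuples m (ell p). dist (v N \<phi>s) (u \<phi>s) < e"
      proof eventually_elim
        case (elim N)
        show ?case
        proof
          fix \<phi>s assume "\<phi>s \<in> dual_tuples m (ell p)"
          from order_le_less_trans[OF uv[OF this] elim] show "dist (v N \<phi>s) (u \<phi>s) < e"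
            by (subst dist_commute) (simp only: dist_norm)
        qed
      qed
    qed
    hence ul: "uniform_limit UNIV (\<lambda>N n. v N (\<phi>s[k := trunc n (\<phi>s ! k)]))
        (\<lambda>n. u (\<phi>s[k := trunc n (\<phi>s ! k)])) sequentially"
      by (rule uniform_limit_compose') (use t in auto)
    have pt: "(\<lambda>n. v N (\<phi>s[k := trunc n (\<phi>s ! k)])) \<longlonglongrightarrow> v N \<phi>s" for N
      using s[of N] a unfolding slotwise_def by blast
    show "(\<lambda>n. u (\<phi>s[k := trunc n (\<phi>s ! k)])) \<longlonglongrightarrow> u \<phi>s"
      by (rule swap_uniform_limit'[OF always_eventually[OF allI[OF pt]] lim[OF a(1)] ul]) simp_all
  qed
qed

lemma coeffs_determine:
  assumes p: "p > 0" and u: "u \<in> vecs (inj_tensor_power m (ell p))"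
    and w: "w \<in> vecs (inj_tensor_power m (ell p))" and uw: "coeffs u = coeffs w"
  shows "u = w"
proof -
  have su: "slotwise p m u" and sw: "slotwise p m w"
    using slotwise_inj_tensor_power[OF p] u w by auto
  have main: "u \<phi>s = w \<phi>s"
    if "k \<le> m" "\<phi>s \<in> dual_tuples m (ell p)" "\<forall>j. k \<le> j \<and> j < m \<longrightarrow> (\<exists>i. \<phi>s ! j = (\<lambda>x. x i))"
    for k \<phi>s
    using that
  proof (induction k arbitrary: \<phi>s)
    case 0
    define g where "g j = (SOME i. \<phi>s ! j = (\<lambda>x. x i))" for j
    have g: "\<phi>s ! j = (\<lambda>x. x (g j))" if "j < m" for j
      unfolding g_def by (rule someI_ex) (use 0 that in blast)
    have "\<phi>s = map (\<lambda>i x. x i) (map g [0..<m])"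
      using 0 g by (intro nth_equalityI) (auto simp: dual_tuples_def)
    thus ?case
      using fun_cong[OF uw, of "map g [0..<m]"] by (simp add: coeffs_def)
  next
    case (Suc k)
    have k: "k < m"
      using Suc.prems by simp
    have len: "length \<phi>s = m"
      using Suc.prems by (simp add: dual_tuples_def)
    have c: "u (\<phi>s[k := \<lambda>x. x i]) = w (\<phi>s[k := \<lambda>x. x i])" for i
    proof (rule Suc.IH)
      show "\<phi>s[k := \<lambda>x. x i] \<in> dual_tuples m (ell p)"
        by (intro dual_tuples_update Suc.prems coord_in_dual_ball p)
      show "\<forall>j. k \<le> j \<and> j < m \<longrightarrow> (\<exists>i'. \<phi>s[k := \<lambda>x. x i] ! j = (\<lambda>x. x i'))"
        using Suc.prems(3) k len by (auto simp: nth_list_update)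
    qed (use k in simp)
    have eu: "u (\<phi>s[k := trunc n (\<phi>s ! k)]) =
        (\<Sum>i<n. (\<phi>s ! k) (\<lambda>j. if j = i then 1 else 0) * u (\<phi>s[k := \<lambda>x. x i]))"
      and ew: "w (\<phi>s[k := trunc n (\<phi>s ! k)]) =
        (\<Sum>i<n. (\<phi>s ! k) (\<lambda>j. if j = i then 1 else 0) * w (\<phi>s[k := \<lambda>x. x i]))" for n
      using su sw Suc.prems(2) k unfolding slotwise_def by blast+
    have lu: "(\<lambda>n. u (\<phi>s[k := trunc n (\<phi>s ! k)])) \<longlonglongrightarrow> u \<phi>s"
      and lw: "(\<lambda>n. w (\<phi>s[k := trunc n (\<phi>s ! k)])) \<longlonglongrightarrow> w \<phi>s"
      using su sw Suc.prems(2) k unfolding slotwise_def by blast+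
    have "u (\<phi>s[k := trunc n (\<phi>s ! k)]) = w (\<phi>s[k := trunc n (\<phi>s ! k)])" for n
      by (simp only: eu ew c)
    with lu lw show ?case
      by (simp add: LIMSEQ_unique)
  qed
  show ?thesis
  proof (rule ext)
    fix \<phi>s
    show "u \<phi>s = w \<phi>s"
    proof (cases "\<phi>s \<in> dual_tuples m (ell p)")
      case True
      thus ?thesis
        by (intro main[of m]) auto
    next
      case False
      thus ?thesis
        using u w by (simp add: inj_tensor_power_def)
    qed
  qed
qed

lemma inj_on_coeffs:
  assumes "p > 0"
  shows "inj_on coeffs (vecs (inj_tensor_power m (ell p)))"
  using coeffs_determine[OF assms] by (auto intro: inj_onI)

end

theory Submission
  imports Defs
begin

text \<open>Put \<open>s p = 1 - m (1 - 1/p)\<close>, which is affine in \<open>1/p\<close>, positive at \<open>p0\<close> and negative at \<open>p1\<close>.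
  In the tensor power of \<open>\<ell>\<^sub>p\<close>, a sum of \<open>n\<close> diagonal tensors \<open>e\<^sub>k \<otimes> \<dots> \<otimes> e\<^sub>k\<close> with unimodular coefficients
  has norm at most of order \<open>n\<close> to the power \<open>max 0 (s p)\<close>, by Hoelder. Conversely, the parts of a tensor in
  \<open>n\<close> disjoint diagonal blocks have norms in the tensor power of \<open>\<ell>\<close> with exponent \<open>p0\<close> whose sum is at most
  \<open>n\<close> to the power \<open>1 - s p0\<close> times the norm of the tensor. Interpolating with the trivial bound for
  \<open>p1\<close>, some part of an element \<open>x\<close> of the interpolation space is smaller than \<open>x\<close> by a factor of order
  \<open>n\<close> to the power \<open>(1 - \<theta>) s p0\<close>. An isomorphism carries the diagonal tensors to a sequence
  which, after a gliding hump argument, consists essentially of such blocks. Comparing the growth rates would give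
  \<open>(1 - \<theta>) s p0 \<le> max 0 (s p\<theta>)\<close>, but \<open>s p\<theta> = (1 - \<theta>) s p0 + \<theta> s p1\<close> is smaller than the left-hand side.\<close>

subsection \<open>Seminormed function spaces and contractive multipliers\<close>

text \<open>Nothing explicit is known about the norm of the interpolation space, so every estimate
  in it has to be read off a representing function on the strip. Only maps given by one formula on
  both endpoints act on such functions, which is why every cut below is a pointwise multiplier that
  is contractive at both endpoints. The estimate at the left endpoint holds for each boundary point
  separately, whereas the smallest block changes from point to point. A block that is small on
  average is selected, and a scalar outer function turns the average into a bound along the whole
  line; at \<open>\<theta>\<close> the gain survives with the power \<open>1 - \<theta>\<close>. An
  isomorphism need not respect the diagonal: the preimages of the diagonal tensors may stay put in
  some slots and run off to infinity in others. The humps may therefore freeze any proper subset of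
  the slots, and the block estimate is stated for the remaining nonempty set \<open>A\<close>.
  Freezing all slots would leave multiples of a single array, whose sums grow linearly for suitable
  phases, while the diagonal sums grow with an exponent less than \<open>1\<close>.\<close>

locale seminormed =
  fixes X :: "'i fspace"
  assumes zero: "(\<lambda>i. 0) \<in> vecs X"
    and add: "x \<in> vecs X \<Longrightarrow> y \<in> vecs X \<Longrightarrow> (\<lambda>i. x i + y i) \<in> vecs X"
    and scale: "x \<in> vecs X \<Longrightarrow> (\<lambda>i. c * x i) \<in> vecs X"
    and nonneg: "x \<in> vecs X \<Longrightarrow> 0 \<le> nrm X x"
    and triangle: "x \<in> vecs X \<Longrightarrow> y \<in> vecs X \<Longrightarrow> nrm X (\<lambda>i. x i + y i) \<le> nrm X x + nrm X y"
    and nrm_scale_le: "x \<in> vecs X \<Longrightarrow> nrm X (\<lambda>i. c * x i) \<le> norm c * nrm X x"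
begin

lemma nrm_zero: "nrm X (\<lambda>i. 0) = 0"
  using nrm_scale_le[OF zero, of 0] nonneg[OF zero] by simp

text \<open>Only the inequality is an axiom, because norms defined by infima or suprema yield it
  directly; applied to the scalar \<open>inverse c\<close> it gives the reverse inequality.\<close>

lemma nrm_scale:
  assumes "x \<in> vecs X"
  shows "nrm X (\<lambda>i. c * x i) = norm c * nrm X x"
proof (cases "c = 0")
  case True
  then show ?thesis by (simp add: nrm_zero)
next
  case False
  have "nrm X (\<lambda>i. inverse c * (c * x i)) \<le> norm (inverse c) * nrm X (\<lambda>i. c * x i)"
    by (intro nrm_scale_le scale assms)
  moreover have "(\<lambda>i. inverse c * (c * x i)) = x"
    using False by (auto simp: field_simps)
  ultimately have "norm c * nrm X x \<le> nrm X (\<lambda>i. c * x i)"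
    using False by (simp add: norm_inverse norm_divide divide_simps mult.commute)
  with nrm_scale_le[OF assms, of c] show ?thesis by linarith
qed

lemma diff:
  assumes "x \<in> vecs X" "y \<in> vecs X"
  shows "(\<lambda>i. x i - y i) \<in> vecs X"
  using add[OF assms(1) scale[OF assms(2), of "-1"]] by simp

lemma nrm_diff_triangle:
  assumes "x \<in> vecs X" "y \<in> vecs X"
  shows "nrm X (\<lambda>i. x i - y i) \<le> nrm X x + nrm X y"
  using triangle[OF assms(1) scale[OF assms(2), of "-1"]] nrm_scale[OF assms(2), of "-1"] by simp

lemma nrm_le_add_diff:
  assumes "x \<in> vecs X" "y \<in> vecs X"
  shows "nrm X x \<le> nrm X y + nrm X (\<lambda>i. x i - y i)"
  using triangle[OF assms(2) diff[OF assms]] by simp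

lemma nrm_minus_commute:
  assumes "x \<in> vecs X" "y \<in> vecs X"
  shows "nrm X (\<lambda>i. x i - y i) = nrm X (\<lambda>i. y i - x i)"
  using nrm_scale[OF diff[OF assms], of "-1"] by simp

lemma abs_nrm_diff_le:
  assumes "x \<in> vecs X" "y \<in> vecs X"
  shows "\<bar>nrm X x - nrm X y\<bar> \<le> nrm X (\<lambda>i. x i - y i)"
  using nrm_le_add_diff[OF assms] nrm_le_add_diff[OF assms(2,1)] nrm_minus_commute[OF assms]
  by linarith

lemma sum_in:
  assumes "finite F" "\<And>k. k \<in> F \<Longrightarrow> x k \<in> vecs X"
  shows "(\<lambda>i. \<Sum>k\<in>F. x k i) \<in> vecs X"
  using assms by (induction F rule: finite_induct) (auto intro: zero add)

lemma nrm_sum: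
  assumes "finite F" "\<And>k. k \<in> F \<Longrightarrow> x k \<in> vecs X"
  shows "nrm X (\<lambda>i. \<Sum>k\<in>F. x k i) \<le> (\<Sum>k\<in>F. nrm X (x k))"
  using assms
proof (induction F rule: finite_induct)
  case empty
  then show ?case by (simp add: nrm_zero)
next
  case (insert a F)
  have "nrm X (\<lambda>i. x a i + (\<Sum>k\<in>F. x k i)) \<le> nrm X (x a) + nrm X (\<lambda>i. \<Sum>k\<in>F. x k i)"
    by (intro triangle sum_in) (use insert in auto)
  with insert show ?case by simp
qed

end

text \<open>A multiplier is one and the same map on both spaces of a couple, so contractivity at the
  two endpoints passes to the sum space and to every interpolation space.\<close>

definition contractive :: "'i fspace \<Rightarrow> ('i \<Rightarrow> complex) \<Rightarrow> bool" where
  "contractive X w \<longleftrightarrow>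
    (\<forall>x\<in>vecs X. (\<lambda>i. w i * x i) \<in> vecs X \<and> nrm X (\<lambda>i. w i * x i) \<le> nrm X x)"

lemma contractiveD:
  assumes "contractive X w" "x \<in> vecs X"
  shows "(\<lambda>i. w i * x i) \<in> vecs X" "nrm X (\<lambda>i. w i * x i) \<le> nrm X x"
  using assms by (auto simp: contractive_def)

lemma contractive_one: "contractive X (\<lambda>i. 1)"
  by (simp add: contractive_def)

lemma contractive_mult:
  assumes "contractive X v" "contractive X w"
  shows "contractive X (\<lambda>i. v i * w i)"
  unfolding contractive_def
proof (intro ballI)
  fix x assume x: "x \<in> vecs X"
  note 1 = contractiveD[OF assms(2) x]
  note 2 = contractiveD[OF assms(1) 1(1)]
  show "(\<lambda>i. v i * w i * x i) \<in> vecs X \<and> nrm X (\<lambda>i. v i * w i * x i) \<le> nrm X x"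
    using 1(2) 2 by (simp add: mult.assoc)
qed

text \<open>Slotwise multiplication produces only products of functions of one index. Averages give
  access to further multipliers, such as the projection onto the block diagonal.\<close>

lemma (in seminormed) contractive_average:
  assumes "n > 0" "\<And>t. t < n \<Longrightarrow> contractive X (w t)"
  shows "contractive X (\<lambda>i. (\<Sum>t<n. w t i) / of_nat n)"
  unfolding contractive_def
proof (intro ballI)
  fix x assume x: "x \<in> vecs X"
  have eq: "(\<lambda>i. (\<Sum>t<n. w t i) / of_nat n * x i)
      = (\<lambda>i. (1 / of_nat n) * (\<Sum>t<n. w t i * x i))"
    by (auto simp: sum_distrib_right)
  have 1: "(\<lambda>i. w t i * x i) \<in> vecs X" "nrm X (\<lambda>i. w t i * x i) \<le> nrm X x" if "t < n" for t
    using contractiveD[OF assms(2)[OF that] x] .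
  have 2: "(\<lambda>i. \<Sum>t<n. w t i * x i) \<in> vecs X"
    by (intro sum_in) (auto intro: 1)
  have "nrm X (\<lambda>i. \<Sum>t<n. w t i * x i) \<le> (\<Sum>t<n. nrm X (\<lambda>i. w t i * x i))"
    by (intro nrm_sum) (auto intro: 1)
  also have "\<dots> \<le> (\<Sum>t<n. nrm X x)"
    by (intro sum_mono 1) auto
  finally have "nrm X (\<lambda>i. \<Sum>t<n. w t i * x i) \<le> n * nrm X x" by simp
  then have "nrm X (\<lambda>i. (1 / of_nat n) * (\<Sum>t<n. w t i * x i)) \<le> nrm X x"
    unfolding nrm_scale[OF 2] using assms(1) by (simp add: norm_divide field_simps)
  then show "(\<lambda>i. (\<Sum>t<n. w t i) / of_nat n * x i) \<in> vecs X \<and>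
      nrm X (\<lambda>i. (\<Sum>t<n. w t i) / of_nat n * x i) \<le> nrm X x"
    unfolding eq using scale[OF 2] by blast
qed


subsection \<open>Calderon's interpolation space\<close>

locale couple = X0: seminormed X0 + X1: seminormed X1 for X0 X1 :: "'i fspace"
begin

abbreviation S where "S \<equiv> sum_space X0 X1"

lemma sum_nrm_le:
  assumes "x \<in> vecs X0" "y \<in> vecs X1"
  shows "nrm S (\<lambda>i. x i + y i) \<le> nrm X0 x + nrm X1 y"
  unfolding sum_space_def fspace.simps
  by (rule cInf_lower) (use assms in \<open>auto intro!: bdd_belowI[of _ 0] add_nonneg_nonneg X0.nonneg X1.nonneg\<close>)

lemma sum_nrm_less:
  assumes "z \<in> vecs S" "nrm S z < r"
  obtains x y where "x \<in> vecs X0" "y \<in> vecs X1" "z = (\<lambda>i. x i + y i)" "nrm X0 x + nrm X1 y < r"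
proof -
  let ?A = "{nrm X0 x + nrm X1 y | x y.
                  x \<in> vecs X0 \<and> y \<in> vecs X1 \<and> z = (\<lambda>i. x i + y i)}"
  have "?A \<noteq> {}" using assms(1) by (auto simp: sum_space_def)
  moreover have "bdd_below ?A"
    by (auto intro!: bdd_belowI[of _ 0] add_nonneg_nonneg X0.nonneg X1.nonneg)
  moreover have "Inf ?A < r" using assms(2) by (simp add: sum_space_def)
  ultimately obtain a where "a \<in> ?A" "a < r" by (metis (no_types, lifting) cInf_less_iff)
  then show ?thesis using that by blast
qed

lemma sum_in: "x \<in> vecs X0 \<Longrightarrow> y \<in> vecs X1 \<Longrightarrow> (\<lambda>i. x i + y i) \<in> vecs S"
  by (auto simp: sum_space_def)

lemma sum_nonneg:
  assumes "z \<in> vecs S"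
  shows "0 \<le> nrm S z"
proof (rule ccontr)
  assume "\<not> 0 \<le> nrm S z"
  then have "nrm S z < 0" by simp
  then obtain x y where
    "x \<in> vecs X0" "y \<in> vecs X1" "z = (\<lambda>i. x i + y i)" "nrm X0 x + nrm X1 y < 0"
    by (rule sum_nrm_less[OF assms])
  with X0.nonneg[of x] X1.nonneg[of y] show False by simp
qed

sublocale S: seminormed S
proof
  show "(\<lambda>i. 0) \<in> vecs S" using sum_in[OF X0.zero X1.zero] by simp
  show "0 \<le> nrm S z" if "z \<in> vecs S" for z using sum_nonneg[OF that] .
  fix z z' assume z: "z \<in> vecs S"
  obtain x y where xy: "x \<in> vecs X0" "y \<in> vecs X1" "z = (\<lambda>i. x i + y i)"
    using z by (auto simp: sum_space_def)
  show "(\<lambda>i. c * z i) \<in> vecs S" for c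
    using sum_in[OF X0.scale[OF xy(1), of c] X1.scale[OF xy(2), of c]] xy(3)
    by (simp add: algebra_simps)
  show "nrm S (\<lambda>i. c * z i) \<le> norm c * nrm S z" for c
  proof (rule field_le_epsilon)
    fix e :: real assume e: "e > 0"
    \<comment> \<open>The summand \<open>1\<close> keeps the divisor positive when
      \<open>c = 0\<close>.\<close>
    define e' where "e' = e / (norm c + 1)"
    have e': "e' > 0" using e by (simp add: e'_def add_nonneg_pos)
    then have "nrm S z < nrm S z + e'" by simp
    then obtain x y where
      x: "x \<in> vecs X0" and y: "y \<in> vecs X1" and zz: "z = (\<lambda>i. x i + y i)"
      and l: "nrm X0 x + nrm X1 y < nrm S z + e'"
      by (rule sum_nrm_less[OF z])
    have "nrm S (\<lambda>i. c * x i + c * y i) \<le> norm c * nrm X0 x + norm c * nrm X1 y"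
      using sum_nrm_le[OF X0.scale[OF x, of c] X1.scale[OF y, of c]] X0.nrm_scale[OF x] X1.nrm_scale[OF y]
      by simp
    also have "\<dots> \<le> norm c * (nrm S z + e')"
      using mult_left_mono[OF less_imp_le[OF l], of "norm c"] by (simp add: algebra_simps)
    also have "norm c * e' \<le> e"
    proof -
      have "norm c * e \<le> e * (norm c + 1)" using e by (simp add: algebra_simps)
      then show ?thesis unfolding e'_def
        by (simp add: divide_le_eq add_nonneg_pos)
    qed
    then have "norm c * (nrm S z + e') \<le> norm c * nrm S z + e" by (simp add: algebra_simps)
    finally show "nrm S (\<lambda>i. c * z i) \<le> norm c * nrm S z + e"
      unfolding zz by (simp add: algebra_simps)
  qed
  assume z': "z' \<in> vecs S"
  obtain x' y' where xy': "x' \<in> vecs X0" "y' \<in> vecs X1" "z' = (\<lambda>i. x' i + y' i)"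
    using z' by (auto simp: sum_space_def)
  show "(\<lambda>i. z i + z' i) \<in> vecs S"
    using sum_in[OF X0.add[OF xy(1) xy'(1)] X1.add[OF xy(2) xy'(2)]] xy(3) xy'(3)
    by (simp add: algebra_simps)
  show "nrm S (\<lambda>i. z i + z' i) \<le> nrm S z + nrm S z'"
  proof (rule field_le_epsilon)
    fix e :: real assume e: "e > 0"
    then have "nrm S z < nrm S z + e / 2" "nrm S z' < nrm S z' + e / 2" by simp_all
    note less = this
    obtain x y where xy: "x \<in> vecs X0" "y \<in> vecs X1" "z = (\<lambda>i. x i + y i)"
        "nrm X0 x + nrm X1 y < nrm S z + e / 2"
      by (rule sum_nrm_less[OF z less(1)])
    obtain x' y' where xy': "x' \<in> vecs X0" "y' \<in> vecs X1" "z' = (\<lambda>i. x' i + y' i)"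
        "nrm X0 x' + nrm X1 y' < nrm S z' + e / 2"
      by (rule sum_nrm_less[OF z' less(2)])
    note x = xy(1) xy'(1) and y = xy(2) xy'(2) and zz = xy(3) xy'(3) and l = xy(4) xy'(4)
    have "nrm S (\<lambda>i. (x i + x' i) + (y i + y' i)) \<le> (nrm X0 x + nrm X0 x') + (nrm X1 y + nrm X1 y')"
      using sum_nrm_le[OF X0.add[OF x] X1.add[OF y]] X0.triangle[OF x] X1.triangle[OF y]
      by linarith
    also have "\<dots> \<le> nrm S z + nrm S z' + e" using l by linarith
    finally show "nrm S (\<lambda>i. z i + z' i) \<le> nrm S z + nrm S z' + e"
      unfolding zz by (simp add: algebra_simps)
  qed
qed

lemma contractive_sum:
  assumes "contractive X0 w" "contractive X1 w"
  shows "contractive S w"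
  unfolding contractive_def
proof (intro ballI conjI)
  fix z assume z: "z \<in> vecs S"
  note w0 = contractiveD[OF assms(1)]
  note w1 = contractiveD[OF assms(2)]
  obtain x y where xy: "x \<in> vecs X0" "y \<in> vecs X1" "z = (\<lambda>i. x i + y i)"
    using z by (auto simp: sum_space_def)
  show "(\<lambda>i. w i * z i) \<in> vecs S"
    using sum_in[OF w0(1)[OF xy(1)] w1(1)[OF xy(2)]] xy(3)
    by (simp add: algebra_simps)
  show "nrm S (\<lambda>i. w i * z i) \<le> nrm S z"
  proof (rule field_le_epsilon)
    fix e :: real assume e: "e > 0"
    then have "nrm S z < nrm S z + e" by simp
    then obtain x y where
      x: "x \<in> vecs X0" and y: "y \<in> vecs X1" and zz: "z = (\<lambda>i. x i + y i)"
      and l: "nrm X0 x + nrm X1 y < nrm S z + e"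
      by (rule sum_nrm_less[OF z])
    have "nrm S (\<lambda>i. w i * x i + w i * y i) \<le> nrm X0 x + nrm X1 y"
      using sum_nrm_le[OF w0(1)[OF x] w1(1)[OF y]] w0(2)[OF x] w1(2)[OF y]
      by simp
    then show "nrm S (\<lambda>i. w i * z i) \<le> nrm S z + e"
      unfolding zz using l zz by (simp add: algebra_simps)
  qed
qed

end

section \<open>Sums and products of continuous, holomorphic and vanishing vector-valued
  functions\<close>

lemma continuous_into_nrm:
  assumes "seminormed X" "\<And>z. z \<in> A \<Longrightarrow> f z \<in> vecs X" "continuous_into X A f"
  shows "continuous_on A (\<lambda>z. nrm X (f z))"
  unfolding continuous_on_def
proof
  interpret seminormed X by fact
  fix z assume z: "z \<in> A"
  have "((\<lambda>w. nrm X (\<lambda>i. f w i - f z i)) \<longlongrightarrow> 0) (at z within A)"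
    using assms(3) z by (simp add: continuous_into_def)
  moreover have "\<forall>\<^sub>F w in at z within A. norm (nrm X (f w) - nrm X (f z)) \<le> nrm X (\<lambda>i. f w i - f z i)"
    unfolding eventually_at_filter
    by (rule always_eventually) (use abs_nrm_diff_le assms(2) z in auto)
  ultimately have "((\<lambda>w. nrm X (f w) - nrm X (f z)) \<longlongrightarrow> 0) (at z within A)"
    by (rule Lim_null_comparison[rotated])
  then show "((\<lambda>w. nrm X (f w)) \<longlongrightarrow> nrm X (f z)) (at z within A)"
    by (simp add: LIM_zero_iff)
qed

lemma continuous_into_add:
  assumes "seminormed X" "\<And>z. z \<in> A \<Longrightarrow> f z \<in> vecs X" "\<And>z. z \<in> A \<Longrightarrow> g z \<in> vecs X"
    "continuous_into X A f" "continuous_into X A g"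
  shows "continuous_into X A (\<lambda>z i. f z i + g z i)"
  unfolding continuous_into_def
proof
  interpret seminormed X by fact
  fix z assume z: "z \<in> A"
  have "((\<lambda>w. nrm X (\<lambda>i. f w i - f z i) + nrm X (\<lambda>i. g w i - g z i)) \<longlongrightarrow> 0) (at z within A)"
    using assms(4,5) z by (auto simp: continuous_into_def intro: tendsto_add_zero)
  moreover have "\<forall>\<^sub>F w in at z within A. norm (nrm X (\<lambda>i. f w i + g w i - (f z i + g z i)))
      \<le> nrm X (\<lambda>i. f w i - f z i) + nrm X (\<lambda>i. g w i - g z i)"
    unfolding eventually_at_filter
  proof (rule always_eventually, intro allI impI)
    fix w assume w: "w \<in> A"
    have f: "(\<lambda>i. f w i - f z i) \<in> vecs X" and g: "(\<lambda>i. g w i - g z i) \<in> vecs X"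
      using w z assms(2,3) diff by auto
    have "(\<lambda>i. f w i + g w i - (f z i + g z i)) = (\<lambda>i. (f w i - f z i) + (g w i - g z i))"
      by auto
    then show "norm (nrm X (\<lambda>i. f w i + g w i - (f z i + g z i)))
      \<le> nrm X (\<lambda>i. f w i - f z i) + nrm X (\<lambda>i. g w i - g z i)"
      using triangle[OF f g] nonneg[OF add[OF f g]] by simp
  qed
  ultimately show "((\<lambda>w. nrm X (\<lambda>i. f w i + g w i - (f z i + g z i))) \<longlongrightarrow> 0) (at z within A)"
    by (rule Lim_null_comparison[rotated])
qed

lemma continuous_into_mult:
  fixes h :: "'a::topological_space \<Rightarrow> complex"
  assumes "seminormed X" "\<And>z. z \<in> A \<Longrightarrow> f z \<in> vecs X" "continuous_into X A f"
    "contractive X w" "continuous_on A h"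
  shows "continuous_into X A (\<lambda>z i. h z * (w i * f z i))"
  unfolding continuous_into_def
proof
  interpret seminormed X by fact
  fix z assume z: "z \<in> A"
  have hz: "(h \<longlongrightarrow> h z) (at z within A)" using assms(5) z by (simp add: continuous_on_def)
  have "((\<lambda>v. norm (h v) * nrm X (\<lambda>i. f v i - f z i) + norm (h v - h z) * nrm X (f z))
      \<longlongrightarrow> norm (h z) * 0 + norm (h z - h z) * nrm X (f z)) (at z within A)"
    using assms(3) z by (intro tendsto_intros hz) (auto simp: continuous_into_def)
  then have "((\<lambda>v. norm (h v) * nrm X (\<lambda>i. f v i - f z i) + norm (h v - h z) * nrm X (f z))
      \<longlongrightarrow> 0) (at z within A)" by simp
  moreover have "\<forall>\<^sub>F v in at z within A. norm (nrm X (\<lambda>i. h v * (w i * f v i) - h z * (w i * f z i)))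
      \<le> norm (h v) * nrm X (\<lambda>i. f v i - f z i) + norm (h v - h z) * nrm X (f z)"
    unfolding eventually_at_filter
  proof (rule always_eventually, intro allI impI)
    fix v assume v: "v \<in> A"
    have f: "(\<lambda>i. f v i - f z i) \<in> vecs X" using v z assms(2) diff by auto
    have fz: "f z \<in> vecs X" using z assms(2) by auto
    note 1 = contractiveD[OF assms(4) f]
    note 2 = contractiveD[OF assms(4) fz]
    have eq: "(\<lambda>i. h v * (w i * f v i) - h z * (w i * f z i))
       = (\<lambda>i. h v * (w i * (f v i - f z i)) + (h v - h z) * (w i * f z i))"
      by (auto simp: algebra_simps)
    have "nrm X (\<lambda>i. h v * (w i * f v i) - h z * (w i * f z i))
      \<le> norm (h v) * nrm X (\<lambda>i. w i * (f v i - f z i)) + norm (h v - h z) * nrm X (\<lambda>i. w i * f z i)"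
      unfolding eq nrm_scale[OF 1(1), symmetric] nrm_scale[OF 2(1), symmetric]
      by (intro triangle scale 1 2)
    also have "\<dots> \<le> norm (h v) * nrm X (\<lambda>i. f v i - f z i) + norm (h v - h z) * nrm X (f z)"
      by (intro add_mono mult_left_mono 1 2) auto
    finally show "norm (nrm X (\<lambda>i. h v * (w i * f v i) - h z * (w i * f z i)))
      \<le> norm (h v) * nrm X (\<lambda>i. f v i - f z i) + norm (h v - h z) * nrm X (f z)"
      unfolding eq using nonneg[OF add[OF scale[OF 1(1)] scale[OF 2(1)]]] by simp
  qed
  ultimately show "((\<lambda>v. nrm X (\<lambda>i. h v * (w i * f v i) - h z * (w i * f z i))) \<longlongrightarrow> 0) (at z within A)"
    by (rule Lim_null_comparison[rotated])
qed

lemma holomorphic_into_add: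
  assumes "seminormed X" "\<And>z. z \<in> A \<Longrightarrow> f z \<in> vecs X" "\<And>z. z \<in> A \<Longrightarrow> g z \<in> vecs X"
    "holomorphic_into X A f" "holomorphic_into X A g"
  shows "holomorphic_into X A (\<lambda>z i. f z i + g z i)"
  unfolding holomorphic_into_def
proof
  interpret seminormed X by fact
  fix z assume z: "z \<in> A"
  obtain d e where d: "d \<in> vecs X" and e: "e \<in> vecs X"
    and ld: "((\<lambda>w. nrm X (\<lambda>i. (f w i - f z i) / (w - z) - d i)) \<longlongrightarrow> 0) (at z within A)"
    and le: "((\<lambda>w. nrm X (\<lambda>i. (g w i - g z i) / (w - z) - e i)) \<longlongrightarrow> 0) (at z within A)"
    using assms(4,5) z unfolding holomorphic_into_def by blast
  show "\<exists>d\<in>vecs X. ((\<lambda>w. nrm X (\<lambda>i. (f w i + g w i - (f z i + g z i)) / (w - z) - d i)) \<longlongrightarrow> 0)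
      (at z within A)"
  proof
    show "(\<lambda>i. d i + e i) \<in> vecs X" by (intro add d e)
    have "((\<lambda>w. nrm X (\<lambda>i. (f w i - f z i) / (w - z) - d i) + nrm X (\<lambda>i. (g w i - g z i) / (w - z) - e i)) \<longlongrightarrow> 0)
        (at z within A)" using ld le by (rule tendsto_add_zero)
    moreover have "\<forall>\<^sub>F w in at z within A. norm (nrm X (\<lambda>i. (f w i + g w i - (f z i + g z i)) / (w - z) - (d i + e i)))
       \<le> nrm X (\<lambda>i. (f w i - f z i) / (w - z) - d i) + nrm X (\<lambda>i. (g w i - g z i) / (w - z) - e i)"
      unfolding eventually_at_filter
    proof (rule always_eventually, intro allI impI)
      fix w assume w: "w \<in> A"
      have f: "(\<lambda>i. (f w i - f z i) / (w - z) - d i) \<in> vecs X"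
        using diff[OF scale[OF diff[OF assms(2)[OF w] assms(2)[OF z]], of "inverse (w - z)"] d]
        by (simp add: field_simps)
      have g: "(\<lambda>i. (g w i - g z i) / (w - z) - e i) \<in> vecs X"
        using diff[OF scale[OF diff[OF assms(3)[OF w] assms(3)[OF z]], of "inverse (w - z)"] e]
        by (simp add: field_simps)
      have "(\<lambda>i. (f w i + g w i - (f z i + g z i)) / (w - z) - (d i + e i))
        = (\<lambda>i. ((f w i - f z i) / (w - z) - d i) + ((g w i - g z i) / (w - z) - e i))"
        by (auto simp: diff_divide_distrib add_divide_distrib)
      then show "norm (nrm X (\<lambda>i. (f w i + g w i - (f z i + g z i)) / (w - z) - (d i + e i)))
       \<le> nrm X (\<lambda>i. (f w i - f z i) / (w - z) - d i) + nrm X (\<lambda>i. (g w i - g z i) / (w - z) - e i)"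
        using triangle[OF f g] nonneg[OF add[OF f g]] by simp
    qed
    ultimately show "((\<lambda>w. nrm X (\<lambda>i. (f w i + g w i - (f z i + g z i)) / (w - z) - (d i + e i))) \<longlongrightarrow> 0)
      (at z within A)" by (rule Lim_null_comparison[rotated])
  qed
qed

lemma holomorphic_into_mult:
  assumes "seminormed X" "\<And>z. z \<in> A \<Longrightarrow> f z \<in> vecs X" "holomorphic_into X A f"
    "contractive X w" "h holomorphic_on A"
  shows "holomorphic_into X A (\<lambda>z i. h z * (w i * f z i))"
  unfolding holomorphic_into_def
proof
  interpret seminormed X by fact
  fix z assume z: "z \<in> A"
  obtain d where d: "d \<in> vecs X"
    and ld: "((\<lambda>v. nrm X (\<lambda>i. (f v i - f z i) / (v - z) - d i)) \<longlongrightarrow> 0) (at z within A)"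
    using assms(3) z unfolding holomorphic_into_def by blast
  obtain h' where h': "(h has_field_derivative h') (at z within A)"
    using assms(5) z unfolding holomorphic_on_def field_differentiable_def by blast
  have hz: "(h \<longlongrightarrow> h z) (at z within A)"
    using DERIV_continuous[OF h'] by (simp add: continuous_within)
  have hd: "((\<lambda>v. (h v - h z) / (v - z)) \<longlongrightarrow> h') (at z within A)"
    using h' by (simp add: has_field_derivative_iff)
  have fz: "f z \<in> vecs X" using z assms(2) by auto
  note w = contractiveD[OF assms(4)]
  show "\<exists>d\<in>vecs X. ((\<lambda>v. nrm X (\<lambda>i. (h v * (w i * f v i) - h z * (w i * f z i)) / (v - z) - d i)) \<longlongrightarrow> 0)
      (at z within A)"
  proof
    let ?d = "\<lambda>i. h' * (w i * f z i) + h z * (w i * d i)"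
    \<comment> \<open>The summands match the splitting \<open>eq\<close> of the product rule: the
      error of the difference quotient of \<open>f\<close>, the continuity of \<open>h\<close>, and
      the error of the difference quotient of \<open>h\<close>.\<close>
    let ?u = "\<lambda>v. norm (h v) * nrm X (\<lambda>i. (f v i - f z i) / (v - z) - d i) + (norm (h v - h z) * nrm X d +
        norm ((h v - h z) / (v - z) - h') * nrm X (f z))"
    show "?d \<in> vecs X" by (intro add scale w d fz)
    have "(?u \<longlongrightarrow> norm (h z) * 0 + (norm (h z - h z) * nrm X d + norm (h' - h') * nrm X (f z))) (at z within A)"
      by (intro tendsto_intros hz ld hd)
    then have "(?u \<longlongrightarrow> 0) (at z within A)" by simp
    moreover have "\<forall>\<^sub>F v in at z within A.
      norm (nrm X (\<lambda>i. (h v * (w i * f v i) - h z * (w i * f z i)) / (v - z) - ?d i)) \<le> ?u v"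
      unfolding eventually_at_filter
    proof (rule always_eventually, intro allI impI)
      fix v assume v: "v \<in> A" "v \<noteq> z"
      have f: "(\<lambda>i. (f v i - f z i) / (v - z) - d i) \<in> vecs X"
        using diff[OF scale[OF diff[OF assms(2)[OF v(1)] assms(2)[OF z]], of "inverse (v - z)"] d]
        by (simp add: field_simps)
      note 1 = w[OF f] and 2 = w[OF d] and 3 = w[OF fz]
      have eq: "(\<lambda>i. (h v * (w i * f v i) - h z * (w i * f z i)) / (v - z) - ?d i)
        = (\<lambda>i. h v * (w i * ((f v i - f z i) / (v - z) - d i)) + ((h v - h z) * (w i * d i)
           + ((h v - h z) / (v - z) - h') * (w i * f z i)))"
      proof
        fix i
        have a: "v - z \<noteq> 0" using v by simp
        show "(h v * (w i * f v i) - h z * (w i * f z i)) / (v - z) - ?d i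
          = h v * (w i * ((f v i - f z i) / (v - z) - d i)) + ((h v - h z) * (w i * d i)
           + ((h v - h z) / (v - z) - h') * (w i * f z i))"
          using a by (simp add: diff_divide_distrib right_diff_distrib left_diff_distrib mult.commute mult.left_commute)
      qed
      have "nrm X (\<lambda>i. (h v * (w i * f v i) - h z * (w i * f z i)) / (v - z) - ?d i)
        \<le> norm (h v) * nrm X (\<lambda>i. w i * ((f v i - f z i) / (v - z) - d i)) +
          nrm X (\<lambda>i. (h v - h z) * (w i * d i) + ((h v - h z) / (v - z) - h') * (w i * f z i))"
        unfolding eq nrm_scale[OF 1(1), symmetric] by (intro triangle add scale 1 2 3)
      also have "nrm X (\<lambda>i. (h v - h z) * (w i * d i) + ((h v - h z) / (v - z) - h') * (w i * f z i))
         \<le> norm (h v - h z) * nrm X (\<lambda>i. w i * d i) +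
           norm ((h v - h z) / (v - z) - h') * nrm X (\<lambda>i. w i * f z i)"
        unfolding nrm_scale[OF 2(1), symmetric] nrm_scale[OF 3(1), symmetric] by (intro triangle scale 2 3)
      also have "norm (h v) * nrm X (\<lambda>i. w i * ((f v i - f z i) / (v - z) - d i)) +
          (norm (h v - h z) * nrm X (\<lambda>i. w i * d i) +
           norm ((h v - h z) / (v - z) - h') * nrm X (\<lambda>i. w i * f z i)) \<le> ?u v"
        by (intro add_mono mult_left_mono 1 2 3) auto
      finally have "nrm X (\<lambda>i. (h v * (w i * f v i) - h z * (w i * f z i)) / (v - z) - ?d i) \<le> ?u v" by simp
      moreover have "0 \<le> nrm X (\<lambda>i. (h v * (w i * f v i) - h z * (w i * f z i)) / (v - z) - ?d i)"
        unfolding eq by (intro nonneg add scale 1 2 3)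
      ultimately show "norm (nrm X (\<lambda>i. (h v * (w i * f v i) - h z * (w i * f z i)) / (v - z) - ?d i)) \<le> ?u v"
        by simp
    qed
    ultimately show "((\<lambda>v. nrm X (\<lambda>i. (h v * (w i * f v i) - h z * (w i * f z i)) / (v - z) - ?d i)) \<longlongrightarrow> 0)
      (at z within A)" by (rule Lim_null_comparison[rotated])
  qed
qed

lemma C0_into_add:
  assumes "seminormed X" "C0_into X f" "C0_into X g"
  shows "C0_into X (\<lambda>t i. f t i + g t i)"
proof -
  interpret seminormed X by fact
  have f: "f t \<in> vecs X" and g: "g t \<in> vecs X" for t using assms by (auto simp: C0_into_def)
  have "((\<lambda>t. nrm X (f t) + nrm X (g t)) \<longlongrightarrow> 0) at_infinity"
    using assms by (auto simp: C0_into_def intro: tendsto_add_zero)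
  moreover have "\<forall>\<^sub>F t in at_infinity. norm (nrm X (\<lambda>i. f t i + g t i)) \<le> nrm X (f t) + nrm X (g t)"
    using triangle[OF f g] nonneg[OF add[OF f g]] by (intro always_eventually) auto
  ultimately have "((\<lambda>t. nrm X (\<lambda>i. f t i + g t i)) \<longlongrightarrow> 0) at_infinity"
    by (rule Lim_null_comparison[rotated])
  then show ?thesis
    using continuous_into_add[OF assms(1), of UNIV f g] assms f g add[OF f g] by (auto simp: C0_into_def)
qed

lemma C0_into_mult:
  fixes h :: "real \<Rightarrow> complex"
  assumes "seminormed X" "C0_into X f" "contractive X w" "continuous_on UNIV h" "\<And>t. norm (h t) \<le> H"
  shows "C0_into X (\<lambda>t i. h t * (w i * f t i))"
proof -
  interpret seminormed X by fact
  have f: "f t \<in> vecs X" for t using assms by (auto simp: C0_into_def)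
  note 1 = contractiveD[OF assms(3) f]
  have "((\<lambda>t. H * nrm X (f t)) \<longlongrightarrow> 0) at_infinity"
    using assms by (auto simp: C0_into_def intro: tendsto_mult_right_zero)
  moreover have "\<forall>\<^sub>F t in at_infinity. norm (nrm X (\<lambda>i. h t * (w i * f t i))) \<le> H * nrm X (f t)"
  proof (rule always_eventually, rule allI)
    fix t
    have "norm (h t) * nrm X (\<lambda>i. w i * f t i) \<le> H * nrm X (f t)"
      using order_trans[OF norm_ge_zero assms(5)[of t]] by (intro mult_mono 1 assms(5) nonneg f)
    then show "norm (nrm X (\<lambda>i. h t * (w i * f t i))) \<le> H * nrm X (f t)"
      using nonneg[OF 1(1)] by (simp add: nrm_scale[OF 1(1)] abs_mult)
  qed
  ultimately have "((\<lambda>t. nrm X (\<lambda>i. h t * (w i * f t i))) \<longlongrightarrow> 0) at_infinity"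
    by (rule Lim_null_comparison[rotated])
  then show ?thesis
    using continuous_into_mult[OF assms(1), of UNIV f w h] assms f scale[OF 1(1)]
    by (auto simp: C0_into_def)
qed

text \<open>This gives the suprema in \<open>calderon_norm\<close> their meaning: decay bounds the
  norm far out, compactness of an interval bounds it on the rest of the line.\<close>

lemma C0_into_bounded:
  assumes "seminormed X" "C0_into X f"
  shows "bdd_above (range (\<lambda>t. nrm X (f t)))"
proof -
  have c: "continuous_on UNIV (\<lambda>t. nrm X (f t))"
    using assms by (intro continuous_into_nrm) (auto simp: C0_into_def)
  have "((\<lambda>t. nrm X (f t)) \<longlongrightarrow> 0) at_infinity" using assms by (simp add: C0_into_def)
  then have "\<forall>\<^sub>F t in at_infinity. dist (nrm X (f t)) 0 < 1" by (rule tendstoD) simp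
  then obtain b where b: "\<And>t. norm t \<ge> b \<Longrightarrow> dist (nrm X (f t)) 0 < 1"
    unfolding eventually_at_infinity by auto
  have "compact ((\<lambda>t. nrm X (f t)) ` {-b..b})"
    by (intro compact_continuous_image continuous_on_subset[OF c]) auto
  then have "bdd_above ((\<lambda>t. nrm X (f t)) ` {-b..b})"
    by (intro bounded_imp_bdd_above compact_imp_bounded)
  then obtain M where M: "\<And>t. t \<in> {-b..b} \<Longrightarrow> nrm X (f t) \<le> M"
    unfolding bdd_above_def by blast
  have "nrm X (f t) \<le> max M 1" for t
  proof (cases "norm t \<ge> b")
    case True
    with b[OF this] show ?thesis by (auto simp: dist_real_def)
  next
    case False
    then have "t \<in> {-b..b}" by auto
    from M[OF this] show ?thesis by simp
  qed
  then show ?thesis unfolding bdd_above_def by blast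
qed

section \<open>Calderon's function space and the seminorm it induces\<close>

context couple
begin

lemma calderon_funD:
  assumes "f \<in> calderon_fun X0 X1"
  shows "z \<in> strip \<Longrightarrow> f z \<in> vecs S" "bounded_into S strip f" "continuous_into S strip f"
    "holomorphic_into S (interior strip) f" "C0_into X0 (\<lambda>t. f (Complex 0 t))"
    "C0_into X1 (\<lambda>t. f (Complex 1 t))" "f (Complex 0 t) \<in> vecs X0" "f (Complex 1 t) \<in> vecs X1"
  using assms by (auto simp: calderon_fun_def C0_into_def)

lemma calderon_norm_ge:
  assumes "f \<in> calderon_fun X0 X1"
  shows "nrm X0 (f (Complex 0 t)) \<le> calderon_norm X0 X1 f"
    "nrm X1 (f (Complex 1 t)) \<le> calderon_norm X0 X1 f"
proof -
  have "nrm X0 (f (Complex 0 t)) \<le> (SUP t. nrm X0 (f (Complex 0 t)))"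
    by (intro cSUP_upper C0_into_bounded X0.seminormed_axioms calderon_funD[OF assms]) auto
  then show "nrm X0 (f (Complex 0 t)) \<le> calderon_norm X0 X1 f" unfolding calderon_norm_def by linarith
  have "nrm X1 (f (Complex 1 t)) \<le> (SUP t. nrm X1 (f (Complex 1 t)))"
    by (intro cSUP_upper C0_into_bounded X1.seminormed_axioms calderon_funD[OF assms]) auto
  then show "nrm X1 (f (Complex 1 t)) \<le> calderon_norm X0 X1 f" unfolding calderon_norm_def by linarith
qed

lemma calderon_norm_le:
  assumes "\<And>t. nrm X0 (f (Complex 0 t)) \<le> B" "\<And>t. nrm X1 (f (Complex 1 t)) \<le> B"
  shows "calderon_norm X0 X1 f \<le> B"
  unfolding calderon_norm_def by (intro max.boundedI cSUP_least assms) simp_all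

lemma calderon_norm_nonneg:
  assumes "f \<in> calderon_fun X0 X1"
  shows "0 \<le> calderon_norm X0 X1 f"
  using calderon_norm_ge(1)[OF assms, of 0] X0.nonneg[OF calderon_funD(7)[OF assms], of 0] by linarith

lemma calderon_zero: "(\<lambda>z i. 0) \<in> calderon_fun X0 X1"
  by (auto simp: calderon_fun_def S.zero X0.zero X1.zero bounded_into_def continuous_into_def
      holomorphic_into_def C0_into_def S.nrm_zero X0.nrm_zero X1.nrm_zero intro!: bexI[of _ "\<lambda>i. 0"])

lemma calderon_add:
  assumes f: "f \<in> calderon_fun X0 X1" and g: "g \<in> calderon_fun X0 X1"
  shows "(\<lambda>z i. f z i + g z i) \<in> calderon_fun X0 X1"
proof -
  note f' = calderon_funD[OF f] and g' = calderon_funD[OF g]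
  obtain A B where A: "\<And>z. z \<in> strip \<Longrightarrow> nrm S (f z) \<le> A" and B: "\<And>z. z \<in> strip \<Longrightarrow> nrm S (g z) \<le> B"
    using f'(2) g'(2) unfolding bounded_into_def by blast
  have "nrm S (\<lambda>i. f z i + g z i) \<le> A + B" if "z \<in> strip" for z
    using S.triangle[OF f'(1)[OF that] g'(1)[OF that]] A[OF that] B[OF that] by linarith
  then have "bounded_into S strip (\<lambda>z i. f z i + g z i)" unfolding bounded_into_def by blast
  moreover have i: "z \<in> strip" if "z \<in> interior strip" for z
    using that interior_subset[of strip] by auto
  moreover have "holomorphic_into S (interior strip) (\<lambda>z i. f z i + g z i)"
    by (intro holomorphic_into_add S.seminormed_axioms f' g' i)
  ultimately show ?thesis unfolding calderon_fun_def mem_Collect_eq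
    by (intro conjI ballI S.add continuous_into_add C0_into_add
        X0.seminormed_axioms X1.seminormed_axioms S.seminormed_axioms f' g')
qed

text \<open>All competitors for the interpolation norm arise from this closure property or from
  sums: \<open>h = 1\<close> gives the multipliers, \<open>w = 1\<close> the scalars, and the
  smallest block needs both factors. Holomorphy on a set that contains the closed strip also
  supplies the continuity up to the boundary.\<close>

lemma calderon_mult:
  assumes f: "f \<in> calderon_fun X0 X1" and w: "contractive X0 w" "contractive X1 w"
    and h: "h holomorphic_on A" "strip \<subseteq> A" "\<And>z. z \<in> strip \<Longrightarrow> norm (h z) \<le> H"
  shows "(\<lambda>z i. h z * (w i * f z i)) \<in> calderon_fun X0 X1"
proof -
  note f' = calderon_funD[OF f] and ws = contractive_sum[OF w]
  note 1 = contractiveD[OF ws f'(1)]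
  obtain B where B: "\<And>z. z \<in> strip \<Longrightarrow> nrm S (f z) \<le> B"
    using f'(2) unfolding bounded_into_def by blast
  have "nrm S (\<lambda>i. h z * (w i * f z i)) \<le> H * B" if "z \<in> strip" for z
    unfolding S.nrm_scale[OF 1(1)[OF that]]
    using order_trans[OF norm_ge_zero h(3)[OF that]]
    by (intro mult_mono h order_trans[OF 1(2) B] S.nonneg 1 that)
  then have b: "bounded_into S strip (\<lambda>z i. h z * (w i * f z i))" unfolding bounded_into_def by blast
  have i: "interior strip \<subseteq> strip" by (rule interior_subset)
  have ch: "continuous_on strip h"
    using holomorphic_on_imp_continuous_on[OF h(1)] h(2) by (rule continuous_on_subset)
  have hi: "h holomorphic_on interior strip"
    using h i by (auto intro: holomorphic_on_subset)
  have s: "Complex 0 t \<in> strip" "Complex 1 t \<in> strip" for t by (auto simp: strip_def)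
  have eq: "Complex a t = of_real a + \<i> * of_real t" for a t by (simp add: complex_eq_iff)
  have cc: "continuous_on UNIV (Complex a)" for a
    unfolding eq by (intro continuous_intros)
  have c: "continuous_on UNIV (\<lambda>t. h (Complex 0 t))" "continuous_on UNIV (\<lambda>t. h (Complex 1 t))"
    by (rule continuous_on_compose2[OF ch cc], use s in auto)+
  have fi: "f z \<in> vecs S" if "z \<in> interior strip" for z
    using that i f'(1) by auto
  show ?thesis unfolding calderon_fun_def mem_Collect_eq
  proof (intro conjI ballI)
    show "(\<lambda>i. h z * (w i * f z i)) \<in> vecs S" if "z \<in> strip" for z
      by (intro S.scale 1 that)
    show "continuous_into S strip (\<lambda>z i. h z * (w i * f z i))"
      by (intro continuous_into_mult S.seminormed_axioms f' ws ch)
    show "holomorphic_into S (interior strip) (\<lambda>z i. h z * (w i * f z i))"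
      by (intro holomorphic_into_mult S.seminormed_axioms f' fi ws hi)
    show "C0_into X0 (\<lambda>t i. h (Complex 0 t) * (w i * f (Complex 0 t) i))"
      by (rule C0_into_mult[OF X0.seminormed_axioms f'(5) w(1) c(1) h(3)[OF s(1)]])
    show "C0_into X1 (\<lambda>t i. h (Complex 1 t) * (w i * f (Complex 1 t) i))"
      by (rule C0_into_mult[OF X1.seminormed_axioms f'(6) w(2) c(2) h(3)[OF s(2)]])
  qed (rule b)
qed

lemma interpolation_in:
  "f \<in> calderon_fun X0 X1 \<Longrightarrow> f (of_real \<theta>) \<in> vecs (complex_interpolation X0 X1 \<theta>)"
  by (auto simp: complex_interpolation_def)

lemma interpolation_nrm_le:
  assumes "f \<in> calderon_fun X0 X1"
  shows "nrm (complex_interpolation X0 X1 \<theta>) (f (of_real \<theta>)) \<le> calderon_norm X0 X1 f"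
  unfolding complex_interpolation_def fspace.simps
  by (rule cInf_lower) (use assms in \<open>auto intro!: bdd_belowI[of _ 0] calderon_norm_nonneg\<close>)

lemma interpolation_nrm_less:
  assumes "x \<in> vecs (complex_interpolation X0 X1 \<theta>)" "nrm (complex_interpolation X0 X1 \<theta>) x < r"
  obtains f where "f \<in> calderon_fun X0 X1" "f (of_real \<theta>) = x" "calderon_norm X0 X1 f < r"
proof -
  let ?A = "{calderon_norm X0 X1 f | f. f \<in> calderon_fun X0 X1 \<and> f (of_real \<theta>) = x}"
  have "?A \<noteq> {}" using assms(1) by (auto simp: complex_interpolation_def)
  moreover have "bdd_below ?A"
    by (auto intro!: bdd_belowI[of _ 0] calderon_norm_nonneg)
  moreover have "Inf ?A < r" using assms(2) by (simp add: complex_interpolation_def)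
  ultimately obtain a where "a \<in> ?A" "a < r" by (metis (no_types, lifting) cInf_less_iff)
  then show ?thesis using that by blast
qed

lemma contractive_interpolation:
  assumes "contractive X0 w" "contractive X1 w"
  shows "contractive (complex_interpolation X0 X1 \<theta>) w"
  unfolding contractive_def
proof (intro ballI conjI)
  let ?Z = "complex_interpolation X0 X1 \<theta>"
  have m: "(\<lambda>z i. w i * f z i) \<in> calderon_fun X0 X1" if "f \<in> calderon_fun X0 X1" for f
    using calderon_mult[OF that assms, of "\<lambda>z. 1" UNIV 1] by simp
  fix x assume x: "x \<in> vecs ?Z"
  show "(\<lambda>i. w i * x i) \<in> vecs ?Z"
    using x m interpolation_in by (fastforce simp: complex_interpolation_def)
  show "nrm ?Z (\<lambda>i. w i * x i) \<le> nrm ?Z x"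
  proof (rule dense_ge)
    fix r assume "nrm ?Z x < r"
    from interpolation_nrm_less[OF x this] obtain f where
      f: "f \<in> calderon_fun X0 X1" "f (of_real \<theta>) = x" "calderon_norm X0 X1 f < r" .
    have "nrm ?Z (\<lambda>i. w i * x i) \<le> calderon_norm X0 X1 (\<lambda>z i. w i * f z i)"
      using interpolation_nrm_le[OF m[OF f(1)], where \<theta>=\<theta>] f(2) by simp
    also have "\<dots> \<le> calderon_norm X0 X1 f"
      by (intro calderon_norm_le order_trans[OF contractiveD(2)] assms calderon_funD[OF f(1)]
          calderon_norm_ge[OF f(1)])
    finally show "nrm ?Z (\<lambda>i. w i * x i) \<le> r" using f(3) by simp
  qed
qed

sublocale Z: seminormed "complex_interpolation X0 X1 \<theta>" for \<theta>
proof
  let ?Z = "complex_interpolation X0 X1 \<theta>"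
  show "(\<lambda>i. 0) \<in> vecs ?Z" using interpolation_in[OF calderon_zero] by simp
  have m: "(\<lambda>z i. c * f z i) \<in> calderon_fun X0 X1" if "f \<in> calderon_fun X0 X1" for f c
    using calderon_mult[OF that contractive_one contractive_one, of "\<lambda>z. c" UNIV "norm c"] by simp
  fix x y assume x: "x \<in> vecs ?Z"
  show "0 \<le> nrm ?Z x"
  proof (rule ccontr)
    assume "\<not> 0 \<le> nrm ?Z x"
    with interpolation_nrm_less[OF x, of 0] calderon_norm_nonneg show False
      by (metis not_less)
  qed
  show "(\<lambda>i. c * x i) \<in> vecs ?Z" for c
    using x m interpolation_in by (fastforce simp: complex_interpolation_def)
  show "nrm ?Z (\<lambda>i. c * x i) \<le> norm c * nrm ?Z x" for c
  proof (rule field_le_epsilon)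
    fix e :: real assume e: "e > 0"
    define e' where "e' = e / (norm c + 1)"
    have e': "e' > 0" using e by (simp add: e'_def add_nonneg_pos)
    then have "nrm ?Z x < nrm ?Z x + e'" by simp
    from interpolation_nrm_less[OF x this] obtain f where
      f: "f \<in> calderon_fun X0 X1" "f (of_real \<theta>) = x" "calderon_norm X0 X1 f < nrm ?Z x + e'" .
    have "nrm ?Z (\<lambda>i. c * x i) \<le> calderon_norm X0 X1 (\<lambda>z i. c * f z i)"
      using interpolation_nrm_le[OF m[OF f(1)], where \<theta>=\<theta>] f(2) by simp
    also have "\<dots> \<le> norm c * calderon_norm X0 X1 f"
      by (intro calderon_norm_le) (auto simp: X0.nrm_scale X1.nrm_scale calderon_funD[OF f(1)]
          intro!: mult_left_mono calderon_norm_ge[OF f(1)])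
    also have "\<dots> \<le> norm c * (nrm ?Z x + e')" using f(3) by (intro mult_left_mono) auto
    also have "norm c * e' \<le> e"
    proof -
      have "norm c * e \<le> e * (norm c + 1)" using e by (simp add: algebra_simps)
      then show ?thesis unfolding e'_def
        by (simp add: divide_le_eq add_nonneg_pos)
    qed
    then have "norm c * (nrm ?Z x + e') \<le> norm c * nrm ?Z x + e" by (simp add: algebra_simps)
    finally show "nrm ?Z (\<lambda>i. c * x i) \<le> norm c * nrm ?Z x + e" .
  qed
  assume y: "y \<in> vecs ?Z"
  show "(\<lambda>i. x i + y i) \<in> vecs ?Z"
    using x y calderon_add interpolation_in[of _ \<theta>] by (fastforce simp: complex_interpolation_def)
  show "nrm ?Z (\<lambda>i. x i + y i) \<le> nrm ?Z x + nrm ?Z y"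
  proof (rule field_le_epsilon)
    fix e :: real assume e: "e > 0"
    then have "nrm ?Z x < nrm ?Z x + e / 2" "nrm ?Z y < nrm ?Z y + e / 2" by simp_all
    note less = this
    obtain f where
      f: "f \<in> calderon_fun X0 X1" "f (of_real \<theta>) = x" "calderon_norm X0 X1 f < nrm ?Z x + e / 2"
      by (rule interpolation_nrm_less[OF x less(1)])
    obtain g where
      g: "g \<in> calderon_fun X0 X1" "g (of_real \<theta>) = y" "calderon_norm X0 X1 g < nrm ?Z y + e / 2"
      by (rule interpolation_nrm_less[OF y less(2)])
    have "nrm ?Z (\<lambda>i. x i + y i) \<le> calderon_norm X0 X1 (\<lambda>z i. f z i + g z i)"
      using interpolation_nrm_le[OF calderon_add[OF f(1) g(1)], where \<theta>=\<theta>] f(2) g(2) by simp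
    also have "\<dots> \<le> calderon_norm X0 X1 f + calderon_norm X0 X1 g"
      by (intro calderon_norm_le order_trans[OF X0.triangle] order_trans[OF X1.triangle] add_mono
          calderon_funD[OF f(1)] calderon_funD[OF g(1)] calderon_norm_ge f g)
    finally show "nrm ?Z (\<lambda>i. x i + y i) \<le> nrm ?Z x + nrm ?Z y + e" using f(3) g(3) by simp
  qed
qed

end

subsection \<open>The lower estimate for interpolated block decompositions\<close>

text \<open>The values of \<open>f\<close> are small outside a compact interval and are approximated
  on it by finitely many of them. Contractivity carries the smallness of \<open>w N\<close> on these
  finitely many vectors over to all the others.\<close>

lemma C0_into_uniform:
  assumes "seminormed X" "C0_into X f" "\<And>N. contractive X (w N)"
    and lim: "\<And>x. x \<in> vecs X \<Longrightarrow> (\<lambda>N. nrm X (\<lambda>i. w N i * x i)) \<longlonglongrightarrow> 0" and e: "e > 0"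
  shows "\<forall>\<^sub>F N in sequentially. \<forall>t. nrm X (\<lambda>i. w N i * f t i) \<le> e"
proof -
  interpret seminormed X by fact
  have f: "f t \<in> vecs X" for t using assms(2) by (auto simp: C0_into_def)
  note w = contractiveD[OF assms(3)]
  have "((\<lambda>t. nrm X (f t)) \<longlongrightarrow> 0) at_infinity" using assms by (simp add: C0_into_def)
  then have "\<forall>\<^sub>F t in at_infinity. dist (nrm X (f t)) 0 < e" by (rule tendstoD) (rule e)
  then obtain b where b: "\<And>t. norm t \<ge> b \<Longrightarrow> dist (nrm X (f t)) 0 < e"
    unfolding eventually_at_infinity by auto
  have "\<exists>U. open U \<and> t \<in> U \<and> (\<forall>s\<in>U. nrm X (\<lambda>i. f s i - f t i) < e / 2)" for t
  proof -
    have "((\<lambda>s. nrm X (\<lambda>i. f s i - f t i)) \<longlongrightarrow> 0) (at t)"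
      using assms(2) unfolding C0_into_def continuous_into_def by blast
    then have "\<forall>\<^sub>F s in at t. nrm X (\<lambda>i. f s i - f t i) < e / 2"
      by (rule order_tendstoD) (use e in auto)
    then obtain U where U: "open U" "t \<in> U" "\<And>s. s \<in> U \<Longrightarrow> s \<noteq> t \<Longrightarrow> nrm X (\<lambda>i. f s i - f t i) < e / 2"
      unfolding eventually_at_topological by auto
    have "nrm X (\<lambda>i. f s i - f t i) < e / 2" if "s \<in> U" for s
      using U(3)[OF that] e nrm_zero by (cases "s = t") auto
    with U(1,2) show ?thesis by blast
  qed
  then obtain U where U: "\<And>t. open (U t)" "\<And>t. t \<in> U t" "\<And>s t. s \<in> U t \<Longrightarrow> nrm X (\<lambda>i. f s i - f t i) < e / 2"
    by metis
  have "compact {-b..b}" by simp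
  then obtain T where T: "T \<subseteq> {-b..b}" "finite T" "{-b..b} \<subseteq> (\<Union>t\<in>T. U t)"
    by (rule compactE_image[of _ "{-b..b}" U]) (use U in auto)
  have "\<forall>\<^sub>F N in sequentially. \<forall>t\<in>T. nrm X (\<lambda>i. w N i * f t i) < e / 2"
    unfolding eventually_ball_finite_distrib[OF T(2)]
    by (intro ballI order_tendstoD(2)[OF lim[OF f]]) (use e in auto)
  then show ?thesis
  proof eventually_elim
    case (elim N)
    show ?case
    proof
      fix t
      show "nrm X (\<lambda>i. w N i * f t i) \<le> e"
      proof (cases "norm t \<ge> b")
        case True
        from b[OF this] w(2)[OF f, of N t] show ?thesis by (auto simp: dist_real_def)
      next
        case False
        then have "t \<in> {-b..b}" by auto
        with T obtain s where s: "s \<in> T" "t \<in> U s" by auto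
        have d: "(\<lambda>i. f t i - f s i) \<in> vecs X" by (intro diff f)
        have "nrm X (\<lambda>i. w N i * (f t i - f s i) + w N i * f s i) \<le>
            nrm X (\<lambda>i. w N i * (f t i - f s i)) + nrm X (\<lambda>i. w N i * f s i)"
          by (intro triangle w d f)
        also have "\<dots> \<le> e / 2 + e / 2"
          using elim s(1) w(2)[OF d, of N] U(3)[OF s(2)] by force
        finally show ?thesis by (simp add: algebra_simps)
      qed
    qed
  qed
qed

text \<open>A Riemann sum for the integral of \<open>exp (- \<bar>t\<bar>)\<close>, which is
  \<open>2\<close>; what matters is a bound that depends neither on the mesh nor on the number of
  points.\<close>

lemma sum_exp_grid:
  fixes d :: real
  assumes "0 < d" "d \<le> 1"
  shows "(\<Sum>j\<in>{- int N..int N}. d * exp (- \<bar>of_int j * d\<bar>)) \<le> 4"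
proof -
  define q where "q = exp (- d)"
  have q: "0 < q" "q < 1" using assms by (auto simp: q_def)
  have e: "exp (- \<bar>of_int j * d\<bar>) = q ^ nat \<bar>j\<bar>" for j
    using assms by (simp add: q_def exp_of_nat_mult[symmetric] abs_mult)
  have s: "(\<Sum>j\<in>{- int N..int N}. q ^ nat \<bar>j\<bar>) \<le> 2 * (\<Sum>i\<le>N. q ^ i)"
  proof (induction N)
    case (Suc N)
    have "{- int (Suc N)..int (Suc N)} = insert (int (Suc N)) (insert (- int (Suc N)) {- int N..int N})"
      by auto
    then have "(\<Sum>j\<in>{- int (Suc N)..int (Suc N)}. q ^ nat \<bar>j\<bar>) = 2 * q ^ Suc N + (\<Sum>j\<in>{- int N..int N}. q ^ nat \<bar>j\<bar>)"
      by (simp add: nat_add_distrib)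
    with Suc show ?case by simp
  qed simp
  have "(\<Sum>i\<le>N. q ^ i) \<le> (\<Sum>i. q ^ i)"
    by (intro sum_le_suminf summable_geometric) (use q in auto)
  also have "\<dots> = 1 / (1 - q)" using q by (intro suminf_geometric) auto
  \<comment> \<open>Since \<open>d \<le> 1\<close>, the number \<open>1 - exp (- d)\<close> is at
    least \<open>d / 2\<close>.\<close>
  also have "\<dots> \<le> 2 / d"
  proof -
    have "q = 1 / exp d" by (simp add: q_def exp_minus inverse_eq_divide)
    also have "\<dots> \<le> 1 / (1 + d)" using assms by (intro divide_left_mono exp_ge_add_one_self) auto
    also have "\<dots> \<le> 1 - d / 2" using assms by (simp add: field_simps)
    finally have "d \<le> 2 * (1 - q)" by simp
    then show ?thesis using assms q by (simp add: field_simps)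
  qed
  finally have "(\<Sum>i\<le>N. q ^ i) \<le> 2 / d" .
  with s have "(\<Sum>j\<in>{- int N..int N}. q ^ nat \<bar>j\<bar>) \<le> 4 / d" by simp
  then have "d * (\<Sum>j\<in>{- int N..int N}. q ^ nat \<bar>j\<bar>) \<le> 4" using assms by (simp add: field_simps)
  then show ?thesis by (simp add: e sum_distrib_left)
qed

text \<open>The function \<open>a\<close> is only controlled on average over a grid, not pointwise. The rational function
  \<open>V\<close> below replaces the Poisson integral of \<open>a\<close>: its real part is positive on the strip and, on
  the left boundary line, already the summand of the nearest grid point makes it dominate \<open>a\<close> up to the
  weight \<open>exp \<bar>t\<bar>\<close>. As the logarithm of \<open>V\<close> has bounded imaginary part, \<open>V\<close> to the power
  \<open>- (1 - z)\<close> behaves like \<open>1 / V\<close> on the left line and like \<open>1\<close> on the right one, up to factors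
  absorbed by \<open>exp (z^2)\<close>.\<close>

lemma outer_function:
  fixes a :: "real \<Rightarrow> real"
  assumes \<beta>: "\<beta> > 0" and d: "0 < d" "d \<le> 1" and a: "\<And>t. a t \<ge> 0" and B: "B > 0" and \<theta>: "0 < \<theta>" "\<theta> < 1"
    and J: "finite J"
    and grid: "\<And>t. a t \<le> \<beta> \<or> (\<exists>j\<in>J. \<bar>t - of_int j * d\<bar> \<le> d \<and> a t \<le> a (of_int j * d) + \<beta>)"
    and sum: "(\<Sum>j\<in>J. d * exp (- \<bar>of_int j * d\<bar>) * a (of_int j * d)) \<le> 4 * \<beta>"
  obtains h A H where "h holomorphic_on A" "strip \<subseteq> A" "\<And>z. z \<in> strip \<Longrightarrow> norm (h z) \<le> H"
    "\<And>t. norm (h (Complex 0 t)) * a t \<le> 2 * exp 4 * B"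
    "\<And>t. norm (h (Complex 1 t)) \<le> exp 2"
    "norm (h (of_real \<theta>)) \<ge> ((1 + 4 / \<theta>) * \<beta> / B) powr (- (1 - \<theta>))"
proof -
  define c where "c j = d * exp (- \<bar>of_int j * d\<bar>) * a (of_int j * d)" for j
  \<comment> \<open>The poles of \<open>V\<close> lie at distance \<open>d\<close> to the left of
    the grid points. So \<open>V\<close> is holomorphic on \<open>A\<close>, which contains the
    strip, and at boundary points within \<open>d\<close> of a grid point the real part of
    \<open>1 / u\<close> is at least \<open>1 / (2 * d)\<close>, which cancels the mesh factor in
    \<open>c\<close>.\<close>
  define u where "u j z = z + of_real d - \<i> * of_real (of_int j * d)" for j z
  define V where "V z = of_real \<beta> + (\<Sum>j\<in>J. of_real (c j) / u j z)" for z
  define A where "A = {z. Re z > - d}"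
  define W where "W z = V z / of_real B" for z
  \<comment> \<open>Subtracting the square of \<open>\<theta>\<close> makes the Gaussian factor
    equal to \<open>1\<close> at \<open>\<theta>\<close>, so that only the power of \<open>W\<close>
    is left there.\<close>
  define h where "h z = exp (z\<^sup>2 - (of_real \<theta>)\<^sup>2 - (1 - z) * Ln (W z))" for z
  have c: "c j \<ge> 0" for j using d a by (simp add: c_def)
  have Reu: "Re (u j z) = Re z + d" for j z by (simp add: u_def)
  have Req: "Re (of_real (c j) / u j z) = c j * (Re z + d) / (norm (u j z))\<^sup>2" for j z
    by (simp add: Re_divide' Reu cmod_power2 flip: cmod_def)
  have Req0: "Re (of_real (c j) / u j z) \<ge> 0" if "z \<in> A" for j z
    unfolding Req using that c by (auto simp: A_def)
  have ReV: "Re (V z) \<ge> \<beta>" if "z \<in> A" for z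
    using Req0[OF that] by (simp add: V_def sum_nonneg del: Re_divide_of_real)
  have ReV_j: "Re (V z) \<ge> \<beta> + Re (of_real (c j) / u j z)" if "z \<in> A" "j \<in> J" for z j
  proof -
    have "Re (of_real (c j) / u j z) \<le> (\<Sum>j\<in>J. Re (of_real (c j) / u j z))"
      by (intro member_le_sum J that Req0)
    then show ?thesis by (simp add: V_def)
  qed
  have ReW: "Re (W z) > 0" if "z \<in> A" for z
    using ReV[OF that] \<beta> B by (simp add: W_def)
  have sA: "strip \<subseteq> A" using d by (auto simp: strip_def A_def)
  have u0: "u j z \<noteq> 0" if "z \<in> A" for j z
  proof
    assume "u j z = 0"
    with Reu[of j z] that show False by (simp add: A_def)
  qed
  have "V holomorphic_on A"
    unfolding V_def using u0 by (auto intro!: holomorphic_intros simp: u_def)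
  then have "W holomorphic_on A" unfolding W_def using B by (auto intro!: holomorphic_intros)
  moreover have "W z \<notin> \<real>\<^sub>\<le>\<^sub>0" if "z \<in> A" for z
    using ReW[OF that] by (auto simp: complex_nonpos_Reals_iff)
  ultimately have h1: "h holomorphic_on A" unfolding h_def by (intro holomorphic_intros)
  have W0: "W z \<noteq> 0" if "z \<in> A" for z using ReW[OF that] by auto
  have nh: "norm (h z) \<le> exp ((Re z)\<^sup>2 - (Im z)\<^sup>2 - \<theta>\<^sup>2 + 2 * \<bar>Im z\<bar> - (1 - Re z) * ln (norm (W z)))"
    if "z \<in> A" for z
  proof -
    \<comment> \<open>The positive real part of \<open>W\<close> confines its argument;
      \<open>2\<close> is a rounded \<open>pi / 2\<close>.\<close>
    have "\<bar>Im (Ln (W z))\<bar> < pi / 2" using Re_Ln_pos_lt[OF W0[OF that]] ReW[OF that] by simp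
    then have i: "\<bar>Im (Ln (W z))\<bar> \<le> 2" using pi_half_less_two by linarith
    have "- (Im z * Im (Ln (W z))) \<le> \<bar>Im z\<bar> * \<bar>Im (Ln (W z))\<bar>"
      by (metis abs_mult abs_ge_minus_self)
    also have "\<dots> \<le> \<bar>Im z\<bar> * 2" by (intro mult_left_mono i) auto
    finally have "- (Im z * Im (Ln (W z))) \<le> 2 * \<bar>Im z\<bar>" by simp
    moreover have "Re (z\<^sup>2 - (of_real \<theta>)\<^sup>2 - (1 - z) * Ln (W z))
       = (Re z)\<^sup>2 - (Im z)\<^sup>2 - \<theta>\<^sup>2 - (1 - Re z) * ln (norm (W z)) - Im z * Im (Ln (W z))"
      using W0[OF that] by (simp add: Re_power2 algebra_simps flip: of_real_power)
    ultimately show ?thesis unfolding h_def norm_exp_eq_Re by simp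
  qed
  \<comment> \<open>Gaussian decay against exponential growth: \<open>2 * \<bar>y\<bar>\<close>
    comes from the argument of \<open>W\<close>, and the third \<open>\<bar>y\<bar>\<close> from the
    weight \<open>exp \<bar>t\<bar>\<close> on the left line.\<close>
  have q1: "2 * \<bar>y\<bar> - y\<^sup>2 \<le> 1" for y :: real
    using zero_le_power2[of "\<bar>y\<bar> - 1"] by (simp add: power2_eq_square algebra_simps)
  have q2: "3 * \<bar>y\<bar> - y\<^sup>2 \<le> 3" for y :: real
    using zero_le_power2[of "2 * \<bar>y\<bar> - 3"] by (simp add: power2_eq_square algebra_simps)
  have "norm (h z) \<le> exp (2 + \<bar>ln (\<beta> / B)\<bar>)" if "z \<in> strip" for z
  proof -
    have z: "z \<in> A" "0 \<le> Re z" "Re z \<le> 1" using that sA by (auto simp: strip_def)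
    have "\<beta> / B \<le> norm (W z)"
      using ReV[OF z(1)] complex_Re_le_cmod[of "V z"] B
      by (simp add: W_def norm_divide divide_right_mono)
    then have "ln (\<beta> / B) \<le> ln (norm (W z))" using \<beta> B by (intro ln_mono) auto
    then have "- ln (norm (W z)) \<le> \<bar>ln (\<beta> / B)\<bar>" by linarith
    then have "(1 - Re z) * (- ln (norm (W z))) \<le> (1 - Re z) * \<bar>ln (\<beta> / B)\<bar>"
      using z by (intro mult_left_mono) auto
    also have "\<dots> \<le> 1 * \<bar>ln (\<beta> / B)\<bar>" using z by (intro mult_right_mono) auto
    finally have "- ((1 - Re z) * ln (norm (W z))) \<le> \<bar>ln (\<beta> / B)\<bar>" by simp
    moreover have "(Re z)\<^sup>2 \<le> 1" using z by (simp add: power_le_one)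
    ultimately have "(Re z)\<^sup>2 - (Im z)\<^sup>2 - \<theta>\<^sup>2 + 2 * \<bar>Im z\<bar> - (1 - Re z) * ln (norm (W z)) \<le> 2 + \<bar>ln (\<beta> / B)\<bar>"
      using q1[of "Im z"] zero_le_power2[of \<theta>] by linarith
    with nh[OF z(1)] show ?thesis by (meson exp_le_cancel_iff order_trans)
  qed
  note h2 = this
  have h3: "norm (h (Complex 0 t)) * a t \<le> 2 * exp 4 * B" for t
  proof -
    let ?z = "Complex 0 t"
    have z: "?z \<in> A" using d by (simp add: A_def)
    have V: "\<beta> \<le> Re (V ?z)" "Re (V ?z) \<le> norm (V ?z)" using ReV[OF z] complex_Re_le_cmod by auto
    have e1: "1 \<le> exp (1 + \<bar>t\<bar>)" by simp
    have at: "a t \<le> 2 * exp (1 + \<bar>t\<bar>) * norm (V ?z)"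
    proof (cases "a t \<le> \<beta>")
      case True
      then have "a t \<le> 1 * norm (V ?z)" using V by simp
      also have "\<dots> \<le> 2 * exp (1 + \<bar>t\<bar>) * norm (V ?z)" by (intro mult_right_mono) (use e1 in linarith, simp)
      finally show ?thesis .
    next
      case False
      with grid[of t] obtain j where j: "j \<in> J" "\<bar>t - of_int j * d\<bar> \<le> d" "a t \<le> a (of_int j * d) + \<beta>" by auto
      have "u j ?z = Complex d (t - of_int j * d)" by (simp add: u_def complex_eq_iff)
      then have "(norm (u j ?z))\<^sup>2 = d\<^sup>2 + (t - of_int j * d)\<^sup>2" by (simp add: cmod_power2)
      moreover have "(t - of_int j * d)\<^sup>2 \<le> d\<^sup>2" using j(2) d by (simp add: abs_le_square_iff[symmetric])
      ultimately have un: "(norm (u j ?z))\<^sup>2 \<le> 2 * d\<^sup>2" by simp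
      have "c j / (2 * d) = c j * d / (2 * d\<^sup>2)" using d by (simp add: power2_eq_square)
      also have "\<dots> \<le> c j * d / (norm (u j ?z))\<^sup>2"
        using un u0[OF z] c d by (intro divide_left_mono mult_pos_pos mult_nonneg_nonneg) auto
      also have "\<dots> = Re (of_real (c j) / u j ?z)" unfolding Req by simp
      finally have "\<beta> + c j / (2 * d) \<le> Re (V ?z)" using ReV_j[OF z j(1)] by linarith
      then have "exp (- \<bar>of_int j * d\<bar>) * a (of_int j * d) \<le> 2 * (Re (V ?z) - \<beta>)"
        using d by (simp add: c_def)
      moreover have "exp (- (1 + \<bar>t\<bar>)) * a (of_int j * d) \<le> exp (- \<bar>of_int j * d\<bar>) * a (of_int j * d)"
        using j(2) d by (intro mult_right_mono a) auto
      ultimately have "exp (- (1 + \<bar>t\<bar>)) * a (of_int j * d) \<le> 2 * (Re (V ?z) - \<beta>)" by (rule order_trans[rotated])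
      then have "exp (1 + \<bar>t\<bar>) * (exp (- (1 + \<bar>t\<bar>)) * a (of_int j * d)) \<le> exp (1 + \<bar>t\<bar>) * (2 * (Re (V ?z) - \<beta>))"
        by (intro mult_left_mono) auto
      moreover have "exp (1 + \<bar>t\<bar>) * (exp (- (1 + \<bar>t\<bar>)) * a (of_int j * d)) = a (of_int j * d)"
        by (simp only: mult.assoc[symmetric] exp_add[symmetric] add.right_inverse exp_zero mult_1)
      ultimately have "a t \<le> exp (1 + \<bar>t\<bar>) * (2 * (Re (V ?z) - \<beta>)) + \<beta>" using j(3) by linarith
      also have "\<dots> = 2 * exp (1 + \<bar>t\<bar>) * Re (V ?z) - (2 * exp (1 + \<bar>t\<bar>) - 1) * \<beta>" by (simp add: algebra_simps)
      also have "\<dots> \<le> 2 * exp (1 + \<bar>t\<bar>) * Re (V ?z)"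
      proof -
        have "0 \<le> (2 * exp (1 + \<bar>t\<bar>) - 1) * \<beta>"
          by (intro mult_nonneg_nonneg) (use \<beta> e1 in linarith)+
        then show ?thesis by linarith
      qed
      also have "\<dots> \<le> 2 * exp (1 + \<bar>t\<bar>) * norm (V ?z)" using V by (intro mult_left_mono) auto
      finally show ?thesis .
    qed
    have V0: "norm (V ?z) > 0" using V \<beta> by linarith
    have "norm (h ?z) \<le> exp (- t\<^sup>2 - \<theta>\<^sup>2 + 2 * \<bar>t\<bar> - ln (norm (W ?z)))" using nh[OF z] by simp
    also have "\<dots> \<le> exp (2 * \<bar>t\<bar> - t\<^sup>2 - ln (norm (W ?z)))" by simp
    also have "\<dots> = exp (2 * \<bar>t\<bar> - t\<^sup>2) * (B / norm (V ?z))"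
      using V0 B by (simp add: exp_diff W_def norm_divide)
    finally have "norm (h ?z) * a t \<le> exp (2 * \<bar>t\<bar> - t\<^sup>2) * (B / norm (V ?z)) * (2 * exp (1 + \<bar>t\<bar>) * norm (V ?z))"
      using B V0 by (intro mult_mono at a) auto
    also have "\<dots> = 2 * B * (exp (2 * \<bar>t\<bar> - t\<^sup>2) * exp (1 + \<bar>t\<bar>))" using V0 by simp
    also have "\<dots> = 2 * B * exp (1 + (3 * \<bar>t\<bar> - t\<^sup>2))"
      unfolding exp_add[symmetric] by (simp add: algebra_simps)
    also have "\<dots> \<le> 2 * B * exp 4" using q2[of t] B by (intro mult_left_mono) auto
    finally show ?thesis by (simp add: algebra_simps)
  qed
  have h4: "norm (h (Complex 1 t)) \<le> exp 2" for t
  proof -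
    have z: "Complex 1 t \<in> A" using d by (simp add: A_def)
    have "norm (h (Complex 1 t)) \<le> exp (1 - t\<^sup>2 - \<theta>\<^sup>2 + 2 * \<bar>t\<bar>)" using nh[OF z] by simp
    also have "\<dots> \<le> exp 2" using q1[of t] zero_le_power2[of \<theta>] by (simp only: exp_le_cancel_iff)
    finally show ?thesis .
  qed
  have h5: "norm (h (of_real \<theta>)) \<ge> ((1 + 4 / \<theta>) * \<beta> / B) powr (- (1 - \<theta>))"
  proof -
    let ?z = "of_real \<theta> :: complex"
    have z: "?z \<in> A" using d \<theta> by (simp add: A_def)
    \<comment> \<open>At \<open>\<theta>\<close> every denominator has real part
      \<open>\<theta> + d\<close>, hence modulus at least \<open>\<theta>\<close>. With the
      hypothesis on the weighted sum this is the origin of the factor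
      \<open>1 + 4 / \<theta>\<close>.\<close>
    have "norm (V ?z) \<le> \<beta> + (\<Sum>j\<in>J. norm (of_real (c j) / u j ?z))"
      unfolding V_def using \<beta> by (intro order_trans[OF norm_triangle_ineq] add_mono norm_sum) auto
    also have "(\<Sum>j\<in>J. norm (of_real (c j) / u j ?z)) \<le> (\<Sum>j\<in>J. c j / \<theta>)"
    proof (rule sum_mono)
      fix j
      have "\<theta> \<le> norm (u j ?z)" using complex_Re_le_cmod[of "u j ?z"] d by (simp add: Reu)
      then show "norm (of_real (c j) / u j ?z) \<le> c j / \<theta>"
        using c[of j] \<theta> by (auto simp: norm_divide intro!: divide_left_mono mult_pos_pos)
    qed
    also have "\<dots> \<le> 4 * \<beta> / \<theta>"
      unfolding sum_divide_distrib[symmetric] using sum \<theta> by (intro divide_right_mono) (auto simp: c_def)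
    finally have "norm (V ?z) \<le> (1 + 4 / \<theta>) * \<beta>" by (simp add: algebra_simps)
    then have W: "norm (W ?z) \<le> (1 + 4 / \<theta>) * \<beta> / B"
      using B by (simp add: W_def norm_divide divide_right_mono)
    have "((1 + 4 / \<theta>) * \<beta> / B) powr (- (1 - \<theta>)) \<le> norm (W ?z) powr (- (1 - \<theta>))"
      by (rule powr_mono2') (use W W0[OF z] \<theta> in auto)
    also have "\<dots> = exp (- (1 - \<theta>) * ln (norm (W ?z)))" using W0[OF z] by (simp add: powr_def)
    also have "\<dots> = norm (h ?z)"
      using W0[OF z] by (simp add: h_def norm_exp_eq_Re algebra_simps)
    finally show ?thesis .
  qed
  show ?thesis by (rule that[OF h1 sA h2 h3 h4 h5])
qed

section \<open>Tails and small blocks in the interpolation space\<close>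

context couple
begin

text \<open>A fixed representing function of \<open>y\<close>, multiplied by \<open>w N\<close>,
  represents the tail of \<open>y\<close>; its boundary values become small uniformly along both
  lines.\<close>

lemma interpolation_tail:
  assumes w: "\<And>N. contractive X0 (w N)" "\<And>N. contractive X1 (w N)"
    and l0: "\<And>x. x \<in> vecs X0 \<Longrightarrow> (\<lambda>N. nrm X0 (\<lambda>i. w N i * x i)) \<longlonglongrightarrow> 0"
    and l1: "\<And>x. x \<in> vecs X1 \<Longrightarrow> (\<lambda>N. nrm X1 (\<lambda>i. w N i * x i)) \<longlonglongrightarrow> 0"
    and y: "y \<in> vecs (complex_interpolation X0 X1 \<theta>)" and e: "e > 0"
  shows "\<forall>\<^sub>F N in sequentially. nrm (complex_interpolation X0 X1 \<theta>) (\<lambda>i. w N i * y i) \<le> e"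
proof -
  obtain f where f: "f \<in> calderon_fun X0 X1" and fy: "y = f (of_real \<theta>)"
    using y by (auto simp: complex_interpolation_def)
  have "\<forall>\<^sub>F N in sequentially. \<forall>t. nrm X0 (\<lambda>i. w N i * f (Complex 0 t) i) \<le> e"
    by (intro C0_into_uniform X0.seminormed_axioms calderon_funD[OF f] w l0 e)
  moreover have "\<forall>\<^sub>F N in sequentially. \<forall>t. nrm X1 (\<lambda>i. w N i * f (Complex 1 t) i) \<le> e"
    by (intro C0_into_uniform X1.seminormed_axioms calderon_funD[OF f] w l1 e)
  ultimately show ?thesis
  proof eventually_elim
    case (elim N)
    have "(\<lambda>z i. w N i * f z i) \<in> calderon_fun X0 X1"
      using calderon_mult[OF f w(1)[of N] w(2)[of N], of "\<lambda>z. 1" UNIV 1] by simp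
    from interpolation_nrm_le[OF this, of \<theta>] calderon_norm_le[of "\<lambda>z i. w N i * f z i" e] elim
    show ?case unfolding fy by force
  qed
qed

text \<open>At each point of the left line the \<open>n\<close> blocks have total size at most
  \<open>L * B\<close>, so their mean size is \<open>\<beta>\<close>. Averaging with the weight
  \<open>exp (- \<bar>t\<bar>)\<close> over a grid lets the pigeonhole principle pick one
  \<open>k\<close> for the whole line. The outer function for this block bounds both boundary values
  by a multiple of \<open>B\<close>, and dividing by its value at \<open>\<theta>\<close> gives the
  factor \<open>(L / n) powr (1 - \<theta>)\<close>, up to a constant.\<close>

lemma interpolation_lower_estimate:
  assumes f: "f \<in> calderon_fun X0 X1" "calderon_norm X0 X1 f \<le> B" and B: "B > 0"
    and \<theta>: "0 < \<theta>" "\<theta> < 1" and n: "n > 0" and L: "L > 0"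
    and w: "\<And>k. k < n \<Longrightarrow> contractive X0 (w k)" "\<And>k. k < n \<Longrightarrow> contractive X1 (w k)"
    and lower: "\<And>x. x \<in> vecs X0 \<Longrightarrow> (\<Sum>k<n. nrm X0 (\<lambda>i. w k i * x i)) \<le> L * nrm X0 x"
  shows "\<exists>k<n. nrm (complex_interpolation X0 X1 \<theta>) (\<lambda>i. w k i * f (of_real \<theta>) i)
    \<le> 2 * exp 4 * B * ((1 + 4 / \<theta>) * L / real n) powr (1 - \<theta>)"
proof -
  let ?f0 = "\<lambda>t. f (Complex 0 t)" and ?f1 = "\<lambda>t. f (Complex 1 t)"
  define \<beta> where "\<beta> = B * L / real n"
  have \<beta>: "\<beta> > 0" using B L n by (simp add: \<beta>_def)
  define a where "a k t = nrm X0 (\<lambda>i. w k i * ?f0 t i)" for k t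
  note f' = calderon_funD[OF f(1)]
  have w0: "(\<lambda>i. w k i * ?f0 t i) \<in> vecs X0" if "k < n" for k t
    using contractiveD(1)[OF w(1)[OF that] f'(7)] .
  have w1: "nrm X1 (\<lambda>i. w k i * ?f1 t i) \<le> B" "(\<lambda>i. w k i * ?f1 t i) \<in> vecs X1" if "k < n" for k t
    using contractiveD[OF w(2)[OF that] f'(8)] calderon_norm_ge(2)[OF f(1)] f(2) by (meson order_trans)+
  have a0: "a k t \<ge> 0" if "k < n" for k t unfolding a_def by (intro X0.nonneg w0 that)
  have C0: "C0_into X0 (\<lambda>t i. w k i * ?f0 t i)" if "k < n" for k
    using C0_into_mult[OF X0.seminormed_axioms f'(5) w(1)[OF that], of "\<lambda>_. 1" 1] by simp
  have ac: "continuous_on UNIV (a k)" if "k < n" for k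
    unfolding a_def using C0[OF that]
    by (intro continuous_into_nrm X0.seminormed_axioms w0 that) (auto simp: C0_into_def)
  have a\<beta>: "(\<Sum>k<n. a k t) \<le> L * B" for t
  proof -
    have "nrm X0 (?f0 t) \<le> B" using calderon_norm_ge(1)[OF f(1)] f(2) by (meson order_trans)
    then have "L * nrm X0 (?f0 t) \<le> L * B" using L by simp
    with lower[OF f'(7)[of t]] show ?thesis by (simp add: a_def)
  qed
  have "\<forall>\<^sub>F t in at_infinity. \<forall>k\<in>{..<n}. a k t < \<beta>"
    unfolding eventually_ball_finite_distrib[OF finite_lessThan]
  proof
    fix k assume "k \<in> {..<n}"
    then have "((\<lambda>t. a k t) \<longlongrightarrow> 0) at_infinity" using C0 by (auto simp: C0_into_def a_def)
    then show "\<forall>\<^sub>F t in at_infinity. a k t < \<beta>" using \<beta> by (rule order_tendstoD)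
  qed
  then obtain R where R: "\<And>t k. \<bar>t\<bar> \<ge> R \<Longrightarrow> k < n \<Longrightarrow> a k t < \<beta>"
    unfolding eventually_at_infinity by auto
  \<comment> \<open>The margin of length \<open>1\<close> makes room for the grid point below
    \<open>t\<close>, which may lie outside the interval from \<open>-R\<close> to
    \<open>R\<close>.\<close>
  have "\<exists>d>0. \<forall>t\<in>{-R-1..R+1}. \<forall>s\<in>{-R-1..R+1}. \<bar>t - s\<bar> < d \<longrightarrow> \<bar>a k t - a k s\<bar> < \<beta>" if "k < n" for k
  proof -
    have "uniformly_continuous_on {-R-1..R+1} (a k)"
      by (intro compact_uniformly_continuous continuous_on_subset[OF ac[OF that]]) auto
    then show ?thesis using \<beta> unfolding uniformly_continuous_on_def dist_real_def
      by (metis abs_minus_commute)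
  qed
  then obtain D where D: "\<And>k. k < n \<Longrightarrow> D k > 0" "\<And>k t s. k < n \<Longrightarrow> t \<in> {-R-1..R+1} \<Longrightarrow> s \<in> {-R-1..R+1} \<Longrightarrow>
    \<bar>t - s\<bar> < D k \<Longrightarrow> \<bar>a k t - a k s\<bar> < \<beta>" by metis
  \<comment> \<open>One mesh for all blocks; halving makes it strictly smaller than each modulus of
    continuity \<open>D k\<close>.\<close>
  define d where "d = Min (insert 1 (D ` {..<n})) / 2"
  have M0: "Min (insert 1 (D ` {..<n})) > 0" using D(1) by (subst Min_gr_iff) auto
  have "Min (insert 1 (D ` {..<n})) \<le> 1" by (intro Min_le) auto
  with M0 have d: "0 < d" "d \<le> 1" unfolding d_def by linarith+
  have dD: "d < D k" if "k < n" for k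
  proof -
    have "Min (insert 1 (D ` {..<n})) \<le> D k" using that by (intro Min_le) auto
    with M0 show ?thesis unfolding d_def by linarith
  qed
  define N where "N = nat \<lceil>(R + 1) / d\<rceil>"
  let ?J = "{- int N..int N}"
  have grid: "a k t \<le> \<beta> \<or> (\<exists>j\<in>?J. \<bar>t - of_int j * d\<bar> \<le> d \<and> a k t \<le> a k (of_int j * d) + \<beta>)" if "k < n" for k t
  proof (cases "\<bar>t\<bar> \<ge> R")
    case True
    with R[OF this that] show ?thesis by simp
  next
    case False
    define j where "j = \<lfloor>t / d\<rfloor>"
    have j: "of_int j * d \<le> t" "t < of_int j * d + d"
      using floor_divide_lower[OF d(1), of t] floor_divide_upper[OF d(1), of t]
      unfolding j_def by (simp_all add: algebra_simps)
    have tj: "\<bar>t - of_int j * d\<bar> \<le> d" using j by linarith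
    have jR: "\<bar>of_int j * d\<bar> \<le> R + 1" using tj False d by linarith
    then have "\<bar>of_int j\<bar> \<le> (R + 1) / d" using d by (simp add: abs_mult field_simps)
    then have "j \<in> ?J" unfolding N_def by (auto; linarith)
    moreover have "\<bar>a k t - a k (of_int j * d)\<bar> < \<beta>"
      by (rule D(2)[OF that]) (use False jR tj dD[OF that] in auto)
    ultimately show ?thesis using tj by (intro disjI2 bexI[of _ j]) auto
  qed
  let ?S = "\<lambda>k. \<Sum>j\<in>?J. d * exp (- \<bar>of_int j * d\<bar>) * a k (of_int j * d)"
  \<comment> \<open>Otherwise the \<open>n\<close> weighted sums would add up to more than
    \<open>4 * L * B\<close>, whereas \<open>a\<beta>\<close> and \<open>sum_exp_grid\<close> bound
    their total by this number.\<close>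
  have "\<exists>k<n. ?S k \<le> 4 * \<beta>"
  proof (rule ccontr)
    assume "\<not> ?thesis"
    then have "(\<Sum>k<n. 4 * \<beta>) < (\<Sum>k<n. ?S k)" using n by (intro sum_strict_mono) auto
    also have "\<dots> = (\<Sum>j\<in>?J. d * exp (- \<bar>of_int j * d\<bar>) * (\<Sum>k<n. a k (of_int j * d)))"
      by (subst sum.swap) (simp add: sum_distrib_left)
    also have "\<dots> \<le> (\<Sum>j\<in>?J. d * exp (- \<bar>of_int j * d\<bar>) * (L * B))"
      using d by (intro sum_mono mult_left_mono a\<beta>) auto
    also have "\<dots> \<le> 4 * (L * B)"
      unfolding sum_distrib_right[symmetric] using sum_exp_grid[OF d] L B by (intro mult_right_mono) auto
    finally show False using n by (simp add: \<beta>_def)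
  qed
  then obtain k where k: "k < n" "?S k \<le> 4 * \<beta>" by blast
  obtain h A H where h: "h holomorphic_on A" "strip \<subseteq> A" "\<And>z. z \<in> strip \<Longrightarrow> norm (h z) \<le> H"
    "\<And>t. norm (h (Complex 0 t)) * a k t \<le> 2 * exp 4 * B"
    "\<And>t. norm (h (Complex 1 t)) \<le> exp 2"
    "norm (h (of_real \<theta>)) \<ge> ((1 + 4 / \<theta>) * \<beta> / B) powr (- (1 - \<theta>))"
    by (rule outer_function[OF \<beta> d a0[OF k(1)] B \<theta> _ grid[OF k(1)] k(2)]) auto
  let ?g = "\<lambda>z i. h z * (w k i * f z i)" and ?Z = "complex_interpolation X0 X1 \<theta>"
  let ?c = "(1 + 4 / \<theta>) * \<beta> / B"
  have g: "?g \<in> calderon_fun X0 X1"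
    by (rule calderon_mult[OF f(1) w[OF k(1) ] h(1-3)]) (use k in auto)
  have z: "(\<lambda>i. w k i * f (of_real \<theta>) i) \<in> vecs ?Z"
    by (intro contractiveD contractive_interpolation w k interpolation_in f)
  have c: "?c > 0" using \<beta> B \<theta> by (auto intro!: divide_pos_pos mult_pos_pos add_pos_pos)
  have "norm (h (of_real \<theta>)) * nrm ?Z (\<lambda>i. w k i * f (of_real \<theta>) i) \<le> calderon_norm X0 X1 ?g"
    using interpolation_nrm_le[OF g, of \<theta>] Z.nrm_scale[OF z] by simp
  also have "\<dots> \<le> 2 * exp 4 * B"
  proof (rule calderon_norm_le)
    show "nrm X0 (?g (Complex 0 t)) \<le> 2 * exp 4 * B" for t
      using h(4)[of t] X0.nrm_scale[OF w0[OF k(1)]] by (simp add: a_def)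
    show "nrm X1 (?g (Complex 1 t)) \<le> 2 * exp 4 * B" for t
    proof -
      have "nrm X1 (?g (Complex 1 t)) \<le> exp 2 * B"
        unfolding X1.nrm_scale[OF w1(2)[OF k(1)]] using B
        by (intro mult_mono h w1 k X1.nonneg) auto
      also have "\<dots> \<le> 2 * exp 4 * B" using B exp_le_cancel_iff[of 2 "4::real"]
        by (intro mult_right_mono) (auto intro: order_trans[of _ "exp 4"])
      finally show ?thesis .
    qed
  qed
  finally have "?c powr (- (1 - \<theta>)) * nrm ?Z (\<lambda>i. w k i * f (of_real \<theta>) i) \<le> 2 * exp 4 * B"
    using mult_right_mono[OF h(6) Z.nonneg[OF z]] by linarith
  then have le: "?c powr (1 - \<theta>) * (?c powr (- (1 - \<theta>)) * nrm ?Z (\<lambda>i. w k i * f (of_real \<theta>) i))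
      \<le> ?c powr (1 - \<theta>) * (2 * exp 4 * B)"
    by (intro mult_left_mono) auto
  have "x powr a * x powr (- a) = 1" if "x > 0" for x a :: real
    using that by (simp add: powr_minus)
  note one = this[OF c]
  have "nrm ?Z (\<lambda>i. w k i * f (of_real \<theta>) i) \<le> 2 * exp 4 * B * ?c powr (1 - \<theta>)"
    using le unfolding mult.assoc[symmetric] one by (simp add: mult.commute)
  moreover have "?c = (1 + 4 / \<theta>) * L / real n" using B by (simp add: \<beta>_def)
  ultimately show ?thesis using k(1) by metis
qed

end

subsection \<open>Functionals on the sequence spaces\<close>

lemma norm_mult_powr_le:
  assumes "norm (g i :: complex) \<le> 1" "p > 0"
  shows "norm (g i * x i) powr p \<le> norm (x i) powr p"
proof -
  have "norm (g i * x i) \<le> 1 * norm (x i)"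
    unfolding norm_mult by (intro mult_right_mono assms) auto
  then show ?thesis using assms by (intro powr_mono2) auto
qed

lemma ell_nonneg: "0 \<le> nrm (ell p) x"
  by (simp add: ell_def)

lemma zero_in_ell: "(\<lambda>i. 0) \<in> vecs (ell p)"
  by (simp add: ell_def)

lemma ell_mult:
  assumes p: "p > 0" and g: "\<And>i. norm (g i) \<le> 1" and x: "x \<in> vecs (ell p)"
  shows "(\<lambda>i. g i * x i) \<in> vecs (ell p)" "nrm (ell p) (\<lambda>i. g i * x i) \<le> nrm (ell p) x"
proof -
  note mono = norm_mult_powr_le[of g, OF g p]
  have s: "summable (\<lambda>n. norm (x n) powr p)"
    using x by (simp add: ell_def)
  have s': "summable (\<lambda>i. norm (g i * x i) powr p)"
    by (rule summable_comparison_test[OF _ s]) (use mono in auto)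
  then show "(\<lambda>i. g i * x i) \<in> vecs (ell p)" by (simp add: ell_def)
  have "(\<Sum>i. norm (g i * x i) powr p) \<le> (\<Sum>i. norm (x i) powr p)"
    by (intro suminf_le s s' mono)
  then show "nrm (ell p) (\<lambda>i. g i * x i) \<le> nrm (ell p) x"
    using p suminf_nonneg[OF s'] by (auto simp: ell_def intro!: powr_mono2)
qed

lemma dual_ball_mult:
  assumes p: "p > 0" and g: "\<And>i. norm (g i) \<le> 1" and \<phi>: "\<phi> \<in> dual_ball (ell p)"
  shows "(\<lambda>x. \<phi> (\<lambda>i. g i * x i)) \<in> dual_ball (ell p)"
  unfolding dual_ball_def mem_Collect_eq
proof (intro conjI ballI allI)
  note d = dual_ball_D[OF \<phi>] and e = ell_mult[where g = g, OF p g]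
  fix x y c assume x: "x \<in> vecs (ell p)"
  show "\<phi> (\<lambda>i. g i * (c * x i)) = c * \<phi> (\<lambda>i. g i * x i)"
    using d(2)[OF e(1)[OF x], of c] by (simp add: mult.left_commute)
  show "norm (\<phi> (\<lambda>i. g i * x i)) \<le> nrm (ell p) x"
    using d(3)[OF e(1)[OF x]] e(2)[OF x] by linarith
  assume y: "y \<in> vecs (ell p)"
  show "\<phi> (\<lambda>i. g i * (x i + y i)) = \<phi> (\<lambda>i. g i * x i) + \<phi> (\<lambda>i. g i * y i)"
    using d(1)[OF e(1)[OF x] e(1)[OF y]] by (simp add: distrib_left)
qed

lemma dual_ball_scale:
  assumes c: "norm c \<le> 1" and \<phi>: "\<phi> \<in> dual_ball (ell p)"
  shows "(\<lambda>x. c * \<phi> x) \<in> dual_ball (ell p)"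
proof -
  have "norm (c * \<phi> x) \<le> nrm (ell p) x" if "x \<in> vecs (ell p)" for x
    using mult_mono[OF c dual_ball_D(3)[OF \<phi> that]] by (simp add: norm_mult)
  then show ?thesis
    using dual_ball_D(1,2)[OF \<phi>] by (auto simp: dual_ball_def distrib_left mult.left_commute)
qed

lemma dual_ball_zero:
  assumes "\<phi> \<in> dual_ball (ell p)"
  shows "\<phi> (\<lambda>i. 0) = 0"
  using dual_ball_D(2)[OF assms zero_in_ell, of 0] by simp

lemma unit_in_ell: "(\<lambda>i. of_bool (i = k)) \<in> vecs (ell p)"
proof -
  have "(\<lambda>i. if i < Suc k then of_bool (i = k) else 0) = (\<lambda>i. of_bool (i = k) :: complex)" by auto
  then show ?thesis using finite_support_in_ell[of "Suc k" "\<lambda>i. of_bool (i = k)" p] by simp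
qed

lemma ell_nrm_finite:
  assumes "finite F" "\<And>i. i \<notin> F \<Longrightarrow> x i = 0"
  shows "nrm (ell p) x = (\<Sum>i\<in>F. norm (x i) powr p) powr (1 / p)"
  using suminf_finite[OF assms(1), of "\<lambda>i. norm (x i) powr p"] assms(2) by (simp add: ell_def)

lemma dual_ball_unit:
  assumes "\<phi> \<in> dual_ball (ell p)"
  shows "norm (\<phi> (\<lambda>i. of_bool (i = k))) \<le> 1"
  using dual_ball_D(3)[OF assms unit_in_ell, of k] ell_nrm_finite[of "{k}" "\<lambda>i. of_bool (i = k)" p]
  by simp

lemma dual_ball_finite_sum:
  assumes \<phi>: "\<phi> \<in> dual_ball (ell p)" and "finite F"
  shows "(\<lambda>i. \<Sum>k\<in>F. c k * of_bool (i = k)) \<in> vecs (ell p) \<and>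
    \<phi> (\<lambda>i. \<Sum>k\<in>F. c k * of_bool (i = k)) = (\<Sum>k\<in>F. c k * \<phi> (\<lambda>i. of_bool (i = k)))"
  using assms(2)
proof (induction F rule: finite_induct)
  case empty
  then show ?case by (simp add: zero_in_ell dual_ball_zero[OF \<phi>])
next
  case (insert a F)
  have fin: "finite (insert a F)" using insert by simp
  have in_ell: "(\<lambda>i. \<Sum>k\<in>G. c k * of_bool (i = k)) \<in> vecs (ell p)" if "finite G" for G
  proof -
    have "summable (\<lambda>i. norm (\<Sum>k\<in>G. c k * of_bool (i = k)) powr p)"
      by (rule summable_finite[OF that]) (auto intro!: sum.neutral)
    then show ?thesis by (simp add: ell_def)
  qed
  have one: "(\<lambda>i. c a * of_bool (i = a)) \<in> vecs (ell p)" 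
    by (auto simp: ell_def intro!: summable_finite[of "{a}"])
  show ?case
    using dual_ball_D(1)[OF \<phi> one, of "\<lambda>i. \<Sum>k\<in>F. c k * of_bool (i = k)"] dual_ball_D(2)[OF \<phi> unit_in_ell, of "c a" a]
      insert in_ell[OF fin] by (simp del: sum_mult_of_bool_eq)
qed

lemma cnj_sgn_mult: "cnj (sgn z) * z = of_real (norm z)"
proof -
  have "cnj (sgn z) * z = (z * cnj z) / of_real (norm z)" by (simp add: sgn_eq)
  also have "\<dots> = of_real (norm z)"
    unfolding complex_norm_square[symmetric] by (simp add: power2_eq_square)
  finally show ?thesis .
qed

text \<open>Jensen's inequality for the convex function \<open>x powr r\<close> at the numbers
  \<open>b k powr (1 / r)\<close>. Zero terms are dropped first, so that it is applied to positive
  numbers only.\<close>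

lemma sum_powr_mean:
  assumes F: "finite F" and b: "\<And>k. k \<in> F \<Longrightarrow> 0 \<le> b k" and r: "1 \<le> r"
  shows "(\<Sum>k\<in>F. b k powr (1 / r)) \<le> real (card F) powr (1 - 1 / r) * (\<Sum>k\<in>F. b k) powr (1 / r)"
proof -
  define G where "G = {k\<in>F. b k > 0}"
  have G: "finite G" "G \<subseteq> F" using F by (auto simp: G_def)
  have 1: "(\<Sum>k\<in>F. b k powr (1 / r)) = (\<Sum>k\<in>G. b k powr (1 / r))"
    by (rule sum.mono_neutral_right) (use F b in \<open>force simp: G_def less_le\<close>)+
  have 2: "(\<Sum>k\<in>F. b k) = (\<Sum>k\<in>G. b k)"
    by (rule sum.mono_neutral_right) (use F b in \<open>force simp: G_def less_le\<close>)+
  show ?thesis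
  proof (cases "G = {}")
    case True
    then show ?thesis using 1 by simp
  next
    case False
    let ?n = "real (card G)" and ?S = "\<Sum>k\<in>G. b k powr (1 / r)"
    have n: "?n > 0" using False G by (simp add: card_gt_0_iff)
    have S: "?S > 0" using False G by (intro sum_pos) (auto simp: G_def)
    have "(\<Sum>k\<in>G. (1 / ?n) *\<^sub>R b k powr (1 / r)) powr r \<le> (\<Sum>k\<in>G. (1 / ?n) * (b k powr (1 / r)) powr r)"
      by (rule convex_on_sum[OF G(1) False powr_convex[OF r]]) (use n in \<open>auto simp: G_def\<close>)
    also have "\<dots> = (\<Sum>k\<in>G. b k) / ?n"
      using r by (simp add: powr_powr sum_divide_distrib G_def)
    also have "(\<Sum>k\<in>G. (1 / ?n) *\<^sub>R b k powr (1 / r)) = ?S / ?n" by (simp add: sum_divide_distrib)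
    finally have "((?S / ?n) powr r) powr (1 / r) \<le> ((\<Sum>k\<in>G. b k) / ?n) powr (1 / r)"
      using r by (intro powr_mono2) auto
    then have "?S / ?n \<le> (\<Sum>k\<in>G. b k) powr (1 / r) / ?n powr (1 / r)"
      using r n S by (simp add: powr_powr powr_divide sum_nonneg G_def)
    then have "?S \<le> ?n * ((\<Sum>k\<in>G. b k) powr (1 / r) / ?n powr (1 / r))"
      using n by (simp add: field_simps)
    also have "\<dots> = ?n powr (1 - 1 / r) * (\<Sum>k\<in>G. b k) powr (1 / r)"
      using n by (simp add: powr_diff)
    also have "\<dots> \<le> real (card F) powr (1 - 1 / r) * (\<Sum>k\<in>G. b k) powr (1 / r)"
      using r card_mono[OF F G(2)] by (intro mult_right_mono powr_mono2) auto
    finally show ?thesis using 1 2 by simp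
  qed
qed

text \<open>The \<open>p\<close>-th powers of the block norms add up to the \<open>p\<close>-th
  power of the norm of \<open>x\<close>; comparing the sum of \<open>n\<close> numbers with their
  \<open>p\<close>-norm costs \<open>n powr (1 - 1 / p)\<close>. This is the price of gluing
  functionals along blocks.\<close>

lemma ell_blocks:
  assumes p: "1 \<le> p" and n: "n > 0" and \<kappa>: "\<And>i. \<kappa> i < n" and x: "x \<in> vecs (ell p)"
  shows "(\<Sum>k<n. nrm (ell p) (\<lambda>i. of_bool (\<kappa> i = k) * x i)) \<le> real n powr (1 - 1 / p) * nrm (ell p) x"
proof -
  let ?b = "\<lambda>k. \<Sum>i. norm (of_bool (\<kappa> i = k) * x i) powr p"
  have s: "summable (\<lambda>i. norm (of_bool (\<kappa> i = k) * x i) powr p)" for k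
    using ell_mult(1)[of p "\<lambda>i. of_bool (\<kappa> i = k)" x] p x by (simp add: ell_def)
  have "(\<Sum>k<n. ?b k) = (\<Sum>i. \<Sum>k<n. norm (of_bool (\<kappa> i = k) * x i) powr p)"
    using s by (simp add: suminf_sum)
  also have "(\<lambda>i. \<Sum>k<n. norm (of_bool (\<kappa> i = k) * x i) powr p) = (\<lambda>i. norm (x i) powr p)"
  proof
    fix i
    have "(\<Sum>k<n. norm (of_bool (\<kappa> i = k) * x i) powr p) = (\<Sum>k<n. if k = \<kappa> i then norm (x i) powr p else 0)"
      by (intro sum.cong) auto
    then show "(\<Sum>k<n. norm (of_bool (\<kappa> i = k) * x i) powr p) = norm (x i) powr p"
      using \<kappa> by simp
  qed
  finally have "(\<Sum>k<n. ?b k) = (\<Sum>i. norm (x i) powr p)" .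
  moreover have "(\<Sum>k<n. ?b k powr (1 / p)) \<le> real (card {..<n}) powr (1 - 1 / p) * (\<Sum>k<n. ?b k) powr (1 / p)"
    by (intro sum_powr_mean p suminf_nonneg s) auto
  ultimately show ?thesis by (simp add: ell_def)
qed

text \<open>The values of \<open>\<phi>\<close> at the unit vectors form a sequence in the unit ball
  of the space with the conjugate exponent \<open>q\<close>, and its \<open>m\<close>-th powers are
  compared with its \<open>q\<close>-th powers. The exponent \<open>1 - m / q\<close> is the
  quantity \<open>s p\<close> that governs the whole proof.\<close>

lemma dual_ball_power_sum:
  assumes p: "1 < p" and \<phi>: "\<phi> \<in> dual_ball (ell p)" and F: "finite F" and m: "m > 0"
  shows "(\<Sum>k\<in>F. norm (\<phi> (\<lambda>i. of_bool (i = k))) ^ m) \<le> real (card F) powr max 0 (1 - real m * (1 - 1 / p))"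
proof -
  define b where "b k = \<phi> (\<lambda>i. of_bool (i = k))" for k
  define q where "q = p / (p - 1)"
  have q: "q > 1" "(q - 1) * p = q" "1 / q = 1 - 1 / p" using p by (auto simp: q_def field_simps)
  have b1: "norm (b k) \<le> 1" for k unfolding b_def by (rule dual_ball_unit[OF \<phi>])
  define S where "S = (\<Sum>k\<in>F. norm (b k) powr q)"
  have S1: "S \<le> 1"
  proof (rule ccontr)
    assume "\<not> S \<le> 1"
    \<comment> \<open>The extremal vector of Hoelder's inequality: \<open>\<phi>\<close> takes the
      value \<open>S\<close> on it and its norm is \<open>S powr (1 / p)\<close>, which is
      impossible for \<open>S > 1\<close>.\<close>
    define c where "c k = cnj (sgn (b k)) * of_real (norm (b k) powr (q - 1))" for k
    define x where "x i = (\<Sum>k\<in>F. c k * of_bool (i = k))" for i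
    have xF: "x i = (if i \<in> F then c i else 0)" for i
    proof -
      have "x i = (\<Sum>k\<in>F. if k = i then c k else 0)" unfolding x_def by (intro sum.cong) auto
      then show ?thesis using F by simp
    qed
    have cb: "c k * b k = of_real (norm (b k) powr q)" for k
    proof -
      have "c k * b k = of_real (norm (b k) * norm (b k) powr (q - 1))"
        using cnj_sgn_mult[of "b k"] by (simp add: c_def mult.commute mult.left_commute)
      also have "norm (b k) * norm (b k) powr (q - 1) = norm (b k) powr q"
        by (simp add: powr_mult_base)
      finally show ?thesis .
    qed
    have nc: "norm (c k) powr p = norm (b k) powr q" for k
      using q by (cases "b k = 0") (simp_all add: c_def norm_mult norm_sgn powr_powr)
    have "\<phi> x = of_real S" "x \<in> vecs (ell p)"
      using dual_ball_finite_sum[OF \<phi> F, of c] cb by (simp_all add: x_def S_def b_def flip: x_def)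
    moreover have "nrm (ell p) x = S powr (1 / p)"
      using ell_nrm_finite[OF F, of x p] xF nc by (simp add: S_def)
    ultimately have "S \<le> S powr (1 / p)"
      using dual_ball_D(3)[OF \<phi>, of x] \<open>\<not> S \<le> 1\<close> by simp
    moreover have "S powr (1 / p) < S powr 1" using \<open>\<not> S \<le> 1\<close> p by (intro powr_less_mono) auto
    ultimately show False using \<open>\<not> S \<le> 1\<close> by simp
  qed
  have S0: "S \<ge> 0" unfolding S_def by (intro sum_nonneg) auto
  have "(\<Sum>k\<in>F. norm (b k) ^ m) \<le> real (card F) powr max 0 (1 - real m * (1 - 1 / p))"
  proof (cases "F = {}")
    case True
    then show ?thesis by simp
  next
    case F0: False
    then have cF: "real (card F) > 0" using F by (simp add: card_gt_0_iff)
    have bm: "norm (b k) ^ m = (norm (b k) powr q) powr (real m / q)" for k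
      using q m by (cases "b k = 0") (auto simp: powr_powr powr_realpow)
    \<comment> \<open>For \<open>q \<le> m\<close> the \<open>m\<close>-th powers are at most the
      \<open>q\<close>-th powers, as all values are at most \<open>1\<close>. For
      \<open>q > m\<close> Jensen's inequality with exponent \<open>q / m\<close> costs a power of
      the number of terms.\<close>
    show ?thesis
    proof (cases "q \<le> real m")
      case True
      have "1 - real m * (1 / q) \<le> 0" using True q by (simp add: field_simps)
      then have e: "max 0 (1 - real m * (1 - 1 / p)) = 0" using q(3) by simp
      have "norm (b k) ^ m \<le> norm (b k) powr q" for k
      proof -
        have "norm (b k) powr real m \<le> norm (b k) powr q" by (rule powr_mono') (use b1 True in auto)
        then show ?thesis using m by (cases "b k = 0") (auto simp: powr_realpow zero_power)
      qed
      then have "(\<Sum>k\<in>F. norm (b k) ^ m) \<le> S" unfolding S_def by (intro sum_mono)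
      with S1 e cF show ?thesis by simp
    next
      case False
      define r where "r = q / real m"
      have r: "r \<ge> 1" "1 / r = real m / q" using False m by (auto simp: r_def field_simps)
      have "(\<Sum>k\<in>F. norm (b k) ^ m) \<le> real (card F) powr (1 - 1 / r) * S powr (1 / r)"
        unfolding S_def bm r(2)[symmetric] by (intro sum_powr_mean F r) auto
      also have "\<dots> \<le> real (card F) powr (1 - 1 / r) * 1 powr (1 / r)"
        using S0 S1 r(1) by (intro mult_left_mono powr_mono2) auto
      also have "1 - 1 / r = 1 - real m * (1 - 1 / p)" using r(2) q(3) by (metis times_divide_eq_right mult.right_neutral)
      also have "\<dots> \<le> max 0 (1 - real m * (1 - 1 / p))" by simp
      finally show ?thesis
        using cF by (smt (verit) F0 F card_gt_0_iff mult_cancel_left1 of_nat_less_0_iff of_nat_1 of_nat_le_iff One_nat_def Suc_leI powr_mono powr_one_eq_one)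
    qed
  qed
  then show ?thesis by (simp add: b_def)
qed

subsection \<open>Tensors as functions on tuples of functionals\<close>

lemma map_in_dual_tuples:
  "(\<And>j. j < m \<Longrightarrow> \<psi> j \<in> dual_ball X) \<Longrightarrow> map \<psi> [0..<m] \<in> dual_tuples m X"
  by (auto simp: dual_tuples_def)

lemma dual_tuples_nth:
  "\<phi>s \<in> dual_tuples m X \<Longrightarrow> j < m \<Longrightarrow> \<phi>s ! j \<in> dual_ball X"
  by (auto simp: dual_tuples_def)

lemma elem_tensor_map:
  "(\<And>j. j < m \<Longrightarrow> \<psi> j \<in> dual_ball X) \<Longrightarrow> elem_tensor m X xs (map \<psi> [0..<m]) = (\<Prod>k<m. \<psi> k (xs ! k))"
  using map_in_dual_tuples[of m \<psi> X] by (simp add: elem_tensor_def)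

lemma norm_elem_tensor_le:
  assumes "length xs = m" "set xs \<subseteq> vecs X"
  shows "norm (elem_tensor m X xs \<phi>s) \<le> \<bar>\<Prod>k<m. nrm X (xs ! k)\<bar>"
proof (cases "\<phi>s \<in> dual_tuples m X")
  case True
  have "norm (\<Prod>k<m. (\<phi>s ! k) (xs ! k)) \<le> (\<Prod>k<m. nrm X (xs ! k))"
    unfolding prod_norm[symmetric]
    by (intro prod_mono conjI dual_ball_D(3) dual_tuples_nth[OF True]) (use assms in auto)
  then show ?thesis using True by (simp add: elem_tensor_def)
qed (simp add: elem_tensor_def)

lemma elem_in_alg:
  assumes "length xs = m" "set xs \<subseteq> vecs X"
  shows "elem_tensor m X xs \<in> alg_tensor_power m X"
proof -
  have "elem_tensor m X xs = (\<lambda>\<phi>s. \<Sum>j<(1::nat). 1 * elem_tensor m X xs \<phi>s)" by simp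
  then show ?thesis unfolding alg_tensor_power_def mem_Collect_eq
    using assms by (intro exI[of _ 1] exI[of _ "\<lambda>_. 1"] exI[of _ "\<lambda>_. xs"]) auto
qed

lemma algE:
  assumes "v \<in> alg_tensor_power m X"
  obtains n c xs where "v = (\<lambda>\<phi>s. \<Sum>j<(n::nat). c j * elem_tensor m X (xs j) \<phi>s)"
    "\<And>j. j < n \<Longrightarrow> length (xs j) = m" "\<And>j. j < n \<Longrightarrow> set (xs j) \<subseteq> vecs X"
  using assms unfolding alg_tensor_power_def by blast

lemma sum_lessThan_append:
  fixes f :: "nat \<Rightarrow> 'a::comm_monoid_add"
  shows "(\<Sum>j<n + k. f j) = (\<Sum>j<n. f j) + (\<Sum>j<k. f (n + j))"
  by (induction k) (simp_all add: add.assoc)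

lemma alg_add:
  assumes "u \<in> alg_tensor_power m X" "v \<in> alg_tensor_power m X"
  shows "(\<lambda>\<phi>s. u \<phi>s + v \<phi>s) \<in> alg_tensor_power m X"
proof -
  obtain n c xs where u: "u = (\<lambda>\<phi>s. \<Sum>j<(n::nat). c j * elem_tensor m X (xs j) \<phi>s)"
    "\<And>j. j < n \<Longrightarrow> length (xs j) = m" "\<And>j. j < n \<Longrightarrow> set (xs j) \<subseteq> vecs X"
    using assms(1) by (rule algE) blast
  obtain k d ys where v: "v = (\<lambda>\<phi>s. \<Sum>j<(k::nat). d j * elem_tensor m X (ys j) \<phi>s)"
    "\<And>j. j < k \<Longrightarrow> length (ys j) = m" "\<And>j. j < k \<Longrightarrow> set (ys j) \<subseteq> vecs X"
    using assms(2) by (rule algE) blast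
  let ?c = "\<lambda>j. if j < n then c j else d (j - n)" and ?z = "\<lambda>j. if j < n then xs j else ys (j - n)"
  have "(\<lambda>\<phi>s. u \<phi>s + v \<phi>s) = (\<lambda>\<phi>s. \<Sum>j<n+k. ?c j * elem_tensor m X (?z j) \<phi>s)"
    unfolding sum_lessThan_append u v by simp
  moreover have "\<forall>j<n+k. length (?z j) = m \<and> set (?z j) \<subseteq> vecs X"
    using u(2,3) v(2,3) by (auto simp: not_less; force simp: le_less_linear less_diff_conv2)
  ultimately show ?thesis unfolding alg_tensor_power_def mem_Collect_eq
    by (intro exI[of _ "n + k"] exI[of _ ?c] exI[of _ ?z] conjI)
qed

lemma alg_scale:
  assumes "u \<in> alg_tensor_power m X"
  shows "(\<lambda>\<phi>s. a * u \<phi>s) \<in> alg_tensor_power m X"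
proof -
  obtain n c xs where u: "u = (\<lambda>\<phi>s. \<Sum>j<(n::nat). c j * elem_tensor m X (xs j) \<phi>s)"
    "\<And>j. j < n \<Longrightarrow> length (xs j) = m" "\<And>j. j < n \<Longrightarrow> set (xs j) \<subseteq> vecs X"
    using assms(1) by (rule algE) blast
  have "(\<lambda>\<phi>s. a * u \<phi>s) = (\<lambda>\<phi>s. \<Sum>j<n. (a * c j) * elem_tensor m X (xs j) \<phi>s)"
    unfolding u by (simp add: sum_distrib_left mult.assoc)
  with u(2,3) show ?thesis unfolding alg_tensor_power_def mem_Collect_eq
    by (intro exI[of _ n] exI[of _ "\<lambda>j. a * c j"] exI[of _ xs]) simp
qed

lemma tensor_approx:
  assumes "u \<in> vecs (inj_tensor_power m X)" "e > 0"
  obtains v where "v \<in> alg_tensor_power m X" "\<And>\<phi>s. \<phi>s \<in> dual_tuples m X \<Longrightarrow> norm (u \<phi>s - v \<phi>s) \<le> e"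
  using assms unfolding inj_tensor_power_def by auto

lemma alg_outside:
  "v \<in> alg_tensor_power m X \<Longrightarrow> \<phi>s \<notin> dual_tuples m X \<Longrightarrow> v \<phi>s = 0"
  by (auto simp: alg_tensor_power_def elem_tensor_def)

lemma tensorI:
  assumes "\<And>\<phi>s. \<phi>s \<notin> dual_tuples m X \<Longrightarrow> u \<phi>s = 0"
    "\<And>e. e > 0 \<Longrightarrow> \<exists>v\<in>alg_tensor_power m X. \<forall>\<phi>s\<in>dual_tuples m X. norm (u \<phi>s - v \<phi>s) \<le> e"
  shows "u \<in> vecs (inj_tensor_power m X)"
  using assms by (auto simp: inj_tensor_power_def)

lemma alg_in_tensor: "v \<in> alg_tensor_power m X \<Longrightarrow> v \<in> vecs (inj_tensor_power m X)"
  by (rule tensorI[OF alg_outside]) (auto intro!: bexI[of _ v])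

text \<open>The injective norm is a supremum over this set and would be unspecified if the set were
  empty.\<close>

lemma dual_tuples_nonempty: "dual_tuples m (ell p) \<noteq> {}"
proof -
  have "(\<lambda>x. 0) \<in> dual_ball (ell p)" by (auto simp: dual_ball_def ell_nonneg)
  then have "map (\<lambda>j x. 0) [0..<m] \<in> dual_tuples m (ell p)" by (intro map_in_dual_tuples)
  then show ?thesis by blast
qed

lemma tensor_bdd:
  assumes "u \<in> vecs (inj_tensor_power m X)"
  shows "bdd_above ((\<lambda>\<phi>s. norm (u \<phi>s)) ` dual_tuples m X)"
proof -
  obtain v where v: "v \<in> alg_tensor_power m X" "\<And>\<phi>s. \<phi>s \<in> dual_tuples m X \<Longrightarrow> norm (u \<phi>s - v \<phi>s) \<le> 1"
    using tensor_approx[OF assms, of 1] by auto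
  obtain n c xs where vv: "v = (\<lambda>\<phi>s. \<Sum>j<(n::nat). c j * elem_tensor m X (xs j) \<phi>s)"
    "\<And>j. j < n \<Longrightarrow> length (xs j) = m" "\<And>j. j < n \<Longrightarrow> set (xs j) \<subseteq> vecs X"
    using v(1) by (rule algE) blast
  let ?B = "\<Sum>j<n. norm (c j) * \<bar>\<Prod>k<m. nrm X (xs j ! k)\<bar>"
  have "norm (u \<phi>s) \<le> ?B + 1" if "\<phi>s \<in> dual_tuples m X" for \<phi>s
  proof -
    have "norm (v \<phi>s) \<le> (\<Sum>j<n. norm (c j * elem_tensor m X (xs j) \<phi>s))"
      unfolding vv by (rule norm_sum)
    also have "\<dots> \<le> ?B" unfolding norm_mult
      by (intro sum_mono mult_left_mono norm_elem_tensor_le) (use vv in auto)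
    finally have "norm (v \<phi>s) \<le> ?B" .
    then show ?thesis using v(2)[OF that] norm_triangle_sub[of "u \<phi>s" "v \<phi>s"] by linarith
  qed
  then show ?thesis by (auto intro!: bdd_aboveI[of _ "?B + 1"])
qed

lemma tensor_le:
  assumes "u \<in> vecs (inj_tensor_power m X)" "\<phi>s \<in> dual_tuples m X"
  shows "norm (u \<phi>s) \<le> nrm (inj_tensor_power m X) u"
  using cSUP_upper[OF assms(2) tensor_bdd[OF assms(1)]] by (simp add: inj_tensor_power_def)

lemma tensor_nrm_le:
  assumes "\<And>\<phi>s. \<phi>s \<in> dual_tuples m (ell p) \<Longrightarrow> norm (u \<phi>s) \<le> B"
  shows "nrm (inj_tensor_power m (ell p)) u \<le> B"
  using cSUP_least[OF dual_tuples_nonempty assms] by (simp add: inj_tensor_power_def)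

lemma tensor_nrm_less:
  assumes "u \<in> vecs (inj_tensor_power m (ell p))" "r < nrm (inj_tensor_power m (ell p)) u"
  obtains \<phi>s where "\<phi>s \<in> dual_tuples m (ell p)" "r < norm (u \<phi>s)"
  using less_cSUP_iff[OF dual_tuples_nonempty tensor_bdd[OF assms(1)], of r] assms(2)
  by (auto simp: inj_tensor_power_def)

lemma tensor_add:
  assumes u: "u \<in> vecs (inj_tensor_power m X)" and v: "v \<in> vecs (inj_tensor_power m X)"
  shows "(\<lambda>\<phi>s. u \<phi>s + v \<phi>s) \<in> vecs (inj_tensor_power m X)"
proof (rule tensorI)
  show "u \<phi>s + v \<phi>s = 0" if "\<phi>s \<notin> dual_tuples m X" for \<phi>s
    using u v that by (auto simp: inj_tensor_power_def)
  fix e :: real assume "e > 0"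
  then have e: "e / 2 > 0" by simp
  obtain u' where u': "u' \<in> alg_tensor_power m X" "\<And>\<phi>s. \<phi>s \<in> dual_tuples m X \<Longrightarrow> norm (u \<phi>s - u' \<phi>s) \<le> e / 2"
    by (rule tensor_approx[OF u e]) blast
  obtain v' where v': "v' \<in> alg_tensor_power m X" "\<And>\<phi>s. \<phi>s \<in> dual_tuples m X \<Longrightarrow> norm (v \<phi>s - v' \<phi>s) \<le> e / 2"
    by (rule tensor_approx[OF v e]) blast
  show "\<exists>w\<in>alg_tensor_power m X. \<forall>\<phi>s\<in>dual_tuples m X. norm (u \<phi>s + v \<phi>s - w \<phi>s) \<le> e"
  proof (intro bexI[OF _ alg_add[OF u'(1) v'(1)]] ballI)
    fix \<phi>s assume "\<phi>s \<in> dual_tuples m X"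
    from u'(2)[OF this] v'(2)[OF this] norm_triangle_ineq[of "u \<phi>s - u' \<phi>s" "v \<phi>s - v' \<phi>s"]
    show "norm (u \<phi>s + v \<phi>s - (u' \<phi>s + v' \<phi>s)) \<le> e" by (simp add: algebra_simps)
  qed
qed

lemma tensor_scale:
  assumes u: "u \<in> vecs (inj_tensor_power m X)"
  shows "(\<lambda>\<phi>s. a * u \<phi>s) \<in> vecs (inj_tensor_power m X)"
proof (rule tensorI)
  show "a * u \<phi>s = 0" if "\<phi>s \<notin> dual_tuples m X" for \<phi>s
    using u that by (auto simp: inj_tensor_power_def)
  fix e :: real assume e: "e > 0"
  then have "e / (norm a + 1) > 0" by (simp add: add_nonneg_pos)
  then obtain v where v: "v \<in> alg_tensor_power m X" "\<And>\<phi>s. \<phi>s \<in> dual_tuples m X \<Longrightarrow> norm (u \<phi>s - v \<phi>s) \<le> e / (norm a + 1)"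
    by (rule tensor_approx[OF u]) blast
  show "\<exists>w\<in>alg_tensor_power m X. \<forall>\<phi>s\<in>dual_tuples m X. norm (a * u \<phi>s - w \<phi>s) \<le> e"
  proof (intro bexI[OF _ alg_scale[OF v(1), of a]] ballI)
    fix \<phi>s assume "\<phi>s \<in> dual_tuples m X"
    from v(2)[OF this] have "(norm a + 1) * norm (u \<phi>s - v \<phi>s) \<le> e"
      by (simp add: pos_le_divide_eq add_nonneg_pos mult.commute)
    moreover have "norm (a * u \<phi>s - a * v \<phi>s) \<le> (norm a + 1) * norm (u \<phi>s - v \<phi>s)"
      unfolding right_diff_distrib[symmetric] norm_mult by (intro mult_right_mono) auto
    ultimately show "norm (a * u \<phi>s - a * v \<phi>s) \<le> e" by linarith
  qed
qed

text \<open>This is how the multilinearity of elementary tensors passes to the completion.\<close>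

lemma tensor_relation:
  assumes u: "u \<in> vecs (inj_tensor_power m X)" and I: "finite I" "\<And>i. i \<in> I \<Longrightarrow> \<phi> i \<in> dual_tuples m X"
    and rel: "\<And>xs. length xs = m \<Longrightarrow> set xs \<subseteq> vecs X \<Longrightarrow> (\<Sum>i\<in>I. \<alpha> i * elem_tensor m X xs (\<phi> i)) = 0"
  shows "(\<Sum>i\<in>I. \<alpha> i * u (\<phi> i)) = 0"
proof -
  have alg: "(\<Sum>i\<in>I. \<alpha> i * v (\<phi> i)) = 0" if v: "v \<in> alg_tensor_power m X" for v
  proof -
    obtain n c xs where vv: "v = (\<lambda>\<phi>s. \<Sum>j<(n::nat). c j * elem_tensor m X (xs j) \<phi>s)"
      "\<And>j. j < n \<Longrightarrow> length (xs j) = m" "\<And>j. j < n \<Longrightarrow> set (xs j) \<subseteq> vecs X"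
      using v by (rule algE) blast
    have "(\<Sum>i\<in>I. \<alpha> i * v (\<phi> i)) = (\<Sum>j<n. c j * (\<Sum>i\<in>I. \<alpha> i * elem_tensor m X (xs j) (\<phi> i)))"
      unfolding vv sum_distrib_left by (subst sum.swap) (simp add: mult.left_commute)
    also have "\<dots> = 0" using rel vv by simp
    finally show ?thesis .
  qed
  let ?A = "\<Sum>i\<in>I. norm (\<alpha> i)"
  have "norm (\<Sum>i\<in>I. \<alpha> i * u (\<phi> i)) \<le> 0 + e" if e: "e > 0" for e
  proof -
    have A: "?A + 1 > 0" by (intro add_nonneg_pos sum_nonneg) auto
    then have "e / (?A + 1) > 0" using e by simp
    then obtain v where v: "v \<in> alg_tensor_power m X" "\<And>\<phi>s. \<phi>s \<in> dual_tuples m X \<Longrightarrow> norm (u \<phi>s - v \<phi>s) \<le> e / (?A + 1)"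
      by (rule tensor_approx[OF u]) blast
    have "(\<Sum>i\<in>I. \<alpha> i * u (\<phi> i)) = (\<Sum>i\<in>I. \<alpha> i * (u (\<phi> i) - v (\<phi> i)))"
      using alg[OF v(1)] by (simp add: right_diff_distrib sum_subtractf)
    also have "norm \<dots> \<le> (\<Sum>i\<in>I. norm (\<alpha> i * (u (\<phi> i) - v (\<phi> i))))" by (rule norm_sum)
    also have "\<dots> \<le> (\<Sum>i\<in>I. norm (\<alpha> i) * (e / (?A + 1)))"
      unfolding norm_mult by (intro sum_mono mult_left_mono v I) auto
    also have "\<dots> = ?A * e / (?A + 1)" by (simp flip: sum_distrib_right sum_divide_distrib)
    also have "\<dots> \<le> e" using A e by (simp add: pos_divide_le_eq algebra_simps)
    finally show ?thesis by simp
  qed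
  then have "norm (\<Sum>i\<in>I. \<alpha> i * u (\<phi> i)) \<le> 0" by (rule field_le_epsilon)
  then show ?thesis by simp
qed

lemma tensor_slot_scale:
  assumes u: "u \<in> vecs (inj_tensor_power m (ell p))"
    and \<psi>: "\<And>j. j < m \<Longrightarrow> \<psi> j \<in> dual_ball (ell p)" and c: "\<And>j. j < m \<Longrightarrow> norm (c j) \<le> 1"
  shows "u (map (\<lambda>j x. c j * \<psi> j x) [0..<m]) = (\<Prod>j<m. c j) * u (map \<psi> [0..<m])"
proof -
  define \<phi> where "\<phi> i = (if i = (0::nat) then map (\<lambda>j x. c j * \<psi> j x) [0..<m] else map \<psi> [0..<m])" for i
  define \<alpha> where "\<alpha> i = (if i = (0::nat) then 1 else - (\<Prod>j<m. c j))" for i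
  have b: "(\<lambda>x. c j * \<psi> j x) \<in> dual_ball (ell p)" if "j < m" for j
    by (intro dual_ball_scale c \<psi> that)
  have "(\<Sum>i\<in>{0,1}. \<alpha> i * u (\<phi> i)) = 0"
  proof (rule tensor_relation[OF u])
    show "\<phi> i \<in> dual_tuples m (ell p)" for i
      unfolding \<phi>_def by (auto intro!: map_in_dual_tuples b \<psi>)
    show "(\<Sum>i\<in>{0,1}. \<alpha> i * elem_tensor m (ell p) xs (\<phi> i)) = 0" for xs
      using b \<psi> by (simp add: \<alpha>_def \<phi>_def elem_tensor_map prod.distrib)
  qed simp
  then show ?thesis by (simp add: \<alpha>_def \<phi>_def)
qed

text \<open>The splitting of the functional is asked for on \<open>vecs (ell p)\<close> only, since
  the values of functionals elsewhere are arbitrary; elementary tensors see no other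
  vectors.\<close>

lemma tensor_slot_add:
  fixes n :: nat
  assumes u: "u \<in> vecs (inj_tensor_power m (ell p))" and j0: "j0 < m"
    and \<psi>: "\<And>j. j < m \<Longrightarrow> \<psi> j \<in> dual_ball (ell p)"
    and \<eta>: "\<And>k. k < n \<Longrightarrow> \<eta> k \<in> dual_ball (ell p)"
    and sum: "\<And>x. x \<in> vecs (ell p) \<Longrightarrow> \<psi> j0 x = (\<Sum>k<n. \<eta> k x)"
  shows "u (map \<psi> [0..<m]) = (\<Sum>k<n. u (map (\<psi>(j0 := \<eta> k)) [0..<m]))"
proof -
  \<comment> \<open>The index \<open>n\<close> stands for the unsplit tuple, which enters the
    relation with coefficient \<open>-1\<close>.\<close>
  define \<phi> where "\<phi> i = (if i < n then map (\<psi>(j0 := \<eta> i)) [0..<m] else map \<psi> [0..<m])" for i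
  define \<alpha> where "\<alpha> i = (if i < n then 1 else - 1 :: complex)" for i
  have b: "(\<psi>(j0 := \<eta> k)) j \<in> dual_ball (ell p)" if "j < m" "k < n" for j k
    using \<psi> \<eta> that by auto
  have "(\<Sum>i<Suc n. \<alpha> i * u (\<phi> i)) = 0"
  proof (rule tensor_relation[OF u])
    show "\<phi> i \<in> dual_tuples m (ell p)" if "i \<in> {..<Suc n}" for i
      unfolding \<phi>_def using b \<psi> by (auto intro!: map_in_dual_tuples)
    fix xs assume xs: "length xs = m" "set xs \<subseteq> vecs (ell p)"
    have 1: "elem_tensor m (ell p) xs (map (\<psi>(j0 := \<eta> k)) [0..<m])
      = \<eta> k (xs ! j0) * (\<Prod>l\<in>{..<m} - {j0}. \<psi> l (xs ! l))" if "k < n" for k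
    proof -
      have "elem_tensor m (ell p) xs (map (\<psi>(j0 := \<eta> k)) [0..<m]) = (\<Prod>l<m. (\<psi>(j0 := \<eta> k)) l (xs ! l))"
        by (rule elem_tensor_map) (use b that in auto)
      then show ?thesis using j0 by (simp add: prod.remove[of "{..<m}" j0])
    qed
    have 2: "elem_tensor m (ell p) xs (map \<psi> [0..<m]) = \<psi> j0 (xs ! j0) * (\<Prod>l\<in>{..<m} - {j0}. \<psi> l (xs ! l))"
      using \<psi> j0 by (simp add: elem_tensor_map prod.remove[of "{..<m}" j0])
    have "xs ! j0 \<in> vecs (ell p)" using xs j0 by auto
    from sum[OF this] 1 2 show "(\<Sum>i<Suc n. \<alpha> i * elem_tensor m (ell p) xs (\<phi> i)) = 0"
      by (simp add: \<alpha>_def \<phi>_def sum_distrib_right)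
  qed simp
  then show ?thesis by (simp add: \<alpha>_def \<phi>_def)
qed

text \<open>The multiplier acts through its adjoint on the functionals, a formula that makes sense
  on the completion at once and cannot increase a supremum over the dual balls. On elementary
  tensors it multiplies the vectors, so it maps approximants to approximants.\<close>

lemma tensor_mult:
  assumes p: "p > 0" and u: "u \<in> vecs (inj_tensor_power m (ell p))" and g: "\<And>j i. norm (g j i) \<le> 1"
  defines "v \<equiv> (\<lambda>\<phi>s. if \<phi>s \<in> dual_tuples m (ell p)
      then u (map (\<lambda>j x. (\<phi>s ! j) (\<lambda>i. g j i * x i)) [0..<m]) else 0)"
  shows "v \<in> vecs (inj_tensor_power m (ell p))"
    "nrm (inj_tensor_power m (ell p)) v \<le> nrm (inj_tensor_power m (ell p)) u"
    "length is = m \<Longrightarrow> coeffs v is = (\<Prod>j<m. g j (is ! j)) * coeffs u is"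
    "length is \<noteq> m \<Longrightarrow> coeffs v is = 0"
proof -
  have b: "(\<lambda>x. (\<phi>s ! j) (\<lambda>i. g j i * x i)) \<in> dual_ball (ell p)" if "\<phi>s \<in> dual_tuples m (ell p)" "j < m" for \<phi>s j
    by (intro dual_ball_mult p g dual_tuples_nth[OF that])
  then have t: "map (\<lambda>j x. (\<phi>s ! j) (\<lambda>i. g j i * x i)) [0..<m] \<in> dual_tuples m (ell p)"
    if "\<phi>s \<in> dual_tuples m (ell p)" for \<phi>s
    using that by (intro map_in_dual_tuples)
  show "v \<in> vecs (inj_tensor_power m (ell p))"
  proof (rule tensorI)
    show "v \<phi>s = 0" if "\<phi>s \<notin> dual_tuples m (ell p)" for \<phi>s using that by (simp add: v_def)
    fix e :: real assume e: "e > 0"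
    obtain w where w: "w \<in> alg_tensor_power m (ell p)"
      "\<And>\<phi>s. \<phi>s \<in> dual_tuples m (ell p) \<Longrightarrow> norm (u \<phi>s - w \<phi>s) \<le> e"
      by (rule tensor_approx[OF u e]) blast
    obtain n c xs where ww: "w = (\<lambda>\<phi>s. \<Sum>j<(n::nat). c j * elem_tensor m (ell p) (xs j) \<phi>s)"
      "\<And>j. j < n \<Longrightarrow> length (xs j) = m" "\<And>j. j < n \<Longrightarrow> set (xs j) \<subseteq> vecs (ell p)"
      using w(1) by (rule algE) blast
    define ys where "ys j = map (\<lambda>l i. g l i * (xs j ! l) i) [0..<m]" for j
    let ?w = "\<lambda>\<phi>s. \<Sum>j<n. c j * elem_tensor m (ell p) (ys j) \<phi>s"
    have "\<forall>j<n. length (ys j) = m \<and> set (ys j) \<subseteq> vecs (ell p)"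
    proof (intro allI impI conjI subsetI)
      fix j y assume j: "j < n" and "y \<in> set (ys j)"
      then obtain l where l: "l < m" "y = (\<lambda>i. g l i * (xs j ! l) i)" by (auto simp: ys_def)
      then have "xs j ! l \<in> vecs (ell p)" using ww(2,3)[OF j] by auto
      with l show "y \<in> vecs (ell p)" using ell_mult(1)[where g = "g l", OF p g] by simp
    qed (simp add: ys_def)
    then have "?w \<in> alg_tensor_power m (ell p)"
      unfolding alg_tensor_power_def mem_Collect_eq by blast
    moreover have "norm (v \<phi>s - ?w \<phi>s) \<le> e" if \<phi>s: "\<phi>s \<in> dual_tuples m (ell p)" for \<phi>s
    proof -
      have "elem_tensor m (ell p) (ys j) \<phi>s = elem_tensor m (ell p) (xs j) (map (\<lambda>j x. (\<phi>s ! j) (\<lambda>i. g j i * x i)) [0..<m])" for j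
        using b[OF \<phi>s] \<phi>s by (simp add: elem_tensor_map) (simp add: elem_tensor_def ys_def)
      then have "?w \<phi>s = w (map (\<lambda>j x. (\<phi>s ! j) (\<lambda>i. g j i * x i)) [0..<m])" by (simp add: ww)
      with w(2)[OF t[OF \<phi>s]] \<phi>s show ?thesis by (simp add: v_def)
    qed
    ultimately show "\<exists>w\<in>alg_tensor_power m (ell p). \<forall>\<phi>s\<in>dual_tuples m (ell p). norm (v \<phi>s - w \<phi>s) \<le> e"
      by (intro bexI[of _ ?w] ballI)
  qed
  show "nrm (inj_tensor_power m (ell p)) v \<le> nrm (inj_tensor_power m (ell p)) u"
    by (rule tensor_nrm_le) (simp add: v_def tensor_le[OF u t])
  show "coeffs v is = 0" if "length is \<noteq> m"
    using that by (simp add: coeffs_def v_def dual_tuples_def)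
  assume l: "length is = m"
  let ?\<psi> = "\<lambda>j x. x (is ! j)"
  have e: "map (\<lambda>i x. x i) is = map ?\<psi> [0..<m]" using l by (intro nth_equalityI) auto
  have b: "?\<psi> j \<in> dual_ball (ell p)" for j by (rule coord_in_dual_ball[OF p])
  have "coeffs v is = u (map (\<lambda>j x. (map ?\<psi> [0..<m] ! j) (\<lambda>i. g j i * x i)) [0..<m])"
    using map_in_dual_tuples[of m ?\<psi>, OF b] by (simp add: coeffs_def v_def e)
  also have "map (\<lambda>j x. (map ?\<psi> [0..<m] ! j) (\<lambda>i. g j i * x i)) [0..<m] = map (\<lambda>j x. g j (is ! j) * ?\<psi> j x) [0..<m]"
    by simp
  also have "u \<dots> = (\<Prod>j<m. g j (is ! j)) * u (map ?\<psi> [0..<m])"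
    by (rule tensor_slot_scale[OF u b g])
  also have "u (map ?\<psi> [0..<m]) = coeffs u is" by (simp add: coeffs_def e)
  finally show "coeffs v is = (\<Prod>j<m. g j (is ! j)) * coeffs u is" .
qed

subsection \<open>The array model\<close>

lemma coeffs_in: "u \<in> vecs (inj_tensor_power m (ell p)) \<Longrightarrow> coeffs u \<in> vecs (ell_inj_tensor m p)"
  by (simp add: ell_inj_tensor_def)

lemma nrm_coeffs:
  assumes "p > 0" "u \<in> vecs (inj_tensor_power m (ell p))"
  shows "nrm (ell_inj_tensor m p) (coeffs u) = nrm (inj_tensor_power m (ell p)) u"
  using inv_into_f_f[OF inj_on_coeffs[OF assms(1)] assms(2)] by (simp add: ell_inj_tensor_def)

lemma ell_inj_tensorE:
  assumes "p > 0" "a \<in> vecs (ell_inj_tensor m p)"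
  obtains u where "u \<in> vecs (inj_tensor_power m (ell p))" "a = coeffs u"
    "nrm (ell_inj_tensor m p) a = nrm (inj_tensor_power m (ell p)) u"
proof -
  obtain u where "u \<in> vecs (inj_tensor_power m (ell p))" "a = coeffs u"
    using assms(2) by (auto simp: ell_inj_tensor_def)
  with nrm_coeffs[OF assms(1)] that show ?thesis by metis
qed

text \<open>A list of the wrong length gives a tuple outside \<open>dual_tuples\<close>, where
  tensors vanish by convention. Identities between arrays thus need checking only where
  \<open>is ! j\<close> is a genuine entry for all \<open>j < m\<close>.\<close>

lemma ell_inj_tensor_length:
  assumes "a \<in> vecs (ell_inj_tensor m p)" "length is \<noteq> m"
  shows "a is = 0"
proof -
  obtain u where u: "u \<in> vecs (inj_tensor_power m (ell p))" "a = coeffs u"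
    using assms(1) by (auto simp: ell_inj_tensor_def)
  have "map (\<lambda>i x. x i) is \<notin> dual_tuples m (ell p)" using assms(2) by (simp add: dual_tuples_def)
  with u show ?thesis by (simp add: coeffs_def inj_tensor_power_def)
qed

lemma seminormed_tensor:
  assumes p: "p > 0"
  shows "seminormed (ell_inj_tensor m p)"
proof
  let ?Y = "ell_inj_tensor m p" and ?U = "inj_tensor_power m (ell p)"
  show nn: "0 \<le> nrm ?Y x" if x: "x \<in> vecs ?Y" for x
  proof -
    obtain u where u: "u \<in> vecs ?U" "x = coeffs u" "nrm ?Y x = nrm ?U u" by (rule ell_inj_tensorE[OF p x])
    obtain \<phi>s where "\<phi>s \<in> dual_tuples m (ell p)" using dual_tuples_nonempty by blast
    from order_trans[OF norm_ge_zero tensor_le[OF u(1) this]] u show ?thesis by simp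
  qed
  have s: "(\<lambda>i. c * x i) \<in> vecs ?Y \<and> nrm ?Y (\<lambda>i. c * x i) \<le> norm c * nrm ?Y x" if x: "x \<in> vecs ?Y" for c x
  proof -
    obtain u where u: "u \<in> vecs ?U" "x = coeffs u" "nrm ?Y x = nrm ?U u" by (rule ell_inj_tensorE[OF p x])
    have eq: "(\<lambda>i. c * x i) = coeffs (\<lambda>\<phi>s. c * u \<phi>s)" by (simp add: coeffs_def u)
    have t: "(\<lambda>\<phi>s. c * u \<phi>s) \<in> vecs ?U" by (rule tensor_scale[OF u(1)])
    have "nrm ?U (\<lambda>\<phi>s. c * u \<phi>s) \<le> norm c * nrm ?U u"
      by (rule tensor_nrm_le) (simp add: norm_mult mult_left_mono tensor_le[OF u(1)])
    then show ?thesis unfolding eq nrm_coeffs[OF p t] u(3) using coeffs_in[OF t] by blast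
  qed
  then show "(\<lambda>i. c * x i) \<in> vecs ?Y" "nrm ?Y (\<lambda>i. c * x i) \<le> norm c * nrm ?Y x" if "x \<in> vecs ?Y" for c x
    using that by blast+
  have "(\<lambda>\<phi>s. 0) \<in> vecs ?U"
    by (rule tensorI) (auto intro!: bexI[of _ "\<lambda>\<phi>s. 0"] exI[of _ 0] simp: alg_tensor_power_def)
  from coeffs_in[OF this] show "(\<lambda>i. 0) \<in> vecs ?Y" by (simp add: coeffs_def)
  fix x y assume x: "x \<in> vecs ?Y" and y: "y \<in> vecs ?Y"
  obtain u where u: "u \<in> vecs ?U" "x = coeffs u" "nrm ?Y x = nrm ?U u" by (rule ell_inj_tensorE[OF p x])
  obtain v where v: "v \<in> vecs ?U" "y = coeffs v" "nrm ?Y y = nrm ?U v" by (rule ell_inj_tensorE[OF p y])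
  have eq: "(\<lambda>i. x i + y i) = coeffs (\<lambda>\<phi>s. u \<phi>s + v \<phi>s)" by (simp add: coeffs_def u v)
  have t: "(\<lambda>\<phi>s. u \<phi>s + v \<phi>s) \<in> vecs ?U" by (rule tensor_add[OF u(1) v(1)])
  have "nrm ?U (\<lambda>\<phi>s. u \<phi>s + v \<phi>s) \<le> nrm ?U u + nrm ?U v"
    by (rule tensor_nrm_le) (intro order_trans[OF norm_triangle_ineq] add_mono tensor_le u v)
  then show "(\<lambda>i. x i + y i) \<in> vecs ?Y" "nrm ?Y (\<lambda>i. x i + y i) \<le> nrm ?Y x + nrm ?Y y"
    unfolding eq nrm_coeffs[OF p t] u(3) v(3) using coeffs_in[OF t] by blast+
qed

lemma tensor_mult_array:
  assumes p: "p > 0" and u: "u \<in> vecs (inj_tensor_power m (ell p))" and g: "\<And>j i. norm (g j i) \<le> 1"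
  shows "coeffs (\<lambda>\<phi>s. if \<phi>s \<in> dual_tuples m (ell p)
      then u (map (\<lambda>j x. (\<phi>s ! j) (\<lambda>i. g j i * x i)) [0..<m]) else 0)
    = (\<lambda>is. (\<Prod>j<m. g j (is ! j)) * coeffs u is)"
  using tensor_mult(3,4)[where g = g, OF p u g] ell_inj_tensor_length[OF coeffs_in[OF u]]
  by (metis (no_types, lifting) mult_zero_right)

lemma contractive_tensor:
  assumes p: "p > 0" and g: "\<And>j i. norm (g j i) \<le> 1"
  shows "contractive (ell_inj_tensor m p) (\<lambda>is. \<Prod>j<m. g j (is ! j))"
  unfolding contractive_def
proof
  fix x assume "x \<in> vecs (ell_inj_tensor m p)"
  then obtain u where u: "u \<in> vecs (inj_tensor_power m (ell p))" "x = coeffs u"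
    "nrm (ell_inj_tensor m p) x = nrm (inj_tensor_power m (ell p)) u" by (rule ell_inj_tensorE[OF p])
  note t = tensor_mult(1,2)[where g = g, OF p u(1) g]
  show "(\<lambda>i. (\<Prod>j<m. g j (i ! j)) * x i) \<in> vecs (ell_inj_tensor m p) \<and>
        nrm (ell_inj_tensor m p) (\<lambda>i. (\<Prod>j<m. g j (i ! j)) * x i) \<le> nrm (ell_inj_tensor m p) x"
    unfolding u(2) tensor_mult_array[where g = g, OF p u(1) g, symmetric] nrm_coeffs[OF p t(1)] nrm_coeffs[OF p u(1)]
    using t(2) coeffs_in[OF t(1)] by blast
qed

lemma prod_of_bool: "finite I \<Longrightarrow> (\<Prod>j\<in>I. of_bool (P j)) = (of_bool (\<forall>j\<in>I. P j) :: 'a::comm_semiring_1)"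
  by (induction I rule: finite_induct) auto

lemma contractive_tensor_bool:
  assumes p: "p > 0"
  shows "contractive (ell_inj_tensor m p) (\<lambda>is. of_bool (\<forall>j<m. P j (is ! j)))"
  using contractive_tensor[OF p, where g = "\<lambda>j i. of_bool (P j i)" and m = m]
  by (simp add: prod_of_bool Ball_def)

subsection \<open>Diagonal blocks\<close>

text \<open>Orthogonality of the characters of a cyclic group: for \<open>a \<noteq> b\<close> the
  quotient of the two roots is an \<open>n\<close>-th root of unity different from \<open>1\<close>,
  and its geometric sum vanishes.\<close>

lemma root_of_unity_average:
  fixes a b n :: nat
  assumes "a < n" "b < n"
  defines "e \<equiv> \<lambda>j. exp (2 * of_real pi * \<i> * of_nat j / of_nat n)"
  shows "(\<Sum>t<n. e a ^ t * inverse (e b) ^ t) / of_nat n = of_bool (a = b)"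
proof -
  have n: "n > 0" using assms by simp
  have e0: "e j \<noteq> 0" for j by (simp add: e_def)
  have en: "e j ^ n = 1" for j unfolding e_def using complex_root_unity[of n j] n by simp
  define z where "z = e a * inverse (e b)"
  have s: "(\<Sum>t<n. e a ^ t * inverse (e b) ^ t) = (\<Sum>t<n. z ^ t)"
    by (simp add: z_def power_mult_distrib)
  show ?thesis
  proof (cases "a = b")
    case True
    then have "z = 1" using e0 by (simp add: z_def)
    then show ?thesis using s True n by simp
  next
    case False
    then have "e a \<noteq> e b"
      using complex_root_unity_eq[of n a b] n assms(1,2) unfolding e_def by (simp add: cong_def)
    then have "z \<noteq> 1" using e0 by (auto simp: z_def field_simps)
    moreover have "z ^ n = 1" using en by (simp add: z_def power_mult_distrib power_inverse)
    ultimately have "(\<Sum>t<n. z ^ t) = 0" by (simp add: geometric_sum)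
    then show ?thesis using s False by simp
  qed
qed

text \<open>The projection onto the block diagonal is an average, over the \<open>n\<close>-th roots of unity, of
  multipliers that multiply block \<open>k\<close> in one slot by a root and in another slot by its inverse.\<close>

lemma contractive_block_diagonal:
  fixes \<kappa> :: "nat \<Rightarrow> nat"
  assumes p: "p > 0" and n: "n > 0" and \<kappa>: "\<And>i. \<kappa> i < n" and j0: "j0 < m" and A: "finite A" "A \<subseteq> {..<m}"
  shows "contractive (ell_inj_tensor m p) (\<lambda>is. of_bool (\<forall>j\<in>A. \<kappa> (is ! j) = \<kappa> (is ! j0)))"
  using A
proof (induction A rule: finite_induct)
  case empty
  then show ?case by (simp add: contractive_one)
next
  case (insert l A)
  interpret seminormed "ell_inj_tensor m p" by (rule seminormed_tensor[OF p])
  have l: "l < m" using insert by simp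
  define e where "e j = exp (2 * of_real pi * \<i> * of_nat j / of_nat n)" for j :: nat
  have ne: "norm (e j) = 1" for j by (simp add: e_def norm_exp_eq_Re)
  \<comment> \<open>Two separate factors instead of nested cases, so that for \<open>l = j0\<close>
    the root and its inverse cancel.\<close>
  define g where "g t j i = (if j = l then e (\<kappa> i) ^ t else 1) * (if j = j0 then inverse (e (\<kappa> i)) ^ t else 1)"
    for t j i
  have ng: "norm (g t j i) \<le> 1" for t j i
    by (simp add: g_def norm_mult norm_power norm_inverse ne)
  have "contractive (ell_inj_tensor m p) (\<lambda>is. \<Prod>j<m. g t j (is ! j))" for t
    by (rule contractive_tensor[OF p ng])
  moreover have "(\<Prod>j<m. g t j (is ! j)) = e (\<kappa> (is ! l)) ^ t * inverse (e (\<kappa> (is ! j0))) ^ t" for t "is"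
    using l j0 by (simp add: g_def prod.distrib)
  ultimately have "contractive (ell_inj_tensor m p)
      (\<lambda>is. (\<Sum>t<n. e (\<kappa> (is ! l)) ^ t * inverse (e (\<kappa> (is ! j0))) ^ t) / of_nat n)"
    using n by (intro contractive_average) auto
  also have "(\<lambda>is. (\<Sum>t<n. e (\<kappa> (is ! l)) ^ t * inverse (e (\<kappa> (is ! j0))) ^ t) / of_nat n)
      = (\<lambda>is. of_bool (\<kappa> (is ! l) = \<kappa> (is ! j0)))"
    unfolding e_def by (intro ext root_of_unity_average \<kappa>)
  finally have "contractive (ell_inj_tensor m p) (\<lambda>is. of_bool (\<kappa> (is ! l) = \<kappa> (is ! j0)) *
      of_bool (\<forall>j\<in>A. \<kappa> (is ! j) = \<kappa> (is ! j0)))"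
    using insert by (intro contractive_mult) auto
  then show ?case by (simp flip: of_bool_conj)
qed

text \<open>Norming functionals for the single blocks are glued, in each slot of \<open>A\<close>, to one functional of
  norm at most \<open>n powr (1 - 1 / p)\<close>; passing first to the block diagonal removes the mixed terms.\<close>

lemma block_lower_estimate:
  fixes \<kappa> :: "nat \<Rightarrow> nat"
  assumes p: "1 \<le> p" and n: "n > 0" and \<kappa>: "\<And>i. \<kappa> i < n" and j0: "j0 \<in> A" and A: "A \<subseteq> {..<m}"
    and x: "x \<in> vecs (ell_inj_tensor m p)"
  shows "(\<Sum>k<n. nrm (ell_inj_tensor m p)
      (\<lambda>is. of_bool (\<forall>j<m. if j \<in> A then \<kappa> (is ! j) = k else is ! j = c j) * x is))
    \<le> real n powr (real m * (1 - 1 / p)) * nrm (ell_inj_tensor m p) x"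
proof -
  let ?Y = "ell_inj_tensor m p" and ?U = "inj_tensor_power m (ell p)" and ?D = "dual_tuples m (ell p)"
  have p0: "p > 0" using p by simp
  interpret seminormed ?Y by (rule seminormed_tensor[OF p0])
  have fA: "finite A" and j0m: "j0 < m" using A j0 finite_subset by auto
  define g where "g k j i = (of_bool (if j \<in> A then \<kappa> i = k else i = c j) :: complex)" for k j i
  \<comment> \<open>On the block diagonal, cutting in slot \<open>j0\<close> alone has the same
    effect as cutting in all slots of \<open>A\<close>. Hence splitting only the functional in slot
    \<open>j0\<close> already separates the blocks.\<close>
  define g0 where "g0 k j i = (of_bool (j = j0 \<longrightarrow> \<kappa> i = k) :: complex)" for k j i
  have ng: "norm (g k j i) \<le> 1" "norm (g0 k j i) \<le> 1" for k j i by (simp_all add: g_def g0_def)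
  define x' where "x' = (\<lambda>is. of_bool (\<forall>j\<in>A. \<kappa> (is ! j) = \<kappa> (is ! j0)) *
      (of_bool (\<forall>j<m. j \<notin> A \<longrightarrow> is ! j = c j) * x is))"
  have c1: "contractive ?Y (\<lambda>is. of_bool (\<forall>j\<in>A. \<kappa> (is ! j) = \<kappa> (is ! j0)))"
    by (rule contractive_block_diagonal[OF p0 n \<kappa> j0m fA A])
  have c2: "contractive ?Y (\<lambda>is. of_bool (\<forall>j<m. j \<notin> A \<longrightarrow> is ! j = c j))"
    by (rule contractive_tensor_bool[OF p0])
  note 2 = contractiveD[OF c2 x]
  have x': "x' \<in> vecs ?Y" "nrm ?Y x' \<le> nrm ?Y x"
    using contractiveD[OF c1 2(1)] 2(2) unfolding x'_def by auto
  obtain u where u: "u \<in> vecs ?U" "x' = coeffs u" "nrm ?Y x' = nrm ?U u"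
    by (rule ell_inj_tensorE[OF p0 x'(1)])
  define X where "X k = (\<lambda>is. of_bool (\<forall>j<m. if j \<in> A then \<kappa> (is ! j) = k else is ! j = c j) * x is)" for k
  define u1 where "u1 k \<phi>s = (if \<phi>s \<in> ?D then u (map (\<lambda>j x. (\<phi>s ! j) (\<lambda>i. g k j i * x i)) [0..<m]) else 0)" for k \<phi>s
  define u2 where "u2 k \<phi>s = (if \<phi>s \<in> ?D then u (map (\<lambda>j x. (\<phi>s ! j) (\<lambda>i. g0 k j i * x i)) [0..<m]) else 0)" for k \<phi>s
  have u1: "u1 k \<in> vecs ?U" for k
    unfolding u1_def[abs_def] by (rule tensor_mult(1)[OF p0 u(1) ng(1)])
  have u2: "u2 k \<in> vecs ?U" for k
    unfolding u2_def[abs_def] by (rule tensor_mult(1)[OF p0 u(1) ng(2)])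
  have X1: "coeffs (u1 k) = X k" for k
  proof -
    have "coeffs (u1 k) = (\<lambda>is. (\<Prod>j<m. g k j (is ! j)) * x' is)"
      unfolding u1_def[abs_def] u(2) by (rule tensor_mult_array[OF p0 u(1) ng(1)])
    also have "\<dots> = X k"
      unfolding g_def x'_def X_def prod_of_bool[OF finite_lessThan] mult.assoc[symmetric] of_bool_conj[symmetric]
      using A j0 by (intro ext arg_cong2[where f = "(*)"] arg_cong[where f = of_bool] refl) (auto split: if_splits)
    finally show ?thesis .
  qed
  have X2: "coeffs (u2 k) = X k" for k
  proof -
    have "coeffs (u2 k) = (\<lambda>is. (\<Prod>j<m. g0 k j (is ! j)) * x' is)"
      unfolding u2_def[abs_def] u(2) by (rule tensor_mult_array[OF p0 u(1) ng(2)])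
    also have "\<dots> = X k"
      unfolding g0_def x'_def X_def prod_of_bool[OF finite_lessThan] mult.assoc[symmetric] of_bool_conj[symmetric]
      using A j0 j0m by (intro ext arg_cong2[where f = "(*)"] arg_cong[where f = of_bool] refl) (auto split: if_splits)
    finally show ?thesis .
  qed
  have u12: "u1 k = u2 k" for k
    by (rule coeffs_determine[OF p0 u1 u2]) (simp add: X1 X2)
  have nX: "nrm ?Y (X k) = nrm ?U (u1 k)" for k
    using nrm_coeffs[OF p0 u1] X1 by metis
  \<comment> \<open>This factor brings the glued functionals back into the dual ball. It is inserted
    in the slots outside \<open>A\<close> as well, where \<open>s \<le> 1\<close> does no harm, so
    that the total loss is \<open>s ^ m\<close> for every \<open>A\<close>.\<close>
  define s where "s = real n powr (- (1 - 1 / p))"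
  have s: "0 < s" "s \<le> 1"
  proof -
    show "0 < s" using n by (simp add: s_def)
    have "s \<le> real n powr 0" unfolding s_def using n p by (intro powr_mono) auto
    then show "s \<le> 1" using n by simp
  qed
  have main: "s ^ m * (\<Sum>k<n. nrm ?Y (X k) - \<epsilon>) \<le> nrm ?Y x" if \<epsilon>: "\<epsilon> > 0" for \<epsilon>
  proof -
    have "\<exists>\<phi>s. \<phi>s \<in> ?D \<and> nrm ?U (u1 k) - \<epsilon> < norm (u1 k \<phi>s)" for k
      by (rule tensor_nrm_less[OF u1, of "nrm ?U (u1 k) - \<epsilon>" k]) (use \<epsilon> in auto)
    then obtain F where F: "\<And>k. F k \<in> ?D" "\<And>k. nrm ?U (u1 k) - \<epsilon> < norm (u1 k (F k))" by metis
    define \<psi> where "\<psi> k j = F k ! j" for k j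
    have \<psi>: "\<psi> k j \<in> dual_ball (ell p)" if "j < m" for k j
      unfolding \<psi>_def by (rule dual_tuples_nth[OF F(1) that])
    \<comment> \<open>In a slot outside \<open>A\<close> only the coordinate \<open>c j\<close> of a
      block survives, and a functional acts on it as the coordinate functional times this
      scalar.\<close>
    define \<alpha> where "\<alpha> k j = (if j \<in> A then 1 else \<psi> k j (\<lambda>i. of_bool (i = c j)))" for k j
    define \<sigma> where "\<sigma> k = cnj (sgn (u1 k (F k)))" for k
    \<comment> \<open>All scalars belonging to block \<open>k\<close> are moved into the single slot
      \<open>j0\<close>. The phase \<open>\<sigma> k\<close> makes the contribution of each block
      nonnegative, so that the blocks add up without cancellation.\<close>
    define \<mu> where "\<mu> k = \<sigma> k * (\<Prod>j<m. \<alpha> k j)" for k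
    have n\<alpha>: "norm (\<alpha> k j) \<le> 1" if "j < m" for k j
      using dual_ball_unit[OF \<psi>[OF that]] by (simp add: \<alpha>_def)
    have n\<mu>: "norm (\<mu> k) \<le> 1" for k
    proof -
      have "(\<Prod>j<m. norm (\<alpha> k j)) \<le> (\<Prod>j<m. 1)" using n\<alpha> by (intro prod_mono) auto
      moreover have "norm (\<sigma> k) \<le> 1" by (simp add: \<sigma>_def norm_sgn)
      ultimately show ?thesis
        unfolding \<mu>_def norm_mult prod_norm[symmetric] by (intro mult_le_one prod_nonneg) auto
    qed
    define C where "C k j = of_real s * (if j = j0 then \<mu> k else 1)" for k j
    have nC: "norm (C k j) \<le> 1" for k j
      using mult_le_one[OF s(2) norm_ge_zero n\<mu>] s by (auto simp: C_def norm_mult)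
    define \<xi> where "\<xi> k j x = (if j \<in> A then \<psi> k j (\<lambda>i. of_bool (\<kappa> i = k) * x i) else x (c j))" for k j x
    have \<xi>: "\<xi> k j \<in> dual_ball (ell p)" if "j < m" for k j
      unfolding \<xi>_def[abs_def] using dual_ball_mult[OF p0 _ \<psi>[OF that], of "\<lambda>i. of_bool (\<kappa> i = k)" k]
        coord_in_dual_ball[OF p0, of "c j"] by (cases "j \<in> A") auto
    define \<Phi> where "\<Phi> j x = (if j \<in> A then \<Sum>k<n. C k j * \<xi> k j x else of_real s * x (c j))" for j x
    have \<Phi>: "\<Phi> j \<in> dual_ball (ell p)" if j: "j < m" for j
    proof (cases "j \<in> A")
      case False
      then have "\<Phi> j = (\<lambda>x. of_real s * x (c j))" by (auto simp: \<Phi>_def)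
      then show ?thesis using dual_ball_scale[OF _ coord_in_dual_ball[OF p0], of "of_real s" "c j"] s by simp
    next
      case True
      then have e: "\<Phi> j = (\<lambda>x. \<Sum>k<n. C k j * \<xi> k j x)" by (auto simp: \<Phi>_def)
      have "norm (\<Phi> j x) \<le> nrm (ell p) x" if x: "x \<in> vecs (ell p)" for x
      proof -
        have xk: "(\<lambda>i. of_bool (\<kappa> i = k) * x i) \<in> vecs (ell p)" for k
          by (rule ell_mult(1)[OF p0 _ x]) simp
        have "norm (\<Phi> j x) \<le> (\<Sum>k<n. norm (C k j * \<xi> k j x))" unfolding e by (rule norm_sum)
        also have "\<dots> \<le> (\<Sum>k<n. s * nrm (ell p) (\<lambda>i. of_bool (\<kappa> i = k) * x i))"
          unfolding norm_mult
        proof (intro sum_mono mult_mono)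
          fix k
          show "norm (C k j) \<le> s" using n\<mu>[of k] s by (auto simp: C_def norm_mult intro: mult_left_le)
          show "norm (\<xi> k j x) \<le> nrm (ell p) (\<lambda>i. of_bool (\<kappa> i = k) * x i)"
            using dual_ball_D(3)[OF \<psi>[OF j] xk] True by (simp add: \<xi>_def)
        qed (use s in auto)
        also have "\<dots> = s * (\<Sum>k<n. nrm (ell p) (\<lambda>i. of_bool (\<kappa> i = k) * x i))" by (simp add: sum_distrib_left)
        also have "\<dots> \<le> s * (real n powr (1 - 1 / p) * nrm (ell p) x)"
          using s by (intro mult_left_mono ell_blocks p n \<kappa> x) auto
        also have "\<dots> = (s * real n powr (1 - 1 / p)) * nrm (ell p) x" by simp
        also have "s * real n powr (1 - 1 / p) = 1" unfolding s_def powr_add[symmetric] using n by simp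
        finally show ?thesis by simp
      qed
      moreover have "\<Phi> j (\<lambda>i. x i + y i) = \<Phi> j x + \<Phi> j y" if "x \<in> vecs (ell p)" "y \<in> vecs (ell p)" for x y
        unfolding e using dual_ball_D(1)[OF \<xi>[OF j] that] by (simp add: distrib_left sum.distrib)
      moreover have "\<Phi> j (\<lambda>i. a * x i) = a * \<Phi> j x" if "x \<in> vecs (ell p)" for a x
        unfolding e using dual_ball_D(2)[OF \<xi>[OF j] that] by (simp add: sum_distrib_left mult.left_commute)
      ultimately show ?thesis unfolding dual_ball_def by blast
    qed
    have \<Phi>g: "\<Phi> j (\<lambda>i. g k j i * x i) = C k j * \<xi> k j x" if j: "j < m" and k: "k < n" for j k x
    proof (cases "j \<in> A")
      case True
      have h: "\<xi> k' j (\<lambda>i. of_bool (\<kappa> i = k) * x i) = (if k' = k then \<xi> k j x else 0)" for k'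
      proof -
        have "(\<lambda>i. of_bool (\<kappa> i = k') * (of_bool (\<kappa> i = k) * x i)) = (\<lambda>i. if k' = k then of_bool (\<kappa> i = k) * x i else 0)"
          by auto
        then show ?thesis using True dual_ball_zero[OF \<psi>[OF j]] by (simp add: \<xi>_def)
      qed
      have "\<Phi> j (\<lambda>i. g k j i * x i) = (\<Sum>k'<n. C k' j * (if k' = k then \<xi> k j x else 0))"
        using True by (simp only: \<Phi>_def g_def h if_True)
      also have "\<dots> = (\<Sum>k'<n. if k' = k then C k j * \<xi> k j x else 0)" by (intro sum.cong) auto
      finally show ?thesis using k by simp
    next
      case False
      then have "j \<noteq> j0" using j0 by auto
      then show ?thesis using False by (simp add: \<Phi>_def g_def C_def \<xi>_def)
    qed
    have \<psi>g: "\<psi> k j (\<lambda>i. g k j i * x i) = \<alpha> k j * \<xi> k j x" if j: "j < m" for j k x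
    proof (cases "j \<in> A")
      case False
      have "(\<lambda>i. of_bool (i = c j) * x i) = (\<lambda>i. x (c j) * of_bool (i = c j))" by auto
      then show ?thesis using dual_ball_D(2)[OF \<psi>[OF j, of k] unit_in_ell[of "c j"], of "x (c j)"] False
        by (simp add: g_def \<alpha>_def \<xi>_def mult.commute)
    qed (simp add: g_def \<alpha>_def \<xi>_def)
    have D: "map \<Phi> [0..<m] \<in> ?D" by (intro map_in_dual_tuples \<Phi>)
    have "u1 k (map \<Phi> [0..<m]) = of_real (s ^ m * norm (u1 k (F k)))" if k: "k < n" for k
    proof -
      have "u1 k (map \<Phi> [0..<m]) = u (map (\<lambda>j x. C k j * \<xi> k j x) [0..<m])"
        using D \<Phi>g[OF _ k] by (auto simp: u1_def intro!: arg_cong[where f = u])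
      also have "\<dots> = (\<Prod>j<m. C k j) * u (map (\<xi> k) [0..<m])"
        by (rule tensor_slot_scale[OF u(1) \<xi> nC])
      also have "(\<Prod>j<m. C k j) = of_real (s ^ m) * \<mu> k"
        using j0m by (simp add: C_def prod.distrib)
      also have "\<dots> * u (map (\<xi> k) [0..<m]) = of_real (s ^ m) * \<sigma> k * ((\<Prod>j<m. \<alpha> k j) * u (map (\<xi> k) [0..<m]))"
        by (simp add: \<mu>_def)
      also have "(\<Prod>j<m. \<alpha> k j) * u (map (\<xi> k) [0..<m]) = u (map (\<lambda>j x. \<alpha> k j * \<xi> k j x) [0..<m])"
        by (rule tensor_slot_scale[OF u(1) \<xi> n\<alpha>, symmetric])
      also have "\<dots> = u1 k (F k)"
        using F(1) \<psi>g by (auto simp: u1_def \<psi>_def intro!: arg_cong[where f = u])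
      also have "of_real (s ^ m) * \<sigma> k * u1 k (F k) = of_real (s ^ m * norm (u1 k (F k)))"
        using cnj_sgn_mult[of "u1 k (F k)"] by (simp add: \<sigma>_def mult.assoc)
      finally show ?thesis .
    qed
    moreover have "u (map \<Phi> [0..<m]) = (\<Sum>k<n. u1 k (map \<Phi> [0..<m]))"
    proof -
      have "u (map \<Phi> [0..<m]) = (\<Sum>k<n. u (map (\<Phi>(j0 := (\<lambda>x. C k j0 * \<xi> k j0 x))) [0..<m]))"
        by (rule tensor_slot_add[OF u(1) j0m \<Phi>]) (use dual_ball_scale[OF nC \<xi>[OF j0m]] j0 in \<open>auto simp: \<Phi>_def\<close>)
      also have "\<dots> = (\<Sum>k<n. u2 k (map \<Phi> [0..<m]))"
      proof (rule sum.cong[OF refl])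
        fix k assume "k \<in> {..<n}"
        then have k: "k < n" by simp
        have "(\<Phi>(j0 := (\<lambda>x. C k j0 * \<xi> k j0 x))) j = (\<lambda>x. \<Phi> j (\<lambda>i. g0 k j i * x i))" if "j < m" for j
        proof (cases "j = j0")
          case True
          then have "g0 k j = g k j" using j0 by (auto simp: g0_def g_def fun_eq_iff)
          with True \<Phi>g[OF j0m k] show ?thesis by auto
        qed (simp add: g0_def)
        then show "u (map (\<Phi>(j0 := (\<lambda>x. C k j0 * \<xi> k j0 x))) [0..<m]) = u2 k (map \<Phi> [0..<m])"
          using D by (auto simp: u2_def intro!: arg_cong[where f = u])
      qed
      finally show ?thesis by (simp add: u12)
    qed
    ultimately have "u (map \<Phi> [0..<m]) = of_real (\<Sum>k<n. s ^ m * norm (u1 k (F k)))" by simp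
    then have "(\<Sum>k<n. s ^ m * norm (u1 k (F k))) \<le> norm (u (map \<Phi> [0..<m]))"
      by (simp only: norm_of_real abs_ge_self)
    also have "\<dots> \<le> nrm ?Y x" using tensor_le[OF u(1) D] u(3) x'(2) by linarith
    finally have "(\<Sum>k<n. s ^ m * norm (u1 k (F k))) \<le> nrm ?Y x" .
    moreover have "s ^ m * (\<Sum>k<n. nrm ?Y (X k) - \<epsilon>) \<le> (\<Sum>k<n. s ^ m * norm (u1 k (F k)))"
      unfolding sum_distrib_left nX using s F(2) by (intro sum_mono mult_left_mono less_imp_le) auto
    ultimately show ?thesis by linarith
  qed
  have "s ^ m * (\<Sum>k<n. nrm ?Y (X k)) \<le> nrm ?Y x"
  proof (rule field_le_epsilon)
    fix e :: real assume e: "e > 0"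
    have n0: "real n > 0" using n by simp
    have sm: "s ^ m * e \<le> e" using s e by (simp add: power_le_one mult_left_le_one_le)
    have "s ^ m * (\<Sum>k<n. nrm ?Y (X k)) = s ^ m * (\<Sum>k<n. nrm ?Y (X k) - e / n) + s ^ m * e"
      using n0 by (simp add: sum_subtractf algebra_simps)
    moreover have "s ^ m * (\<Sum>k<n. nrm ?Y (X k) - e / n) \<le> nrm ?Y x"
      using e n0 by (intro main) simp
    ultimately show "s ^ m * (\<Sum>k<n. nrm ?Y (X k)) \<le> nrm ?Y x + e"
      using sm by linarith
  qed
  then have "real n powr (real m * (1 - 1 / p)) * (s ^ m * (\<Sum>k<n. nrm ?Y (X k))) \<le> real n powr (real m * (1 - 1 / p)) * nrm ?Y x"
    by (intro mult_left_mono) auto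
  moreover have "real n powr (real m * (1 - 1 / p)) * s ^ m = 1"
  proof -
    have "s ^ m = real n powr (- (1 - 1 / p) * real m)"
      using n by (simp add: s_def powr_realpow[symmetric] powr_powr)
    moreover have "real m * (1 - 1 / p) + - (1 - 1 / p) * real m = 0" by (simp add: algebra_simps)
    ultimately show ?thesis using n by (simp only: powr_add[symmetric]) simp
  qed
  ultimately have "(\<Sum>k<n. nrm ?Y (X k)) \<le> real n powr (real m * (1 - 1 / p)) * nrm ?Y x"
    by (simp add: mult.assoc[symmetric])
  then show ?thesis by (simp add: X_def)
qed

text \<open>For an elementary tensor the tail in slot \<open>j\<close> is controlled by the tail of
  the \<open>j\<close>-th vector. Linear combinations follow, and density together with
  contractivity of the cuts reaches the completion.\<close>

lemma tensor_tail:
  assumes p: "p > 0" and j: "j < m" and x: "x \<in> vecs (ell_inj_tensor m p)"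
  shows "(\<lambda>N. nrm (ell_inj_tensor m p) (\<lambda>is. of_bool (N \<le> is ! j) * x is)) \<longlonglongrightarrow> 0"
proof -
  let ?Y = "ell_inj_tensor m p" and ?U = "inj_tensor_power m (ell p)" and ?D = "dual_tuples m (ell p)"
  interpret seminormed ?Y by (rule seminormed_tensor[OF p])
  define g where "g N l i = (of_bool (l = j \<longrightarrow> N \<le> i) :: complex)" for N l i :: nat
  have ng: "norm (g N l i) \<le> 1" for N l i by (simp add: g_def)
  have gp: "(\<Prod>l<m. g N l (is ! l)) = of_bool (N \<le> is ! j)" for N "is"
    using j by (auto simp: g_def prod_of_bool intro!: arg_cong[where f = of_bool])
  have c: "contractive ?Y (\<lambda>is. of_bool (N \<le> is ! j))" for N
    using contractive_tensor[where g = "g N" and m = m, OF p ng] by (simp add: gp)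
  obtain u where u: "u \<in> vecs ?U" "x = coeffs u" "nrm ?Y x = nrm ?U u" by (rule ell_inj_tensorE[OF p x])
  have elem: "(\<lambda>N. nrm ?Y (\<lambda>is. of_bool (N \<le> is ! j) * coeffs (elem_tensor m (ell p) xs) is)) \<longlonglongrightarrow> 0"
    if xs: "length xs = m" "set xs \<subseteq> vecs (ell p)" for xs
  proof -
    let ?e = "elem_tensor m (ell p) xs"
    have e: "?e \<in> vecs ?U" by (intro alg_in_tensor elem_in_alg xs)
    have xj: "xs ! l \<in> vecs (ell p)" if "l < m" for l using xs that by auto
    let ?t = "\<lambda>N. nrm (ell p) (\<lambda>i. if i < N then 0 else (xs ! j) i)"
    let ?P = "\<Prod>l\<in>{..<m} - {j}. nrm (ell p) (xs ! l)"
    have bound: "nrm ?Y (\<lambda>is. of_bool (N \<le> is ! j) * coeffs ?e is) \<le> ?t N * ?P" for N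
    proof -
      let ?v = "\<lambda>\<phi>s. if \<phi>s \<in> ?D then ?e (map (\<lambda>j x. (\<phi>s ! j) (\<lambda>i. g N j i * x i)) [0..<m]) else 0"
      have v: "?v \<in> vecs ?U" by (rule tensor_mult(1)[where g = "g N", OF p e ng])
      have "norm (?v \<phi>s) \<le> ?t N * ?P" if \<phi>s: "\<phi>s \<in> ?D" for \<phi>s
      proof -
        have b: "(\<lambda>x. (\<phi>s ! l) (\<lambda>i. g N l i * x i)) \<in> dual_ball (ell p)" if "l < m" for l
          by (intro dual_ball_mult p ng dual_tuples_nth[OF \<phi>s that])
        have "?v \<phi>s = (\<Prod>l<m. (\<phi>s ! l) (\<lambda>i. g N l i * (xs ! l) i))"
          using \<phi>s b by (simp add: elem_tensor_map)
        also have "norm \<dots> \<le> (\<Prod>l<m. nrm (ell p) (\<lambda>i. g N l i * (xs ! l) i))"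
          unfolding prod_norm[symmetric]
          by (intro prod_mono conjI dual_ball_D(3)[OF dual_tuples_nth[OF \<phi>s]] ell_mult(1)[where g = "g N l" for l, OF p ng xj]) auto
        also have "\<dots> = nrm (ell p) (\<lambda>i. g N j i * (xs ! j) i) * (\<Prod>l\<in>{..<m} - {j}. nrm (ell p) (\<lambda>i. g N l i * (xs ! l) i))"
          using j by (intro prod.remove) auto
        also have "(\<lambda>i. g N j i * (xs ! j) i) = (\<lambda>i. if i < N then 0 else (xs ! j) i)"
          by (auto simp: g_def)
        also have "(\<Prod>l\<in>{..<m} - {j}. nrm (ell p) (\<lambda>i. g N l i * (xs ! l) i)) = ?P"
          by (intro prod.cong) (auto simp: g_def)
        finally show ?thesis .
      qed
      then have "nrm ?U ?v \<le> ?t N * ?P" by (rule tensor_nrm_le)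
      moreover have "coeffs ?v = (\<lambda>is. of_bool (N \<le> is ! j) * coeffs ?e is)"
        using tensor_mult_array[where g = "g N", OF p e ng] by (simp add: gp)
      ultimately show ?thesis using nrm_coeffs[OF p v] by metis
    qed
    have lim: "(\<lambda>N. ?t N * ?P) \<longlonglongrightarrow> 0"
      by (intro tendsto_mult_left_zero ell_tail_norm p xj j)
    have "norm (nrm ?Y (\<lambda>is. of_bool (N \<le> is ! j) * coeffs ?e is)) \<le> ?t N * ?P" for N
      unfolding real_norm_def abs_of_nonneg[OF nonneg[OF contractiveD(1)[OF c coeffs_in[OF e]]]] by (rule bound)
    from Lim_null_comparison[OF always_eventually[OF allI[OF this]] lim] show ?thesis .
  qed
  have alg: "(\<lambda>N. nrm ?Y (\<lambda>is. of_bool (N \<le> is ! j) * coeffs v is)) \<longlonglongrightarrow> 0"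
    if v: "v \<in> alg_tensor_power m (ell p)" for v
  proof -
    obtain n d xs where vv: "v = (\<lambda>\<phi>s. \<Sum>l<(n::nat). d l * elem_tensor m (ell p) (xs l) \<phi>s)"
      "\<And>l. l < n \<Longrightarrow> length (xs l) = m" "\<And>l. l < n \<Longrightarrow> set (xs l) \<subseteq> vecs (ell p)"
      using v by (rule algE) blast
    let ?E = "\<lambda>N l is. of_bool (N \<le> is ! j) * coeffs (elem_tensor m (ell p) (xs l)) is"
    have E: "?E N l \<in> vecs ?Y" if "l < n" for N l
      using vv that by (intro contractiveD(1)[OF c] coeffs_in alg_in_tensor elem_in_alg)
    have bound: "nrm ?Y (\<lambda>is. of_bool (N \<le> is ! j) * coeffs v is) \<le> (\<Sum>l<n. norm (d l) * nrm ?Y (?E N l))" for N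
    proof -
      have eq: "(\<lambda>is. of_bool (N \<le> is ! j) * coeffs v is) = (\<lambda>is. \<Sum>l<n. d l * ?E N l is)"
        by (simp add: vv(1) coeffs_def sum_distrib_left mult.left_commute)
      show ?thesis unfolding eq
        using nrm_sum[of "{..<n}" "\<lambda>l is. d l * ?E N l is"] scale[OF E] nrm_scale[OF E] by simp
    qed
    have lim: "(\<lambda>N. \<Sum>l<n. norm (d l) * nrm ?Y (?E N l)) \<longlonglongrightarrow> 0"
      using elem vv by (intro tendsto_null_sum tendsto_mult_right_zero) auto
    have "norm (nrm ?Y (\<lambda>is. of_bool (N \<le> is ! j) * coeffs v is)) \<le> (\<Sum>l<n. norm (d l) * nrm ?Y (?E N l))" for N
      unfolding real_norm_def abs_of_nonneg[OF nonneg[OF contractiveD(1)[OF c coeffs_in[OF alg_in_tensor[OF v]]]]]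
      by (rule bound)
    from Lim_null_comparison[OF always_eventually[OF allI[OF this]] lim] show ?thesis .
  qed
  show ?thesis
  proof (rule tendstoI)
    fix e :: real assume e: "e > 0"
    then have "e / 2 > 0" by simp
    then obtain v where v: "v \<in> alg_tensor_power m (ell p)" "\<And>\<phi>s. \<phi>s \<in> ?D \<Longrightarrow> norm (u \<phi>s - v \<phi>s) \<le> e / 2"
      by (rule tensor_approx[OF u(1)]) blast
    have vU: "v \<in> vecs ?U" by (rule alg_in_tensor[OF v(1)])
    have d: "(\<lambda>is. x is - coeffs v is) \<in> vecs ?Y" by (intro diff x coeffs_in vU)
    have "(\<lambda>is. x is - coeffs v is) = coeffs (\<lambda>\<phi>s. u \<phi>s + (-1) * v \<phi>s)" by (simp add: u(2) coeffs_def)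
    then have "nrm ?Y (\<lambda>is. x is - coeffs v is) = nrm ?U (\<lambda>\<phi>s. u \<phi>s + (-1) * v \<phi>s)"
      using nrm_coeffs[OF p tensor_add[OF u(1) tensor_scale[OF vU, of "-1"]]] by simp
    also have "\<dots> \<le> e / 2" by (rule tensor_nrm_le) (use v in simp)
    finally have d2: "nrm ?Y (\<lambda>is. x is - coeffs v is) \<le> e / 2" .
    have "\<forall>\<^sub>F N in sequentially. nrm ?Y (\<lambda>is. of_bool (N \<le> is ! j) * coeffs v is) < e / 2"
      by (rule order_tendstoD(2)[OF alg[OF v(1)]]) (use e in simp)
    then show "\<forall>\<^sub>F N in sequentially. dist (nrm ?Y (\<lambda>is. of_bool (N \<le> is ! j) * x is)) 0 < e"
    proof eventually_elim
      case (elim N)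
      note 1 = contractiveD[OF c[of N] d] and 2 = contractiveD(1)[OF c[of N] coeffs_in[OF vU]]
      have "nrm ?Y (\<lambda>is. of_bool (N \<le> is ! j) * (x is - coeffs v is) + of_bool (N \<le> is ! j) * coeffs v is) < e"
        using triangle[OF 1(1) 2] 1(2) d2 elim by linarith
      then have "nrm ?Y (\<lambda>is. of_bool (N \<le> is ! j) * x is) < e" by (simp add: right_diff_distrib)
      then show ?case using nonneg[OF contractiveD(1)[OF c[of N] x]] by (simp add: dist_real_def)
    qed
  qed
qed

text \<open>The product is at most the \<open>m\<close>-th power of the largest factor. This crude
  form of the inequality of means decouples the slots and is the source of the factor
  \<open>m\<close> in \<open>diag_unit_sum\<close>.\<close>

lemma prod_le_sum_power:
  fixes b :: "nat \<Rightarrow> real"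
  assumes m: "m > 0" and b: "\<And>j. 0 \<le> b j"
  shows "(\<Prod>j<m. b j) \<le> (\<Sum>j<m. b j ^ m)"
proof -
  have "Max (b ` {..<m}) \<in> b ` {..<m}" using m by (intro Max_in) auto
  then obtain l where l: "l < m" "b l = Max (b ` {..<m})" by auto
  have "(\<Prod>j<m. b j) \<le> (\<Prod>j<m. b l)" unfolding l(2) using b by (intro prod_mono) auto
  also have "\<dots> = b l ^ m" by simp
  also have "\<dots> \<le> (\<Sum>j<m. b j ^ m)" using l(1) b by (intro member_le_sum) auto
  finally show ?thesis .
qed

definition diag_unit :: "nat \<Rightarrow> nat \<Rightarrow> nat list \<Rightarrow> complex" where
  "diag_unit m k is = of_bool (is = replicate m k)"

text \<open>At a tuple of functionals the \<open>k\<close>-th term is a product over the slots,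
  bounded by a sum of \<open>m\<close>-th powers; each slot is then covered by
  \<open>dual_ball_power_sum\<close>. Only the moduli of the coefficients enter, so the phases are
  free.\<close>

lemma diag_unit_sum:
  assumes p: "1 < p" and m: "m > 0" and F: "finite F" and \<epsilon>: "\<And>k. k \<in> F \<Longrightarrow> norm (\<epsilon> k) \<le> 1"
  shows "(\<lambda>is. \<Sum>k\<in>F. \<epsilon> k * diag_unit m k is) \<in> vecs (ell_inj_tensor m p)" (is ?in)
    "nrm (ell_inj_tensor m p) (\<lambda>is. \<Sum>k\<in>F. \<epsilon> k * diag_unit m k is)
      \<le> real m * real (card F) powr max 0 (1 - real m * (1 - 1 / p))" (is ?le)
proof -
  let ?U = "inj_tensor_power m (ell p)" and ?D = "dual_tuples m (ell p)"
  have p0: "p > 0" using p by simp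
  define E where "E k = elem_tensor m (ell p) (replicate m (\<lambda>i. of_bool (i = k)))" for k
  have E: "E k \<in> alg_tensor_power m (ell p)" for k
    unfolding E_def by (intro elem_in_alg) (auto simp: unit_in_ell)
  have dE: "coeffs (E k) = diag_unit m k" for k
  proof
    fix "is"
    show "coeffs (E k) is = diag_unit m k is"
    proof (cases "length is = m")
      case True
      have e: "map (\<lambda>i x. x i) is = map (\<lambda>j x. x (is ! j)) [0..<m]" using True by (intro nth_equalityI) auto
      have "coeffs (E k) is = (\<Prod>j<m. of_bool (is ! j = k))"
        unfolding coeffs_def E_def e by (subst elem_tensor_map) (auto intro: coord_in_dual_ball[OF p0])
      also have "\<dots> = of_bool (is = replicate m k)"
        using True by (auto simp: prod_of_bool list_eq_iff_nth_eq intro!: arg_cong[where f = of_bool])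
      finally show ?thesis by (simp add: diag_unit_def)
    next
      case False
      then have "is \<noteq> replicate m k" by auto
      then show ?thesis
        using ell_inj_tensor_length[OF coeffs_in[OF alg_in_tensor[OF E]] False] by (simp add: diag_unit_def)
    qed
  qed
  let ?u = "\<lambda>\<phi>s. \<Sum>k\<in>F. \<epsilon> k * E k \<phi>s"
  have u: "?u \<in> vecs ?U"
    using F
  proof (induction F rule: finite_induct)
    case empty
    show ?case by (rule tensorI) (auto intro!: bexI[of _ "\<lambda>\<phi>s. 0"] exI[of _ 0] simp: alg_tensor_power_def)
  next
    case (insert a F)
    then show ?case using tensor_add[OF tensor_scale[OF alg_in_tensor[OF E]] insert(3), of "\<epsilon> a" a] by simp
  qed
  have eq: "(\<lambda>is. \<Sum>k\<in>F. \<epsilon> k * diag_unit m k is) = coeffs ?u"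
    unfolding dE[symmetric] by (simp add: coeffs_def)
  show ?in unfolding eq by (rule coeffs_in[OF u])
  let ?R = "real (card F) powr max 0 (1 - real m * (1 - 1 / p))"
  have "norm (?u \<phi>s) \<le> real m * ?R" if \<phi>s: "\<phi>s \<in> ?D" for \<phi>s
  proof -
    let ?b = "\<lambda>j k. norm ((\<phi>s ! j) (\<lambda>i. of_bool (i = k)))"
    have Ek: "norm (E k \<phi>s) \<le> (\<Sum>j<m. ?b j k ^ m)" for k
    proof -
      have "E k \<phi>s = (\<Prod>j<m. (\<phi>s ! j) (\<lambda>i. of_bool (i = k)))"
        using \<phi>s by (simp add: E_def elem_tensor_def)
      then have "norm (E k \<phi>s) = (\<Prod>j<m. ?b j k)" by (simp add: prod_norm)
      also have "\<dots> \<le> (\<Sum>j<m. ?b j k ^ m)" by (rule prod_le_sum_power[OF m]) simp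
      finally show ?thesis .
    qed
    have "norm (?u \<phi>s) \<le> (\<Sum>k\<in>F. norm (\<epsilon> k * E k \<phi>s))" by (rule norm_sum)
    also have "\<dots> \<le> (\<Sum>k\<in>F. 1 * (\<Sum>j<m. ?b j k ^ m))"
      unfolding norm_mult by (intro sum_mono mult_mono \<epsilon> Ek) auto
    also have "\<dots> = (\<Sum>j<m. \<Sum>k\<in>F. ?b j k ^ m)" by (subst sum.swap) simp
    also have "\<dots> \<le> (\<Sum>j<m. ?R)"
      by (intro sum_mono dual_ball_power_sum p F m dual_tuples_nth[OF \<phi>s]) auto
    finally show ?thesis by simp
  qed
  then show ?le unfolding eq nrm_coeffs[OF p0 u] by (rule tensor_nrm_le)
qed

text \<open>The lower bound comes from taking the \<open>k\<close>-th coordinate functional in every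
  slot.\<close>

lemma nrm_diag_unit_ge:
  assumes p: "1 < p" and m: "m > 0"
  shows "diag_unit m k \<in> vecs (ell_inj_tensor m p)" "1 \<le> nrm (ell_inj_tensor m p) (diag_unit m k)"
proof -
  have p0: "p > 0" using p by simp
  show d: "diag_unit m k \<in> vecs (ell_inj_tensor m p)"
    using diag_unit_sum(1)[OF p m, of "{k}" "\<lambda>_. 1"] by simp
  obtain u where u: "u \<in> vecs (inj_tensor_power m (ell p))" "diag_unit m k = coeffs u"
    "nrm (ell_inj_tensor m p) (diag_unit m k) = nrm (inj_tensor_power m (ell p)) u"
    by (rule ell_inj_tensorE[OF p0 d])
  have "map (\<lambda>i x. x i) (replicate m k) \<in> dual_tuples m (ell p)"
    by (auto simp: dual_tuples_def coord_in_dual_ball[OF p0])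
  from tensor_le[OF u(1) this] have "norm (coeffs u (replicate m k)) \<le> nrm (inj_tensor_power m (ell p)) u"
    by (simp add: coeffs_def)
  then show "1 \<le> nrm (ell_inj_tensor m p) (diag_unit m k)"
    unfolding u(3) by (simp add: u(2)[symmetric] diag_unit_def)
qed

subsection \<open>Gliding hump\<close>

lemma powr_dominates:
  fixes a b d K :: real
  assumes "a < b" "d > 0"
  obtains n :: nat where "n > 0" "K * real n powr a < d * real n powr b"
proof -
  define X where "X = max 1 (K / d + 1)"
  define n where "n = nat \<lceil>X powr (1 / (b - a))\<rceil>"
  have X: "X \<ge> 1" "K / d < X" by (auto simp: X_def)
  have le: "X powr (1 / (b - a)) \<le> real n" unfolding n_def by linarith
  have "0 < X powr (1 / (b - a))" using X by simp
  with le have n0: "n > 0" by (cases n) auto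
  have "X = (X powr (1 / (b - a))) powr (b - a)" using X assms by (simp add: powr_powr)
  also have "\<dots> \<le> real n powr (b - a)" using le assms by (intro powr_mono2) auto
  finally have n: "K / d < real n powr (b - a)" "n > 0" using X n0 by auto
  then have "K < d * real n powr (b - a)" using assms by (simp add: pos_divide_less_eq mult.commute)
  then have "K * real n powr a < d * real n powr (b - a) * real n powr a" using n by simp
  also have "\<dots> = d * real n powr b" by (simp add: powr_add[symmetric])
  finally show ?thesis using that n by blast
qed

lemma gliding_hump:
  fixes Z :: "nat list fspace" and y :: "nat \<Rightarrow> nat list \<Rightarrow> complex"
  assumes Z: "seminormed Z"
    and box: "\<And>P. contractive Z (\<lambda>is. of_bool (\<forall>j<m. P j (is ! j)))"
    and tail: "\<And>x j e. x \<in> vecs Z \<Longrightarrow> j < m \<Longrightarrow> e > 0 \<Longrightarrow>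
      \<forall>\<^sub>F N in sequentially. nrm Z (\<lambda>is. of_bool (N \<le> is ! j) * x is) \<le> e"
    and len: "\<And>x is. x \<in> vecs Z \<Longrightarrow> length is \<noteq> m \<Longrightarrow> x is = 0"
    and y: "\<And>k. y k \<in> vecs Z" and lower: "\<delta> > 0" "\<And>k. \<delta> \<le> nrm Z (y k)"
    and upper: "\<And>F \<epsilon>. finite F \<Longrightarrow> (\<And>k. norm (\<epsilon> k) \<le> 1) \<Longrightarrow>
      nrm Z (\<lambda>is. \<Sum>k\<in>F. \<epsilon> k * y k is) \<le> B * real (card F) powr \<rho>"
    and \<rho>: "\<rho> < 1"
  obtains \<delta>' :: real where "\<delta>' > 0"
    "\<And>n. n > 0 \<Longrightarrow> \<exists>x\<in>vecs Z. \<exists>\<kappa> A c. nrm Z x \<le> B * real n powr \<rho> \<and> (\<forall>i. \<kappa> i < n) \<and> A \<noteq> {} \<and> A \<subseteq> {..<m} \<and>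
      (\<forall>l<n. \<delta>' \<le> nrm Z (\<lambda>is. of_bool (\<forall>j<m. if j \<in> A then \<kappa> (is ! j) = l else is ! j = c j) * x is))"
proof -
  interpret seminormed Z by (rule Z)
  have boxB: "contractive Z (\<lambda>is. of_bool (\<forall>j\<in>B. P j (is ! j)))" if "B \<subseteq> {..<m}" for B P
  proof -
    have "(\<lambda>is. of_bool (\<forall>j\<in>B. P j (is ! j)) :: complex) = (\<lambda>is. of_bool (\<forall>j<m. j \<in> B \<longrightarrow> P j (is ! j)))"
      using that by (intro ext arg_cong[where f = of_bool]) auto
    then show ?thesis using box[of "\<lambda>j i. j \<in> B \<longrightarrow> P j i"] by simp
  qed
  have box1: "contractive Z (\<lambda>is. of_bool (P (is ! j)))" if "j < m" for j P
    using boxB[of "{j}" "\<lambda>_. P"] that by simp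
  define Q where "Q C c is = (of_bool (\<forall>j\<in>C. is ! j = c j) :: complex)" for C and c :: "nat \<Rightarrow> nat" and "is"
  have Q: "contractive Z (Q C c)" if "C \<subseteq> {..<m}" for C c
    unfolding Q_def[abs_def] by (rule boxB[OF that])
  define good where "good C \<longleftrightarrow> C \<subseteq> {..<m} \<and> (\<exists>c K d. infinite K \<and> d > 0 \<and> (\<forall>k\<in>K. d \<le> nrm Z (\<lambda>is. Q C c is * y k is)))" for C
  \<comment> \<open>For a maximal set \<open>C\<close> of coordinates that can be frozen along infinitely many \<open>k\<close> without
    losing the lower bound, every other coordinate drifts to infinity.\<close>
  have "good {}"
    unfolding good_def using lower by (auto simp: Q_def intro!: exI[of _ UNIV] exI[of _ \<delta>])
  moreover have "finite {C. good C}"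
    by (rule finite_subset[of _ "Pow {..<m}"]) (auto simp: good_def)
  ultimately obtain C where C: "good C" and max: "\<And>D. good D \<Longrightarrow> C \<subseteq> D \<Longrightarrow> C = D"
    using finite_has_maximal[of "{C. good C}"] by blast
  obtain c K d where Cm: "C \<subseteq> {..<m}" and K: "infinite K" and d: "d > 0"
    and dK: "\<And>k. k \<in> K \<Longrightarrow> d \<le> nrm Z (\<lambda>is. Q C c is * y k is)"
    using C unfolding good_def by blast
  define z where "z k = (\<lambda>is. Q C c is * y k is)" for k
  have z: "z k \<in> vecs Z" for k unfolding z_def by (rule contractiveD(1)[OF Q[OF Cm] y])
  \<comment> \<open>Infinitely many such \<open>k\<close> would allow slot \<open>j\<close> to be
    frozen at the value \<open>v\<close> too, against the maximality of \<open>C\<close>.\<close>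
  have single: "finite {k\<in>K. e \<le> nrm Z (\<lambda>is. of_bool (is ! j = v) * z k is)}"
    if j: "j < m" "j \<notin> C" and e: "e > 0" for j v e
  proof (rule ccontr)
    assume inf: "infinite {k\<in>K. e \<le> nrm Z (\<lambda>is. of_bool (is ! j = v) * z k is)}"
    have "of_bool (is ! j = v) * z k is = Q (insert j C) (c(j := v)) is * y k is" for k "is"
    proof -
      have "(\<forall>l\<in>insert j C. is ! l = (c(j := v)) l) \<longleftrightarrow> is ! j = v \<and> (\<forall>l\<in>C. is ! l = c l)"
        using j by auto
      then show ?thesis unfolding z_def Q_def by simp
    qed
    then have "good (insert j C)"
      unfolding good_def using Cm j inf e
      by (intro conjI exI[of _ "c(j := v)"] exI[of _ "{k\<in>K. e \<le> nrm Z (\<lambda>is. of_bool (is ! j = v) * z k is)}"] exI[of _ e]) auto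
    from max[OF this] j show False by auto
  qed
  \<comment> \<open>With all slots frozen, the \<open>z k\<close> are multiples of one array.
    Suitable phases make sums of \<open>n\<close> of them grow at least like \<open>d * n\<close>,
    which contradicts \<open>upper\<close> because \<open>\<rho> < 1\<close>.\<close>
  have "C \<noteq> {..<m}"
  proof
    assume Ceq: "C = {..<m}"
    define i0 where "i0 = map c [0..<m]"
    define b where "b k = y k i0" for k
    have Qx: "Q C c is * x is = x i0 * of_bool (is = i0)" if "x \<in> vecs Z" for x "is"
    proof (cases "length is = m")
      case True
      then have "(\<forall>j\<in>C. is ! j = c j) \<longleftrightarrow> is = i0" by (auto simp: Ceq i0_def list_eq_iff_nth_eq)
      then show ?thesis by (simp add: Q_def)
    next
      case False
      then have "is \<noteq> i0" by (auto simp: i0_def)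
      with len[OF that False] show ?thesis by simp
    qed
    have zb: "z k = (\<lambda>is. b k * of_bool (is = i0))" for k
      using Qx[OF y] by (simp add: z_def b_def)
    obtain k0 where k0: "k0 \<in> K" using K by (metis finite.emptyI ex_in_conv)
    have b0: "b k0 \<noteq> 0"
    proof
      assume "b k0 = 0"
      then have "nrm Z (z k0) = 0" using nrm_zero by (simp add: zb)
      with dK[OF k0] d show False by (simp add: z_def)
    qed
    have e0: "(\<lambda>is. of_bool (is = i0)) \<in> vecs Z"
      using scale[OF z[of k0], of "inverse (b k0)"] b0 by (simp add: zb mult.assoc[symmetric])
    let ?E = "nrm Z (\<lambda>is. of_bool (is = i0))"
    have bd: "d \<le> norm (b k) * ?E" if "k \<in> K" for k
      using dK[OF that] nrm_scale[OF e0, of "b k"] by (simp add: zb flip: z_def)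
    obtain n :: nat where n: "n > 0" "B * real n powr \<rho> < d * real n powr 1"
      by (rule powr_dominates[OF \<rho> d])
    obtain F where F: "F \<subseteq> K" "finite F" "card F = n" using K by (metis infinite_arbitrarily_large)
    let ?\<epsilon> = "\<lambda>k. cnj (sgn (b k))"
    let ?w = "\<lambda>is. \<Sum>k\<in>F. ?\<epsilon> k * y k is"
    have w: "?w \<in> vecs Z" by (intro sum_in F scale y)
    have "?w i0 = of_real (\<Sum>k\<in>F. norm (b k))"
      using cnj_sgn_mult[of "b _"] by (simp add: b_def)
    then have "(\<lambda>is. Q C c is * ?w is) = (\<lambda>is. of_real (\<Sum>k\<in>F. norm (b k)) * of_bool (is = i0))"
      using Qx[OF w] by simp
    then have "(\<Sum>k\<in>F. norm (b k)) * ?E = nrm Z (\<lambda>is. Q C c is * ?w is)"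
      using nrm_scale[OF e0, of "of_real (\<Sum>k\<in>F. norm (b k))"] by (simp add: sum_nonneg del: of_real_sum)
    also have "\<dots> \<le> nrm Z ?w" by (rule contractiveD(2)[OF Q[OF Cm] w])
    also have "\<dots> \<le> B * real n powr \<rho>"
      using upper[OF F(2), of ?\<epsilon>] F(3) by (simp add: norm_sgn)
    finally have "(\<Sum>k\<in>F. norm (b k) * ?E) \<le> B * real n powr \<rho>" by (simp add: sum_distrib_right)
    moreover have "(\<Sum>k\<in>F. d) \<le> (\<Sum>k\<in>F. norm (b k) * ?E)" using bd F by (intro sum_mono) auto
    ultimately show False using n F(3) by (simp add: mult.commute)
  qed
  define A where "A = {..<m} - C"
  have A: "A \<noteq> {}" "A \<subseteq> {..<m}" "finite A" using \<open>C \<noteq> {..<m}\<close> Cm by (auto simp: A_def)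
  have initial: "finite {k\<in>K. e < nrm Z (\<lambda>is. of_bool (is ! j < M) * z k is)}" if j: "j \<in> A" and e: "e > 0" for j M e
  proof -
    have jm: "j < m" "j \<notin> C" using j by (auto simp: A_def)
    \<comment> \<open>If the part below \<open>M\<close> is larger than \<open>e\<close>, one of its
      \<open>M\<close> slices has size at least \<open>e / M\<close>; \<open>single\<close> applies
      to each slice.\<close>
    have "{k\<in>K. e < nrm Z (\<lambda>is. of_bool (is ! j < M) * z k is)}
      \<subseteq> (\<Union>v<M. {k\<in>K. e / M \<le> nrm Z (\<lambda>is. of_bool (is ! j = v) * z k is)})"
    proof
      fix k assume k: "k \<in> {k\<in>K. e < nrm Z (\<lambda>is. of_bool (is ! j < M) * z k is)}"
      show "k \<in> (\<Union>v<M. {k\<in>K. e / M \<le> nrm Z (\<lambda>is. of_bool (is ! j = v) * z k is)})"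
      proof (rule ccontr)
        assume "\<not> ?thesis"
        then have l: "nrm Z (\<lambda>is. of_bool (is ! j = v) * z k is) \<le> e / M" if "v < M" for v
          using k that by force
        have zv: "(\<lambda>is. of_bool (is ! j = v) * z k is) \<in> vecs Z" for v
          by (rule contractiveD(1)[OF box1[OF jm(1)] z])
        have "(\<lambda>is. of_bool (is ! j < M) * z k is) = (\<lambda>is. \<Sum>v<M. of_bool (is ! j = v) * z k is)"
          by (auto simp: of_bool_def if_distrib[of "\<lambda>x. x * _"] cong: if_cong)
        then have "nrm Z (\<lambda>is. of_bool (is ! j < M) * z k is) \<le> (\<Sum>v<M. nrm Z (\<lambda>is. of_bool (is ! j = v) * z k is))"
          using nrm_sum[of "{..<M}" "\<lambda>v is. of_bool (is ! j = v) * z k is"] zv by simp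
        also have "\<dots> \<le> (\<Sum>v<M. e / M)" using l by (intro sum_mono) auto
        also have "\<dots> \<le> e" using e by simp
        finally show False using k by simp
      qed
    qed
    moreover have "finite {k\<in>K. e / M \<le> nrm Z (\<lambda>is. of_bool (is ! j = v) * z k is)}" if "v < M" for v
      using that e by (intro single jm) auto
    ultimately show ?thesis by (meson finite_UN_I finite_lessThan finite_subset lessThan_iff)
  qed
  have key: "\<exists>x\<in>vecs Z. \<exists>\<kappa> A c. nrm Z x \<le> B * real n powr \<rho> \<and> (\<forall>i. \<kappa> i < n) \<and> A \<noteq> {} \<and> A \<subseteq> {..<m} \<and>
      (\<forall>l<n. d / 2 \<le> nrm Z (\<lambda>is. of_bool (\<forall>j<m. if j \<in> A then \<kappa> (is ! j) = l else is ! j = c j) * x is))"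
    if n: "n > 0" for n :: nat
  proof -
    \<comment> \<open>The losses are \<open>2 * \<eta>\<close> for each of at most \<open>m\<close>
      slots that are cut and \<open>2 * \<eta>\<close> for each of fewer than \<open>n\<close>
      foreign humps; this choice makes them at most \<open>d / 2\<close> in total.\<close>
    define \<eta> where "\<eta> = d / (4 * (real m + real n))"
    have mn: "real m + real n > 0" using n by simp
    have \<eta>: "\<eta> > 0" unfolding \<eta>_def using d mn by (intro divide_pos_pos mult_pos_pos) auto
    have \<eta>d: "2 * \<eta> * real m + 2 * \<eta> * real n = d / 2"
    proof -
      have "\<eta> * (4 * (real m + real n)) = d" unfolding \<eta>_def using mn by simp
      then show ?thesis by (simp add: algebra_simps)
    qed
    \<comment> \<open>In every slot of \<open>A\<close>, the array \<open>z k\<close> is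
      concentrated on the indices from \<open>M\<close> up to but excluding \<open>N\<close>, with
      errors at most \<open>\<eta>\<close> on either side.\<close>
    define P where "P = (\<lambda>(k, M, N). k \<in> K \<and> M \<le> N \<and> (\<forall>j\<in>A. nrm Z (\<lambda>is. of_bool (is ! j < M) * z k is) \<le> \<eta> \<and>
        nrm Z (\<lambda>is. of_bool (N \<le> is ! j) * z k is) \<le> \<eta>))"
    have step: "\<exists>k N. q < k \<and> P (k, M, N)" for q M
    proof -
      define bad where "bad = (\<Union>j\<in>A. {k\<in>K. \<eta> < nrm Z (\<lambda>is. of_bool (is ! j < M) * z k is)})"
      have "finite bad" unfolding bad_def by (intro finite_UN_I A(3) initial \<eta>)
      then have "infinite (K - (bad \<union> {..q}))"
        using K by (intro Diff_infinite_finite) auto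
      then obtain k where k': "k \<in> K - (bad \<union> {..q})" using infinite_imp_nonempty by blast
      then have k: "k \<in> K" "q < k" by auto
      have kM: "nrm Z (\<lambda>is. of_bool (is ! j < M) * z k is) \<le> \<eta>" if "j \<in> A" for j
        using k' that by (auto simp: bad_def not_less)
      have "\<forall>\<^sub>F N in sequentially. \<forall>j\<in>A. nrm Z (\<lambda>is. of_bool (N \<le> is ! j) * z k is) \<le> \<eta>"
        unfolding eventually_ball_finite_distrib[OF A(3)] using A(2) \<eta> by (intro ballI tail z) auto
      then have "\<forall>\<^sub>F N in sequentially. (\<forall>j\<in>A. nrm Z (\<lambda>is. of_bool (N \<le> is ! j) * z k is) \<le> \<eta>) \<and> M \<le> N"
        using eventually_ge_at_top by (rule eventually_conj)
      from eventually_happens'[OF sequentially_bot this] obtain N where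
        "\<forall>j\<in>A. nrm Z (\<lambda>is. of_bool (N \<le> is ! j) * z k is) \<le> \<eta>" "M \<le> N" by auto
      with k kM have "q < k \<and> P (k, M, N)" by (simp add: P_def)
      then show ?thesis by blast
    qed
    \<comment> \<open>Each interval starts where the preceding one ends, so the intervals do not
      overlap; the strictly increasing \<open>k\<close> make the summands distinct members of the
      sequence.\<close>
    have "\<exists>f. \<forall>l. P (f l) \<and> (fst (f l) < fst (f (Suc l)) \<and> fst (snd (f (Suc l))) = snd (snd (f l)))"
    proof (rule dependent_nat_choice)
      show "\<exists>x. P x" using step[of 0 0] by blast
      fix x and l :: nat assume "P x"
      obtain k N where "fst x < k \<and> P (k, snd (snd x), N)" using step[of "fst x" "snd (snd x)"] by blast
      then show "\<exists>y. P y \<and> (fst x < fst y \<and> fst (snd y) = snd (snd x))"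
        by (intro exI[of _ "(k, snd (snd x), N)"]) auto
    qed
    then obtain f where f: "\<And>l. P (f l)" "\<And>l. fst (f l) < fst (f (Suc l))" "\<And>l. fst (snd (f (Suc l))) = snd (snd (f l))"
      by blast
    define kk where "kk l = fst (f l)" for l
    define M where "M l = fst (snd (f l))" for l
    have fl: "f l = (kk l, M l, M (Suc l))" for l
      using f(3)[of l] by (simp add: kk_def M_def prod_eq_iff)
    have kK: "kk l \<in> K" and M1: "M l \<le> M (Suc l)"
      and lo: "j \<in> A \<Longrightarrow> nrm Z (\<lambda>is. of_bool (is ! j < M l) * z (kk l) is) \<le> \<eta>"
      and hi: "j \<in> A \<Longrightarrow> nrm Z (\<lambda>is. of_bool (M (Suc l) \<le> is ! j) * z (kk l) is) \<le> \<eta>" for l j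
      using f(1)[of l] unfolding fl P_def by auto
    have "strict_mono kk" unfolding strict_mono_Suc_iff kk_def using f(2) by blast
    then have inj: "inj_on kk {..<n}" by (meson inj_on_subset strict_mono_imp_inj_on subset_UNIV)
    have Mm: "M l \<le> M l'" if "l \<le> l'" for l l' using M1 that by (rule lift_Suc_mono_le)
    \<comment> \<open>Indices outside all \<open>n\<close> intervals get the default label
      \<open>0\<close>. This is harmless, since it is only used that
      \<open>\<kappa> i \<noteq> l\<close> keeps \<open>i\<close> out of the \<open>l\<close>-th
      interval.\<close>
    define \<kappa> where "\<kappa> i = (if \<exists>l<n. M l \<le> i \<and> i < M (Suc l) then SOME l. l < n \<and> M l \<le> i \<and> i < M (Suc l) else 0)" for i
    have \<kappa>n: "\<kappa> i < n" for i
      using someI_ex[of "\<lambda>l. l < n \<and> M l \<le> i \<and> i < M (Suc l)"] n by (auto simp: \<kappa>_def)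
    have \<kappa>l: "\<kappa> i = l" if "l < n" "M l \<le> i" "i < M (Suc l)" for i l
    proof -
      have *: "\<exists>l. l < n \<and> M l \<le> i \<and> i < M (Suc l)" using that by blast
      then have "\<kappa> i = (SOME l. l < n \<and> M l \<le> i \<and> i < M (Suc l))" by (simp add: \<kappa>_def)
      with someI_ex[OF *] have k: "M (\<kappa> i) \<le> i" "i < M (Suc (\<kappa> i))" by auto
      show ?thesis
      proof (rule ccontr)
        assume "\<kappa> i \<noteq> l"
        then consider "Suc (\<kappa> i) \<le> l" | "Suc l \<le> \<kappa> i" by linarith
        then show False
        proof cases
          case 1
          from Mm[OF this] k that show False by linarith
        next
          case 2
          from Mm[OF this] k that show False by linarith
        qed
      qed
    qed
    have off: "nrm Z (\<lambda>is. of_bool (\<kappa> (is ! j) \<noteq> l) * z (kk l) is) \<le> 2 * \<eta>"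
      and off_in: "(\<lambda>is. of_bool (\<kappa> (is ! j) \<noteq> l) * z (kk l) is) \<in> vecs Z"
      if j: "j \<in> A" and l: "l < n" for j l
    proof -
      have jm: "j < m" using j A by auto
      note b = contractiveD[OF box1[OF jm, of "\<lambda>i. \<kappa> i \<noteq> l"]]
      show "(\<lambda>is. of_bool (\<kappa> (is ! j) \<noteq> l) * z (kk l) is) \<in> vecs Z" by (rule b(1)[OF z])
      note u = contractiveD(1)[OF box1[OF jm, of "\<lambda>i. i < M l"] z]
        and v = contractiveD(1)[OF box1[OF jm, of "\<lambda>i. M (Suc l) \<le> i"] z]
      have eq: "(\<lambda>is. of_bool (\<kappa> (is ! j) \<noteq> l) * z (kk l) is)
        = (\<lambda>is. of_bool (\<kappa> (is ! j) \<noteq> l) * (of_bool (is ! j < M l) * z (kk l) is)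
            + of_bool (\<kappa> (is ! j) \<noteq> l) * (of_bool (M (Suc l) \<le> is ! j) * z (kk l) is))"
      proof
        fix "is"
        show "of_bool (\<kappa> (is ! j) \<noteq> l) * z (kk l) is
          = of_bool (\<kappa> (is ! j) \<noteq> l) * (of_bool (is ! j < M l) * z (kk l) is)
            + of_bool (\<kappa> (is ! j) \<noteq> l) * (of_bool (M (Suc l) \<le> is ! j) * z (kk l) is)"
          using \<kappa>l[OF l, of "is ! j"] M1[of l] by (auto simp: not_le not_less)
      qed
      show "nrm Z (\<lambda>is. of_bool (\<kappa> (is ! j) \<noteq> l) * z (kk l) is) \<le> 2 * \<eta>"
        unfolding eq using triangle[OF b(1)[OF u] b(1)[OF v], of "kk l" "kk l"] b(2)[OF u, of "kk l"] b(2)[OF v, of "kk l"] lo[OF j, of l] hi[OF j, of l]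
        by linarith
    qed
    define p where "p l is = (of_bool (\<forall>j<m. if j \<in> A then \<kappa> (is ! j) = l else is ! j = c j) :: complex)" for l "is"
    have pc: "contractive Z (p l)" for l
      unfolding p_def[abs_def] by (rule box)
    note pd = contractiveD[OF pc]
    \<comment> \<open>The multiplier \<open>p l\<close> already freezes the slots of
      \<open>C\<close>, so the original array and its frozen part agree under it.\<close>
    have pQ: "p l is * y k is = p l is * z k is" for l k "is"
      using Cm by (auto simp: p_def z_def Q_def A_def)
    \<comment> \<open>The slots of \<open>A\<close> are cut down to the \<open>l\<close>-th label
      one after the other, at the price of \<open>2 * \<eta>\<close> each.\<close>
    have diag: "nrm Z (z (kk l)) - 2 * \<eta> * real (card D) \<le> nrm Z (\<lambda>is. of_bool (\<forall>j\<in>D. \<kappa> (is ! j) = l) * z (kk l) is)"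
      if l: "l < n" and D: "finite D" "D \<subseteq> A" for l D
      using D
    proof (induction D rule: finite_induct)
      case (insert j D)
      have jA: "j \<in> A" and DA: "D \<subseteq> {..<m}" "insert j D \<subseteq> {..<m}" using insert A by auto
      note bD = contractiveD[OF boxB[OF DA(1), of "\<lambda>_ i. \<kappa> i = l"]]
      note bj = contractiveD(1)[OF boxB[OF DA(2), of "\<lambda>_ i. \<kappa> i = l"] z]
      have eq: "(\<lambda>is. of_bool (\<forall>j\<in>D. \<kappa> (is ! j) = l) * z (kk l) is)
        = (\<lambda>is. of_bool (\<forall>j\<in>insert j D. \<kappa> (is ! j) = l) * z (kk l) is +
            of_bool (\<forall>j\<in>D. \<kappa> (is ! j) = l) * (of_bool (\<kappa> (is ! j) \<noteq> l) * z (kk l) is))"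
        by auto
      have "nrm Z (\<lambda>is. of_bool (\<forall>j\<in>D. \<kappa> (is ! j) = l) * z (kk l) is)
        \<le> nrm Z (\<lambda>is. of_bool (\<forall>j\<in>insert j D. \<kappa> (is ! j) = l) * z (kk l) is) + 2 * \<eta>"
        unfolding eq using triangle[OF bj bD(1)[OF off_in[OF jA l]]] bD(2)[OF off_in[OF jA l]] off[OF jA l]
        by (meson add_left_mono order_trans)
      moreover have "nrm Z (z (kk l)) - 2 * \<eta> * real (card D) \<le> nrm Z (\<lambda>is. of_bool (\<forall>j\<in>D. \<kappa> (is ! j) = l) * z (kk l) is)"
        using insert by blast
      moreover have "real (card (insert j D)) = real (card D) + 1" using insert by simp
      ultimately show ?case by (simp only: distrib_left)
    qed simp
    define x where "x = (\<lambda>is. \<Sum>l<n. y (kk l) is)"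
    have x: "x \<in> vecs Z" unfolding x_def by (intro sum_in y) simp
    have "x = (\<lambda>is. \<Sum>k\<in>kk ` {..<n}. 1 * y k is)" unfolding x_def by (simp add: sum.reindex[OF inj])
    then have x1: "nrm Z x \<le> B * real n powr \<rho>"
      using upper[of "kk ` {..<n}" "\<lambda>_. 1"] by (simp add: card_image[OF inj])
    have x2: "d / 2 \<le> nrm Z (\<lambda>is. p l is * x is)" if l: "l < n" for l
    proof -
      obtain j0 where j0: "j0 \<in> A" using A by blast
      let ?R = "\<lambda>is. \<Sum>i\<in>{..<n} - {l}. p l is * z (kk i) is"
      have R: "?R \<in> vecs Z" by (intro sum_in pd z) simp
      \<comment> \<open>For a foreign hump one slot is enough: \<open>p l\<close> forces the label
        \<open>l \<noteq> i\<close> in slot \<open>j0\<close>, where \<open>z (kk i)\<close> is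
        small off its own label.\<close>
      have ne: "nrm Z (\<lambda>is. p l is * z (kk i) is) \<le> 2 * \<eta>" if "i \<in> {..<n} - {l}" for i
      proof -
        have eq: "(\<lambda>is. p l is * z (kk i) is) = (\<lambda>is. p l is * (of_bool (\<kappa> (is ! j0) \<noteq> i) * z (kk i) is))"
          using that j0 A by (auto simp: p_def fun_eq_iff)
        show ?thesis unfolding eq using that by (intro order_trans[OF pd(2)] off off_in j0) auto
      qed
      have "nrm Z ?R \<le> (\<Sum>i\<in>{..<n} - {l}. nrm Z (\<lambda>is. p l is * z (kk i) is))"
        by (intro nrm_sum pd z) simp
      also have "\<dots> \<le> (\<Sum>i\<in>{..<n} - {l}. 2 * \<eta>)" by (intro sum_mono ne)
      also have "\<dots> \<le> 2 * \<eta> * real n" using \<eta> card_mono[of "{..<n}" "{..<n} - {l}"] by simp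
      finally have nR: "nrm Z ?R \<le> 2 * \<eta> * real n" .
      have "(\<lambda>is. p l is * z (kk l) is) = (\<lambda>is. of_bool (\<forall>j\<in>A. \<kappa> (is ! j) = l) * z (kk l) is)"
        using A(2) Cm by (auto simp: p_def z_def Q_def A_def fun_eq_iff)
      then have "nrm Z (z (kk l)) - 2 * \<eta> * real (card A) \<le> nrm Z (\<lambda>is. p l is * z (kk l) is)"
        using diag[OF l A(3) order_refl] by simp
      moreover have "d \<le> nrm Z (z (kk l))" using dK[OF kK] by (simp add: z_def)
      moreover have "2 * \<eta> * real (card A) \<le> 2 * \<eta> * real m"
        using \<eta> card_mono[OF _ A(2)] by (intro mult_left_mono) auto
      ultimately have zl: "d - 2 * \<eta> * real m \<le> nrm Z (\<lambda>is. p l is * z (kk l) is)" by linarith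
      have eq: "(\<lambda>is. p l is * x is) = (\<lambda>is. p l is * z (kk l) is + ?R is)"
        unfolding x_def sum_distrib_left pQ using l by (simp add: sum.remove)
      have "nrm Z (\<lambda>is. p l is * z (kk l) is) \<le> nrm Z (\<lambda>is. p l is * x is) + nrm Z ?R"
      proof -
        have "(\<lambda>is. p l is * x is - ?R is) = (\<lambda>is. p l is * z (kk l) is)"
          using fun_cong[OF eq] by (intro ext) simp
        with nrm_diff_triangle[OF pd(1)[OF x] R, of l] show ?thesis by simp
      qed
      then show ?thesis using zl nR \<eta>d by linarith
    qed
    show ?thesis
      using x x1 x2 \<kappa>n A(1,2) unfolding p_def by (intro bexI[of _ x] exI[of _ \<kappa>] exI[of _ A] exI[of _ c] conjI allI impI)
  qed
  show ?thesis by (rule that[of "d / 2"]) (use d key in auto)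
qed

subsection \<open>Comparison of the growth rates\<close>

theorem theorem2p5:
  fixes m :: nat and p0 p1 \<theta> p\<theta> :: real
  assumes "m \<ge> 3"
    and "1 \<le> p0" and "p0 < conj_exponent (real m)" and "conj_exponent (real m) < p1"
    and "0 < \<theta>" and "\<theta> < 1"
    and "1 / p\<theta> = (1 - \<theta>) / p0 + \<theta> / p1"
  shows "\<not> isomorphic
    (complex_interpolation (ell_inj_tensor m p0) (ell_inj_tensor m p1) \<theta>)
    (ell_inj_tensor m p\<theta>)"
proof
  let ?X0 = "ell_inj_tensor m p0" and ?X1 = "ell_inj_tensor m p1" and ?Y = "ell_inj_tensor m p\<theta>"
  let ?Z = "complex_interpolation ?X0 ?X1 \<theta>"
  assume "isomorphic ?Z ?Y"
  then obtain T C1 C2 where T: "bij_betw T (vecs ?Z) (vecs ?Y)"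
    and Tadd: "\<And>x y. x \<in> vecs ?Z \<Longrightarrow> y \<in> vecs ?Z \<Longrightarrow> T (\<lambda>i. x i + y i) = (\<lambda>j. T x j + T y j)"
    and Tscale: "\<And>c x. x \<in> vecs ?Z \<Longrightarrow> T (\<lambda>i. c * x i) = (\<lambda>j. c * T x j)"
    and C1: "\<And>x. x \<in> vecs ?Z \<Longrightarrow> nrm ?Y (T x) \<le> C1 * nrm ?Z x"
    and C2: "\<And>x. x \<in> vecs ?Z \<Longrightarrow> nrm ?Z x \<le> C2 * nrm ?Y (T x)"
    unfolding isomorphic_def by blast
  have m: "real m \<ge> 3" "m > 0" using assms(1) by auto
  have ms: "conj_exponent (real m) > 1" using m by (simp add: conj_exponent_def field_simps)
  have p: "p0 > 0" "p1 > 1" "p1 > 0" using assms ms by auto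
  define s where "s q = 1 - real m * (1 - 1 / q)" for q
  have s0: "s p0 > 0"
  proof -
    have "p0 * (real m - 1) < real m" using assms(3) m by (simp add: conj_exponent_def pos_less_divide_eq)
    then have "s p0 * p0 > 0" using p by (simp add: s_def algebra_simps)
    then show ?thesis using p by (simp add: zero_less_mult_iff)
  qed
  have s1: "s p1 < 0"
  proof -
    have "real m < p1 * (real m - 1)" using assms(4) m by (simp add: conj_exponent_def pos_divide_less_eq)
    then have "s p1 * p1 < 0" using p by (simp add: s_def algebra_simps)
    then show ?thesis using p by (simp add: mult_less_0_iff)
  qed
  have ip: "1 / p\<theta> < 1" "0 < 1 / p\<theta>"
  proof -
    have "(1 - \<theta>) / p0 \<le> 1 - \<theta>" using assms(2,6) p by (simp add: divide_le_eq)
    moreover have "\<theta> / p1 < \<theta>" using assms(5) p by (simp add: divide_less_eq)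
    ultimately show "1 / p\<theta> < 1" using assms(7) by linarith
    show "0 < 1 / p\<theta>" unfolding assms(7) using assms(5,6) p by (intro add_pos_pos divide_pos_pos) auto
  qed
  then have p\<theta>: "p\<theta> > 1" by (simp add: divide_less_eq split: if_splits)
  define \<rho> where "\<rho> = max 0 (s p\<theta>)"
  have "s p\<theta> = (1 - \<theta>) * s p0 + \<theta> * s p1"
    unfolding s_def assms(7) by (simp add: algebra_simps add_divide_distrib diff_divide_distrib)
  moreover have "\<theta> * s p1 < 0" using s1 assms(5) by (simp add: mult_pos_neg)
  moreover have "(1 - \<theta>) * s p0 > 0" using s0 assms(6) by simp
  \<comment> \<open>The two cases of the maximum rest on different endpoints:
    \<open>s p0 > 0\<close> makes the right-hand side positive, and \<open>s p1 < 0\<close> puts it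
    above \<open>s p\<theta>\<close>.\<close>
  ultimately have \<rho>s: "\<rho> < (1 - \<theta>) * s p0" by (simp add: \<rho>_def)
  have "real m * (1 - 1 / p\<theta>) > 0" using m ip by simp
  then have \<rho>1: "\<rho> < 1" by (simp add: \<rho>_def s_def)
  interpret couple ?X0 ?X1
    by (intro couple.intro seminormed_tensor p)
  interpret Y: seminormed ?Y using p\<theta> by (intro seminormed_tensor) simp
  define y where "y k = inv_into (vecs ?Z) T (diag_unit m k)" for k
  have y: "y k \<in> vecs ?Z" and Ty: "T (y k) = diag_unit m k" for k
    using bij_betwE[OF bij_betw_inv_into[OF T]] bij_betw_inv_into_right[OF T] nrm_diag_unit_ge(1)[OF p\<theta> m(2), of k]
    by (auto simp: y_def)
  have T0: "T (\<lambda>i. 0) = (\<lambda>j. 0)" using Tscale[OF Z.zero, of 0] by simp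
  have Tsum: "T (\<lambda>i. \<Sum>k\<in>F. \<epsilon> k * y k i) = (\<lambda>j. \<Sum>k\<in>F. \<epsilon> k * diag_unit m k j)" if "finite F" for F \<epsilon>
    using that
  proof (induction F rule: finite_induct)
    case empty
    then show ?case using T0 by simp
  next
    case (insert a F)
    have "(\<lambda>i. \<Sum>k\<in>F. \<epsilon> k * y k i) \<in> vecs ?Z" by (intro Z.sum_in insert Z.scale y)
    from Tadd[OF Z.scale[OF y] this, of "\<epsilon> a" a] insert show ?case by (simp add: Tscale[OF y] Ty)
  qed
  \<comment> \<open>The constants of an isomorphism are not assumed positive; the maximum with
    \<open>1\<close> provides that, here and in \<open>\<delta>\<close>.\<close>
  define B where "B = max C2 1 * real m"
  have B: "B > 0" using m by (simp add: B_def)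
  have upper: "nrm ?Z (\<lambda>i. \<Sum>k\<in>F. \<epsilon> k * y k i) \<le> B * real (card F) powr \<rho>"
    if F: "finite F" and \<epsilon>: "\<And>k. norm (\<epsilon> k) \<le> 1" for F \<epsilon>
  proof -
    note d = diag_unit_sum[OF p\<theta> m(2) F, of \<epsilon>, OF \<epsilon>]
    have "(\<lambda>i. \<Sum>k\<in>F. \<epsilon> k * y k i) \<in> vecs ?Z" by (intro Z.sum_in F Z.scale y)
    from C2[OF this] have "nrm ?Z (\<lambda>i. \<Sum>k\<in>F. \<epsilon> k * y k i) \<le> C2 * nrm ?Y (\<lambda>j. \<Sum>k\<in>F. \<epsilon> k * diag_unit m k j)"
      unfolding Tsum[OF F] .
    also have "\<dots> \<le> max C2 1 * nrm ?Y (\<lambda>j. \<Sum>k\<in>F. \<epsilon> k * diag_unit m k j)"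
      by (intro mult_right_mono Y.nonneg d) auto
    also have "\<dots> \<le> max C2 1 * (real m * real (card F) powr \<rho>)"
      using d(2) unfolding \<rho>_def s_def by (intro mult_left_mono) auto
    finally show ?thesis by (simp add: B_def)
  qed
  define \<delta> where "\<delta> = 1 / max C1 1"
  have lower: "\<delta> \<le> nrm ?Z (y k)" for k
  proof -
    have "1 \<le> C1 * nrm ?Z (y k)" using C1[OF y, of k] nrm_diag_unit_ge(2)[OF p\<theta> m(2), of k] by (simp add: Ty)
    also have "\<dots> \<le> max C1 1 * nrm ?Z (y k)" by (intro mult_right_mono Z.nonneg y) auto
    finally show ?thesis by (simp add: \<delta>_def divide_le_eq mult.commute)
  qed
  have box: "contractive ?X0 (\<lambda>is. of_bool (\<forall>j<m. P j (is ! j)))" "contractive ?X1 (\<lambda>is. of_bool (\<forall>j<m. P j (is ! j)))" for P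
    by (intro contractive_tensor_bool p)+
  have box1: "contractive ?X0 (\<lambda>is. of_bool (P (is ! j)))" "contractive ?X1 (\<lambda>is. of_bool (P (is ! j)))" if "j < m" for P j
  proof -
    have "(\<lambda>is. of_bool (P (is ! j)) :: complex) = (\<lambda>is. of_bool (\<forall>l<m. l = j \<longrightarrow> P (is ! l)))"
      using that by (intro ext arg_cong[where f = of_bool]) auto
    then show "contractive ?X0 (\<lambda>is. of_bool (P (is ! j)))" "contractive ?X1 (\<lambda>is. of_bool (P (is ! j)))"
      using box[of "\<lambda>l i. l = j \<longrightarrow> P i"] by simp_all
  qed
  obtain \<delta>' where \<delta>': "\<delta>' > 0" and
    hump: "\<And>n. n > 0 \<Longrightarrow> \<exists>x\<in>vecs ?Z. \<exists>\<kappa> A c. nrm ?Z x \<le> B * real n powr \<rho> \<and> (\<forall>i. \<kappa> i < n) \<and> A \<noteq> {} \<and> A \<subseteq> {..<m} \<and>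
      (\<forall>l<n. \<delta>' \<le> nrm ?Z (\<lambda>is. of_bool (\<forall>j<m. if j \<in> A then \<kappa> (is ! j) = l else is ! j = c j) * x is))"
  proof (rule gliding_hump[of ?Z m y \<delta> B \<rho>])
    show "contractive ?Z (\<lambda>is. of_bool (\<forall>j<m. P j (is ! j)))" for P
      by (intro contractive_interpolation box)
    show "\<forall>\<^sub>F N in sequentially. nrm ?Z (\<lambda>is. of_bool (N \<le> is ! j) * x is) \<le> e"
      if "x \<in> vecs ?Z" "j < m" "e > 0" for x j e
      using that by (intro interpolation_tail box1 tensor_tail p)
    show "x is = 0" if x: "x \<in> vecs ?Z" and l: "length is \<noteq> m" for x "is"
    proof -
      have "x \<in> vecs (sum_space ?X0 ?X1)"
        using x calderon_funD(1)[of _ "of_real \<theta>"] assms(5,6) by (auto simp: complex_interpolation_def strip_def)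
      then obtain v w where "v \<in> vecs ?X0" "w \<in> vecs ?X1" "x = (\<lambda>i. v i + w i)"
        by (auto simp: sum_space_def)
      then show ?thesis using ell_inj_tensor_length[OF _ l, of v p0] ell_inj_tensor_length[OF _ l, of w p1] by simp
    qed
    show "\<delta> > 0" by (simp add: \<delta>_def)
  qed (use y lower upper \<rho>1 Z.seminormed_axioms in auto)
  define c0 where "c0 = (1 + 4 / \<theta>) powr (1 - \<theta>)"
  \<comment> \<open>The constants of the final comparison, collected in advance:
    \<open>2 * exp 4\<close> comes from \<open>interpolation_lower_estimate\<close>, the remaining
    factor \<open>2\<close> from \<open>D\<close>, and \<open>c0\<close> from the value of the outer
    function.\<close>
  obtain n :: nat where n: "n > 0" "(4 * exp 4 * B * c0) * real n powr \<rho> < \<delta>' * real n powr ((1 - \<theta>) * s p0)"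
    by (rule powr_dominates[OF \<rho>s \<delta>'])
  obtain x \<kappa> A c where x: "x \<in> vecs ?Z" "nrm ?Z x \<le> B * real n powr \<rho>" and \<kappa>: "\<And>i. \<kappa> i < n" and A: "A \<noteq> {}" "A \<subseteq> {..<m}"
    and xl: "\<And>l. l < n \<Longrightarrow> \<delta>' \<le> nrm ?Z (\<lambda>is. of_bool (\<forall>j<m. if j \<in> A then \<kappa> (is ! j) = l else is ! j = c j) * x is)"
    using hump[OF n(1)] by blast
  obtain j0 where j0: "j0 \<in> A" using A by blast
  define L where "L = real n powr (real m * (1 - 1 / p0))"
  \<comment> \<open>Twice the bound for the norm of \<open>x\<close>: the interpolation norm is an
    infimum, so a representing function is available only for strictly larger numbers.\<close>
  define D where "D = 2 * B * real n powr \<rho>"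
  have D: "D > 0" and L: "L > 0" using B n by (auto simp: D_def L_def)
  have "nrm ?Z x < D" using x(2) D unfolding D_def by linarith
  then obtain f where f: "f \<in> calderon_fun ?X0 ?X1" "f (of_real \<theta>) = x" "calderon_norm ?X0 ?X1 f < D"
    by (rule interpolation_nrm_less[OF x(1)])
  have "\<exists>l<n. nrm ?Z (\<lambda>is. of_bool (\<forall>j<m. if j \<in> A then \<kappa> (is ! j) = l else is ! j = c j) * f (of_real \<theta>) is)
      \<le> 2 * exp 4 * D * ((1 + 4 / \<theta>) * L / real n) powr (1 - \<theta>)"
  proof (rule interpolation_lower_estimate[OF f(1) less_imp_le[OF f(3)] D assms(5,6) n(1) L])
    show "contractive ?X0 (\<lambda>is. of_bool (\<forall>j<m. if j \<in> A then \<kappa> (is ! j) = l else is ! j = c j))"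
      "contractive ?X1 (\<lambda>is. of_bool (\<forall>j<m. if j \<in> A then \<kappa> (is ! j) = l else is ! j = c j))" for l
      using box[of "\<lambda>j i. if j \<in> A then \<kappa> i = l else i = c j"] by simp_all
    show "(\<Sum>l<n. nrm ?X0 (\<lambda>is. of_bool (\<forall>j<m. if j \<in> A then \<kappa> (is ! j) = l else is ! j = c j) * v is)) \<le> L * nrm ?X0 v"
      if "v \<in> vecs ?X0" for v
      unfolding L_def by (rule block_lower_estimate[OF assms(2) n(1) \<kappa> j0 A(2) that])
  qed
  then obtain l where "l < n" and "nrm ?Z (\<lambda>is. of_bool (\<forall>j<m. if j \<in> A then \<kappa> (is ! j) = l else is ! j = c j) * x is)
      \<le> 2 * exp 4 * D * ((1 + 4 / \<theta>) * L / real n) powr (1 - \<theta>)"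
    unfolding f(2) by blast
  with xl have "\<delta>' \<le> 2 * exp 4 * D * ((1 + 4 / \<theta>) * L / real n) powr (1 - \<theta>)" by (meson order_trans)
  also have "((1 + 4 / \<theta>) * L / real n) powr (1 - \<theta>) = c0 * real n powr (- ((1 - \<theta>) * s p0))"
  proof -
    have "L / real n = real n powr (real m * (1 - 1 / p0) - 1)"
      using n by (simp add: L_def powr_diff)
    also have "real m * (1 - 1 / p0) - 1 = - s p0" by (simp add: s_def)
    finally have "(1 + 4 / \<theta>) * L / real n = (1 + 4 / \<theta>) * real n powr (- s p0)"
      by (simp only: times_divide_eq_right[symmetric])
    then show ?thesis
      using assms(5) by (simp only: c0_def) (simp add: powr_mult powr_powr mult.commute)
  qed
  also have "2 * exp 4 * D * (c0 * real n powr (- ((1 - \<theta>) * s p0)))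
      = (4 * exp 4 * B * c0) * real n powr \<rho> * real n powr (- ((1 - \<theta>) * s p0))" by (simp add: D_def)
  finally have "\<delta>' * real n powr ((1 - \<theta>) * s p0)
      \<le> (4 * exp 4 * B * c0) * real n powr \<rho> * real n powr (- ((1 - \<theta>) * s p0)) * real n powr ((1 - \<theta>) * s p0)"
    by (intro mult_right_mono) auto
  also have "\<dots> = (4 * exp 4 * B * c0) * real n powr \<rho>"
    using n by (simp add: mult.assoc powr_add[symmetric])
  finally show False using n(2) by linarith
qed

end
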